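(* Let $G$ be a second countable compact group and let $G_0$ be a closed subgroup of $G$ with finite index $[G:G_0]<+\infty$. Then the set $\mathcal{K}(\hat{G}\cup\widehat{G_0})$, equipped with the convolution $*$ defined in the context, is a (discrete) hypergroup if and only if $(G,G_0)$ is an admissible pair.
   Context: For a compact group $G$, $\hat G$ denotes the set of equivalence classes of (continuous, complex) irreducible representations of $G$ and $\mathrm{Rep}^{\rm f}(G)$ the set of equivalence classes of finite-dimensional representations. For $\pi\in\mathrm{Rep}^{\rm f}(G)$ the normalized character is $ch(\pi)(g)=\frac{1}{\dim\pi}\mathrm{tr}(\pi(g))$, $g\in G$. Then $ch(\pi_i\otimes\pi_j)=ch(\pi_i)ch(\pi_j)$. Admissible pair: for $g\in G_0$ put $X(g)=\{s\in G: sgs^{-1}\in G_0\}$. $(G,G_0)$ is an admissible pair if $ch(\tau)(sgs^{-1})=ch(\tau)(g)$ for all $\tau\in\widehat{G_0}$, all $g\in G_0$ and all $s\in X(g)$. The set: $\mathcal{K}(\hat{G}\cup\widehat{G_0})=\{(ch(\pi),\circ),(ch(\tau),\bullet):\pi\in\hat G,\ \tau\in\widehat{G_0}\}$ (a disjoint union, with discrete topology). If $\sigma\in\mathrm{Rep}^{\rm f}(G)$ decomposes as $\sigma\cong\bigoplus_k m_k\sigma_k$ with distinct $\sigma_k\in\hat G$, then $ch(\sigma)=\sum_k\frac{m_k\dim\sigma_k}{\dim\sigma}ch(\sigma_k)$, and $(ch(\sigma),\circ)$ is understood as the finitely supported probability measure on $\mathcal{K}(\hat{G}\cup\widehat{G_0})$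 giving mass $\frac{m_k\dim\sigma_k}{\dim\sigma}$ to $(ch(\sigma_k),\circ)$; similarly $(ch(\sigma),\bullet)$ for $\sigma\in\mathrm{Rep}^{\rm f}(G_0)$. A point is identified with its Dirac measure. Convolution: for $\pi_i,\pi_j,\pi\in\hat G$ and $\tau_i,\tau_j,\tau\in\widehat{G_0}$, $(ch(\pi_i),\circ)*(ch(\pi_j),\circ)=(ch(\pi_i)ch(\pi_j),\circ)$; $(ch(\pi),\circ)*(ch(\tau),\bullet)=(ch(\mathrm{res}_{G_0}^G\pi)\,ch(\tau),\bullet)$; $(ch(\tau),\bullet)*(ch(\pi),\circ)=(ch(\tau)\,ch(\mathrm{res}_{G_0}^G\pi),\bullet)$; $(ch(\tau_i),\bullet)*(ch(\tau_j),\bullet)=(ch(\mathrm{ind}_{G_0}^G(\tau_i\otimes\tau_j)),\circ)$, extended bilinearly (and continuously) to bounded measures, where $\mathrm{res}$ and $\mathrm{ind}$ are restriction and induction of representations. Hypergroup (discrete case): a set $K$ with discrete topology and a convolution $*$ is a hypergroup if: for all $x,y\in K$, $\delta_x*\delta_y$ is a finitely supported probability measure on $K$; the bilinear extension of $*$ to bounded measures on $K$ is associative (so that $M^b(K)=\ell^1(K)$ is a Banach algebra); there is a unit $e\in K$ with $\delta_e*\delta_x=\delta_x*\delta_e=\delta_x$ for all $x$; and there is an involution $x\mapsto x^-$ of $K$ (with $(x^-)^-=x$), extended to measures by push-forward, such that $\delta_{x^-}*\delta_{y^-}=(\delta_y*\delta_x)^-$ and $e\in\mathrm{supp}(\delta_x*\delta_y)$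 if and only if $x=y^-$, for all $x,y\in K$. *)

theory Defs
  imports
    "HOL-Analysis.Abstract_Topological_Spaces"
    "HOL-Analysis.Infinite_Sum"
    "HOL-Algebra.Coset"
    "Jordan_Normal_Form.VS_Connect"
begin

section \<open>Topological groups\<close>

definition topological_group :: "('a, 'b) monoid_scheme \<Rightarrow> 'a topology \<Rightarrow> bool" where
  "topological_group G T \<longleftrightarrow>
     group G \<and> topspace T = carrier G \<and>
     continuous_map (prod_topology T T) T (\<lambda>(x, y). x \<otimes>\<^bsub>G\<^esub> y) \<and>
     continuous_map T T (\<lambda>x. inv\<^bsub>G\<^esub> x)"

text \<open>Compact groups are Hausdorff.\<close>

definition compact_group :: "('a, 'b) monoid_scheme \<Rightarrow> 'a topology \<Rightarrow> bool" where
  "compact_group G T \<longleftrightarrow> topological_group G T \<and> compact_space T \<and> Hausdorff_space T"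

abbreviation subgroup_of :: "('a, 'b) monoid_scheme \<Rightarrow> 'a set \<Rightarrow> ('a, 'b) monoid_scheme" where
  "subgroup_of G H \<equiv> G\<lparr>carrier := H\<rparr>"


section \<open>Finite-dimensional representations\<close>

text \<open>
  Representations are matrix representations on the spaces \<open>carrier_vec n\<close>, with \<open>n > 0\<close>
  because the normalized character divides by the dimension. Values outside the carrier of the
  group are irrelevant. The irreducible representations of a compact group are all
  finite-dimensional, so nothing is lost by requiring this in \<open>irr_rep\<close>.
\<close>

type_synonym 'a rep = "'a \<Rightarrow> complex mat"

definition rep_dim :: "('a, 'b) monoid_scheme \<Rightarrow> 'a rep \<Rightarrow> nat" where
  "rep_dim G \<pi> = dim_row (\<pi> \<one>\<^bsub>G\<^esub>)"

definition fd_rep :: "('a, 'b) monoid_scheme \<Rightarrow> 'a topology \<Rightarrow> 'a rep \<Rightarrow> bool" where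
  "fd_rep G T \<pi> \<longleftrightarrow>
     (let n = rep_dim G \<pi> in
        0 < n \<and>
        (\<forall>g\<in>carrier G. \<pi> g \<in> carrier_mat n n) \<and>
        \<pi> \<one>\<^bsub>G\<^esub> = 1\<^sub>m n \<and>
        (\<forall>g\<in>carrier G. \<forall>h\<in>carrier G. \<pi> (g \<otimes>\<^bsub>G\<^esub> h) = \<pi> g * \<pi> h) \<and>
        (\<forall>i<n. \<forall>j<n. continuous_map T euclidean (\<lambda>g. \<pi> g $$ (i, j))))"

definition invariant_subspace :: "('a, 'b) monoid_scheme \<Rightarrow> 'a rep \<Rightarrow> complex vec set \<Rightarrow> bool" where
  "invariant_subspace G \<pi> W \<longleftrightarrow>
     VectorSpace.subspace class_ring W (module_vec TYPE(complex) (rep_dim G \<pi>)) \<and>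
     (\<forall>g\<in>carrier G. \<forall>v\<in>W. \<pi> g *\<^sub>v v \<in> W)"

definition irr_rep :: "('a, 'b) monoid_scheme \<Rightarrow> 'a topology \<Rightarrow> 'a rep \<Rightarrow> bool" where
  "irr_rep G T \<pi> \<longleftrightarrow>
     fd_rep G T \<pi> \<and>
     (\<forall>W. invariant_subspace G \<pi> W \<longrightarrow>
        W = {0\<^sub>v (rep_dim G \<pi>)} \<or> W = carrier_vec (rep_dim G \<pi>))"

definition rep_equiv :: "('a, 'b) monoid_scheme \<Rightarrow> 'a rep \<Rightarrow> 'a rep \<Rightarrow> bool" where
  "rep_equiv G \<pi> \<sigma> \<longleftrightarrow>
     rep_dim G \<pi> = rep_dim G \<sigma> \<and>
     (\<exists>P \<in> carrier_mat (rep_dim G \<pi>) (rep_dim G \<pi>).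
        invertible_mat P \<and> (\<forall>g\<in>carrier G. P * \<pi> g = \<sigma> g * P))"

definition mat_trace :: "complex mat \<Rightarrow> complex" where
  "mat_trace A = (\<Sum>i<dim_row A. A $$ (i, i))"

text \<open>Characters are extensional, so that they are functions on the carrier only.\<close>

definition ch :: "('a, 'b) monoid_scheme \<Rightarrow> 'a rep \<Rightarrow> 'a \<Rightarrow> complex" where
  "ch G \<pi> = (\<lambda>g\<in>carrier G. mat_trace (\<pi> g) / of_nat (rep_dim G \<pi>))"

definition tensor_mat :: "complex mat \<Rightarrow> complex mat \<Rightarrow> complex mat" where
  "tensor_mat A B =
     mat (dim_row A * dim_row B) (dim_col A * dim_col B)
       (\<lambda>(i, j). A $$ (i div dim_row B, j div dim_col B) * B $$ (i mod dim_row B, j mod dim_col B))"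

definition tensor_rep :: "'a rep \<Rightarrow> 'a rep \<Rightarrow> 'a rep" where
  "tensor_rep \<pi> \<sigma> = (\<lambda>g. tensor_mat (\<pi> g) (\<sigma> g))"

definition res_rep :: "'a set \<Rightarrow> 'a rep \<Rightarrow> 'a rep" where
  "res_rep H \<pi> = restrict \<pi> H"

text \<open>
  The representation of \<open>G\<close> induced from a representation \<open>\<tau>\<close> of \<open>H\<close> on \<open>V\<close> is right translation
  \<open>(g f)(x) = f (x g)\<close> on the space of all \<open>f : G \<rightarrow> V\<close> with \<open>f (h x) = \<tau> h (f x)\<close> for \<open>h \<in> H\<close>;
  such \<open>f\<close> are automatically continuous, as a closed subgroup of finite index is open.
  In the coordinates \<open>f \<mapsto> (f t\<^sub>0, \<dots>, f t\<^sub>m)\<close> given by a right transversal of \<open>H\<close>, the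
  element \<open>g\<close> acts by the block matrix whose block \<open>(k, l)\<close> is \<open>\<tau> (t\<^sub>k g t\<^sub>l\<^sup>-\<^sup>1)\<close>, or \<open>0\<close> if
  \<open>t\<^sub>k g t\<^sub>l\<^sup>-\<^sup>1 \<notin> H\<close>. Up to equivalence this does not depend on the transversal.
\<close>

definition right_transversal :: "('a, 'b) monoid_scheme \<Rightarrow> 'a set \<Rightarrow> 'a list \<Rightarrow> bool" where
  "right_transversal G H ts \<longleftrightarrow>
     distinct ts \<and> set ts \<subseteq> carrier G \<and>
     bij_betw (\<lambda>t. H #>\<^bsub>G\<^esub> t) (set ts) (rcosets\<^bsub>G\<^esub> H)"

definition ind_rep :: "('a, 'b) monoid_scheme \<Rightarrow> 'a set \<Rightarrow> 'a rep \<Rightarrow> 'a rep" where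
  "ind_rep G H \<tau> = (\<lambda>g.
     let ts = (SOME ts. right_transversal G H ts);
         n = rep_dim (subgroup_of G H) \<tau>
     in mat (length ts * n) (length ts * n)
          (\<lambda>(i, j). let x = ts ! (i div n) \<otimes>\<^bsub>G\<^esub> g \<otimes>\<^bsub>G\<^esub> inv\<^bsub>G\<^esub> (ts ! (j div n))
                    in if x \<in> H then \<tau> x $$ (i mod n, j mod n) else 0))"


section \<open>The measure attached to a character\<close>

text \<open>
  A list \<open>[(m\<^sub>1, \<sigma>\<^sub>1), \<dots>]\<close> decomposes \<open>\<sigma>\<close> if \<open>\<sigma>\<close> is equivalent to the direct sum of the
  \<open>m\<^sub>k \<sigma>\<^sub>k\<close>, where the \<open>\<sigma>\<^sub>k\<close> are irreducible and pairwise inequivalent.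
\<close>

definition decomposition ::
    "('a, 'b) monoid_scheme \<Rightarrow> 'a topology \<Rightarrow> 'a rep \<Rightarrow> (nat \<times> 'a rep) list \<Rightarrow> bool" where
  "decomposition G T \<sigma> ks \<longleftrightarrow>
     (\<forall>(m, \<rho>)\<in>set ks. 0 < m \<and> irr_rep G T \<rho>) \<and>
     (\<forall>i<length ks. \<forall>j<length ks. i \<noteq> j \<longrightarrow> \<not> rep_equiv G (snd (ks ! i)) (snd (ks ! j))) \<and>
     rep_equiv G \<sigma> (\<lambda>g. diag_block_mat (concat (map (\<lambda>(m, \<rho>). replicate m (\<rho> g)) ks)))"

text \<open>
  For \<open>\<phi> = ch \<sigma>\<close> this is the point mass function on irreducible characters that gives mass
  \<open>m\<^sub>k dim \<sigma>\<^sub>k / dim \<sigma>\<close> to \<open>ch \<sigma>\<^sub>k\<close>. By complete reducibility and the linear independence of the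
  irreducible characters it does not depend on the choices of \<open>\<sigma>\<close> and its decomposition.
\<close>

definition char_measure ::
    "('a, 'b) monoid_scheme \<Rightarrow> 'a topology \<Rightarrow> ('a \<Rightarrow> complex) \<Rightarrow> ('a \<Rightarrow> complex) \<Rightarrow> real" where
  "char_measure G T \<phi> \<psi> =
     (let (\<sigma>, ks) = (SOME (\<sigma>, ks). fd_rep G T \<sigma> \<and> ch G \<sigma> = \<phi> \<and> decomposition G T \<sigma> ks)
      in \<Sum>(m, \<rho>)\<leftarrow>ks. if ch G \<rho> = \<psi> then real (m * rep_dim G \<rho>) / real (rep_dim G \<sigma>) else 0)"


section \<open>The set of characters and its convolution\<close>

datatype mark = Circ | Bullet

type_synonym 'a point = "('a \<Rightarrow> complex) \<times> mark"

definition dual_union :: "('a, 'b) monoid_scheme \<Rightarrow> 'a topology \<Rightarrow> 'a set \<Rightarrow> 'a point set" where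
  "dual_union G T H =
     {(ch G \<pi>, Circ) | \<pi>. irr_rep G T \<pi>} \<union>
     {(ch (subgroup_of G H) \<tau>, Bullet) | \<tau>. irr_rep (subgroup_of G H) (subtopology T H) \<tau>}"

definition marked_measure :: "(('a \<Rightarrow> complex) \<Rightarrow> real) \<Rightarrow> mark \<Rightarrow> 'a point \<Rightarrow> real" where
  "marked_measure \<mu> s = (\<lambda>(\<psi>, s'). if s' = s then \<mu> \<psi> else 0)"

text \<open>
  An irreducible representation with a given character. It is unique up to equivalence.
\<close>

definition rep_of :: "('a, 'b) monoid_scheme \<Rightarrow> 'a topology \<Rightarrow> ('a \<Rightarrow> complex) \<Rightarrow> 'a rep" where
  "rep_of G T \<psi> = (SOME \<pi>. irr_rep G T \<pi> \<and> ch G \<pi> = \<psi>)"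

text \<open>\<open>dual_conv G T H x y z\<close> is the mass that \<open>\<delta>\<^sub>x * \<delta>\<^sub>y\<close> gives to the point \<open>z\<close>.\<close>

fun dual_conv ::
    "('a, 'b) monoid_scheme \<Rightarrow> 'a topology \<Rightarrow> 'a set \<Rightarrow> 'a point \<Rightarrow> 'a point \<Rightarrow> 'a point \<Rightarrow> real"
where
  "dual_conv G T H (\<psi>\<^sub>1, Circ) (\<psi>\<^sub>2, Circ) =
     marked_measure (char_measure G T (\<lambda>g\<in>carrier G. \<psi>\<^sub>1 g * \<psi>\<^sub>2 g)) Circ"
| "dual_conv G T H (\<psi>, Circ) (\<theta>, Bullet) =
     marked_measure
       (char_measure (subgroup_of G H) (subtopology T H)
         (\<lambda>g\<in>H. ch (subgroup_of G H) (res_rep H (rep_of G T \<psi>)) g * \<theta> g)) Bullet"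
| "dual_conv G T H (\<theta>, Bullet) (\<psi>, Circ) =
     marked_measure
       (char_measure (subgroup_of G H) (subtopology T H)
         (\<lambda>g\<in>H. \<theta> g * ch (subgroup_of G H) (res_rep H (rep_of G T \<psi>)) g)) Bullet"
| "dual_conv G T H (\<theta>\<^sub>1, Bullet) (\<theta>\<^sub>2, Bullet) =
     marked_measure
       (char_measure G T
         (ch G (ind_rep G H
           (tensor_rep
             (rep_of (subgroup_of G H) (subtopology T H) \<theta>\<^sub>1)
             (rep_of (subgroup_of G H) (subtopology T H) \<theta>\<^sub>2))))) Circ"


section \<open>Admissible pairs\<close>

definition admissible_pair :: "('a, 'b) monoid_scheme \<Rightarrow> 'a topology \<Rightarrow> 'a set \<Rightarrow> bool" where
  "admissible_pair G T H \<longleftrightarrow>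
     (\<forall>\<tau>. irr_rep (subgroup_of G H) (subtopology T H) \<tau> \<longrightarrow>
        (\<forall>g\<in>H. \<forall>s \<in> {s \<in> carrier G. s \<otimes>\<^bsub>G\<^esub> g \<otimes>\<^bsub>G\<^esub> inv\<^bsub>G\<^esub> s \<in> H}.
           ch (subgroup_of G H) \<tau> (s \<otimes>\<^bsub>G\<^esub> g \<otimes>\<^bsub>G\<^esub> inv\<^bsub>G\<^esub> s) = ch (subgroup_of G H) \<tau> g))"


section \<open>Discrete hypergroups\<close>

text \<open>
  Measures on the discrete set \<open>K\<close> are given by their point masses, and the convolution of
  Dirac measures by a function \<open>c\<close> with \<open>c x y z = (\<delta>\<^sub>x * \<delta>\<^sub>y) {z}\<close>.
\<close>

definition fin_prob_measure :: "'k set \<Rightarrow> ('k \<Rightarrow> real) \<Rightarrow> bool" where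
  "fin_prob_measure K \<mu> \<longleftrightarrow>
     (\<forall>z. 0 \<le> \<mu> z) \<and> {z. \<mu> z \<noteq> 0} \<subseteq> K \<and> finite {z. \<mu> z \<noteq> 0} \<and> (\<Sum>z | \<mu> z \<noteq> 0. \<mu> z) = 1"

definition bounded_measures :: "'k set \<Rightarrow> ('k \<Rightarrow> complex) set" where
  "bounded_measures K = {\<mu>. (\<forall>z. z \<notin> K \<longrightarrow> \<mu> z = 0) \<and> \<mu> abs_summable_on K}"

definition conv_ext ::
    "'k set \<Rightarrow> ('k \<Rightarrow> 'k \<Rightarrow> 'k \<Rightarrow> real) \<Rightarrow> ('k \<Rightarrow> complex) \<Rightarrow> ('k \<Rightarrow> complex) \<Rightarrow> 'k \<Rightarrow> complex" where
  "conv_ext K c \<mu> \<nu> = (\<lambda>z. \<Sum>\<^sub>\<infinity>(x, y)\<in>K \<times> K. \<mu> x * \<nu> y * of_real (c x y z))"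

definition dirac :: "'k \<Rightarrow> 'k \<Rightarrow> real" where
  "dirac x = (\<lambda>z. if z = x then 1 else 0)"

definition push_forward :: "'k set \<Rightarrow> ('k \<Rightarrow> 'k) \<Rightarrow> ('k \<Rightarrow> real) \<Rightarrow> 'k \<Rightarrow> real" where
  "push_forward K f \<mu> = (\<lambda>z. \<Sum>\<^sub>\<infinity>w\<in>{w \<in> K. f w = z}. \<mu> w)"

definition discrete_hypergroup :: "'k set \<Rightarrow> ('k \<Rightarrow> 'k \<Rightarrow> 'k \<Rightarrow> real) \<Rightarrow> bool" where
  "discrete_hypergroup K c \<longleftrightarrow>
     (\<forall>x\<in>K. \<forall>y\<in>K. fin_prob_measure K (c x y)) \<and>
     (\<forall>\<mu>\<in>bounded_measures K. \<forall>\<nu>\<in>bounded_measures K. \<forall>\<xi>\<in>bounded_measures K.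
        conv_ext K c (conv_ext K c \<mu> \<nu>) \<xi> = conv_ext K c \<mu> (conv_ext K c \<nu> \<xi>)) \<and>
     (\<exists>e\<in>K.
        (\<forall>x\<in>K. c e x = dirac x \<and> c x e = dirac x) \<and>
        (\<exists>invol \<in> K \<rightarrow> K.
           (\<forall>x\<in>K. invol (invol x) = x) \<and>
           (\<forall>x\<in>K. \<forall>y\<in>K. c (invol x) (invol y) = push_forward K invol (c y x)) \<and>
           (\<forall>x\<in>K. \<forall>y\<in>K. e \<in> {z. c x y z \<noteq> 0} \<longleftrightarrow> x = invol y)))"

end

theory Submission
  imports Defs "Jordan_Normal_Form.Spectral_Radius"
begin

text \<open>
  A finitely supported measure on the dual is determined by its pair of functions on \<open>G\<close> and
  \<open>G\<^sub>0\<close>, since irreducible characters are linearly independent, and on such pairs the convolution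
  becomes \<open>(u, u') * (v, v') = (u v + Ind (u' v'), u v' + u' v)\<close>. By the projection formula the
  only obstruction to associativity is \<open>Ind (u v) w = u Ind (v w)\<close> on \<open>G\<^sub>0\<close>. For admissible pairs
  \<open>Ind u = u Ind 1\<close> on \<open>G\<^sub>0\<close>, so it holds. Conversely, \<open>v = w = 1\<close> gives \<open>Ind u = u Ind 1\<close>, where
  \<open>Ind u\<close> and \<open>Ind 1\<close> are class functions on \<open>G\<close> and \<open>Ind 1\<close> does not vanish on \<open>G\<^sub>0\<close>.

  Haar measure is replaced by invariant means on the span of finitely many matrix coefficients,
  obtained as limits of convex combinations of point evaluations.
\<close>

section \<open>Invariant means on matrix coefficients\<close>

text \<open>Admissibility enters only through associativity: the unit, the involution and the
  support condition hold for every closed subgroup of finite index. As the convolution is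
  commutative, associativity becomes a cyclic symmetry of triple products of pairs. Representation
  theory is spent on passing between measures and pairs: complete reducibility provides the
  measures, orthogonality makes them unique.

  The support condition is the delicate axiom. For two \<open>Bullet\<close> points the mass at the
  unit is a mean over \<open>G\<close> of an induced function, while orthogonality of the two
  characters is a statement over the subgroup. The mean of \<open>G\<close> is therefore restricted
  to the conjugates of the subgroup, which are open because the index is finite.

  A mean consists of a set \<open>F\<close> of integrands and a functional \<open>M\<close>, built
  anew for each finite family of representations: their coefficients span a translation-invariant
  space of finite dimension, and each argument involves only finitely many of them. The last clause
  of the definition allows functions to be changed off the carrier, where representations carry no
  information.\<close>

definition invariant_mean ::
    "('a, 'b) monoid_scheme \<Rightarrow> ('a \<Rightarrow> complex) set \<Rightarrow> (('a \<Rightarrow> complex) \<Rightarrow> complex) \<Rightarrow> bool" where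
  "invariant_mean G F M \<longleftrightarrow>
     (\<forall>c. (\<lambda>_. c) \<in> F \<and> M (\<lambda>_. c) = c) \<and>
     (\<forall>f\<in>F. \<forall>g\<in>F. (\<lambda>x. f x + g x) \<in> F \<and> M (\<lambda>x. f x + g x) = M f + M g) \<and>
     (\<forall>f\<in>F. \<forall>c. (\<lambda>x. c * f x) \<in> F \<and> M (\<lambda>x. c * f x) = c * M f) \<and>
     (\<forall>f\<in>F. \<forall>h\<in>carrier G. (\<lambda>x. f (h \<otimes>\<^bsub>G\<^esub> x)) \<in> F \<and> M (\<lambda>x. f (h \<otimes>\<^bsub>G\<^esub> x)) = M f) \<and>
     (\<forall>f\<in>F. \<forall>g. (\<forall>x\<in>carrier G. f x = g x) \<longrightarrow> g \<in> F \<and> M g = M f)"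

lemma
  assumes "invariant_mean G F M"
  shows invariant_mean_const: "(\<lambda>_. c) \<in> F" "M (\<lambda>_. c) = c"
    and invariant_mean_add: "\<lbrakk>f \<in> F; g \<in> F\<rbrakk> \<Longrightarrow> (\<lambda>x. f x + g x) \<in> F"
      "\<lbrakk>f \<in> F; g \<in> F\<rbrakk> \<Longrightarrow> M (\<lambda>x. f x + g x) = M f + M g"
    and invariant_mean_cmult: "f \<in> F \<Longrightarrow> (\<lambda>x. c * f x) \<in> F"
      "f \<in> F \<Longrightarrow> M (\<lambda>x. c * f x) = c * M f"
    and invariant_mean_translate: "\<lbrakk>f \<in> F; h \<in> carrier G\<rbrakk> \<Longrightarrow> (\<lambda>x. f (h \<otimes>\<^bsub>G\<^esub> x)) \<in> F"
      "\<lbrakk>f \<in> F; h \<in> carrier G\<rbrakk> \<Longrightarrow> M (\<lambda>x. f (h \<otimes>\<^bsub>G\<^esub> x)) = M f"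
    and invariant_mean_cong: "\<lbrakk>f \<in> F; \<And>x. x \<in> carrier G \<Longrightarrow> f x = g x\<rbrakk> \<Longrightarrow> g \<in> F"
      "\<lbrakk>f \<in> F; \<And>x. x \<in> carrier G \<Longrightarrow> f x = g x\<rbrakk> \<Longrightarrow> M g = M f"
proof -
  note * = assms[unfolded invariant_mean_def]
  note 1 = *[THEN conjunct1, rule_format]
    and 2 = *[THEN conjunct2, THEN conjunct1, rule_format]
    and 3 = *[THEN conjunct2, THEN conjunct2, THEN conjunct1, rule_format]
    and 4 = *[THEN conjunct2, THEN conjunct2, THEN conjunct2, THEN conjunct1, rule_format]
    and 5 = *[THEN conjunct2, THEN conjunct2, THEN conjunct2, THEN conjunct2, rule_format]
  show "(\<lambda>_. c) \<in> F" "M (\<lambda>_. c) = c" using 1[of c] by simp_all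
  show "\<lbrakk>f \<in> F; g \<in> F\<rbrakk> \<Longrightarrow> (\<lambda>x. f x + g x) \<in> F"
    "\<lbrakk>f \<in> F; g \<in> F\<rbrakk> \<Longrightarrow> M (\<lambda>x. f x + g x) = M f + M g" using 2[of f g] by simp_all
  show "f \<in> F \<Longrightarrow> (\<lambda>x. c * f x) \<in> F" "f \<in> F \<Longrightarrow> M (\<lambda>x. c * f x) = c * M f" using 3[of f c] by simp_all
  show "\<lbrakk>f \<in> F; h \<in> carrier G\<rbrakk> \<Longrightarrow> (\<lambda>x. f (h \<otimes>\<^bsub>G\<^esub> x)) \<in> F"
    "\<lbrakk>f \<in> F; h \<in> carrier G\<rbrakk> \<Longrightarrow> M (\<lambda>x. f (h \<otimes>\<^bsub>G\<^esub> x)) = M f" using 4[of f h] by simp_all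
  show "\<lbrakk>f \<in> F; \<And>x. x \<in> carrier G \<Longrightarrow> f x = g x\<rbrakk> \<Longrightarrow> g \<in> F"
    "\<lbrakk>f \<in> F; \<And>x. x \<in> carrier G \<Longrightarrow> f x = g x\<rbrakk> \<Longrightarrow> M g = M f" using 5[of f g] by simp_all
qed

lemma invariant_mean_sum:
  assumes "invariant_mean G F M" "\<And>i. i \<in> A \<Longrightarrow> f i \<in> F"
  shows "(\<lambda>x. \<Sum>i\<in>A. f i x) \<in> F" "M (\<lambda>x. \<Sum>i\<in>A. f i x) = (\<Sum>i\<in>A. M (f i))"
proof -
  have "(\<lambda>x. \<Sum>i\<in>A. f i x) \<in> F \<and> M (\<lambda>x. \<Sum>i\<in>A. f i x) = (\<Sum>i\<in>A. M (f i))"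
    using assms(2)
  proof (induction A rule: infinite_finite_induct)
    case (insert a A)
    then show ?case using invariant_mean_add[OF assms(1), of "f a" "\<lambda>x. \<Sum>i\<in>A. f i x"] by simp
  qed (simp_all add: invariant_mean_const[OF assms(1)])
  then show "(\<lambda>x. \<Sum>i\<in>A. f i x) \<in> F" "M (\<lambda>x. \<Sum>i\<in>A. f i x) = (\<Sum>i\<in>A. M (f i))" by auto
qed

section \<open>Convex combinations of point evaluations\<close>

definition weighted_sum :: "(real \<times> 'a) list \<Rightarrow> ('a \<Rightarrow> complex) \<Rightarrow> complex" where
  "weighted_sum \<mu> f = (\<Sum>(c, g)\<leftarrow>\<mu>. of_real c * f g)"

definition convex_weights :: "'a set \<Rightarrow> (real \<times> 'a) list set" where
  "convex_weights S = {\<mu>. (\<forall>(c, g)\<in>set \<mu>. 0 \<le> c \<and> g \<in> S) \<and> (\<Sum>(c, g)\<leftarrow>\<mu>. c) = 1}"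

text \<open>Finitely supported measures are lists with possible repetitions, so that the midpoint is
  concatenation with halved weights and no points have to be merged.\<close>

definition weights_mid :: "(real \<times> 'a) list \<Rightarrow> (real \<times> 'a) list \<Rightarrow> (real \<times> 'a) list" where
  "weights_mid \<mu> \<nu> = map (\<lambda>(c, g). (c / 2, g)) (\<mu> @ \<nu>)"

lemma weighted_sum_mid:
  "weighted_sum (weights_mid \<mu> \<nu>) f = (weighted_sum \<mu> f + weighted_sum \<nu> f) / 2"
proof -
  have half: "(\<Sum>(c, g)\<leftarrow>map (\<lambda>(c, g). (c / 2, g)) \<rho>. of_real c * f g) = weighted_sum \<rho> f / 2" for \<rho>
    unfolding weighted_sum_def by (induction \<rho>) (auto simp: field_simps)
  have "weighted_sum (weights_mid \<mu> \<nu>) f =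
      (\<Sum>(c, g)\<leftarrow>map (\<lambda>(c, g). (c / 2, g)) \<mu>. of_real c * f g) + (\<Sum>(c, g)\<leftarrow>map (\<lambda>(c, g). (c / 2, g)) \<nu>. of_real c * f g)"
    by (simp only: weights_mid_def weighted_sum_def map_append sum_list_append)
  then show ?thesis unfolding half by (simp add: add_divide_distrib)
qed

lemma weights_mid_convex:
  assumes "\<mu> \<in> convex_weights S" "\<nu> \<in> convex_weights S"
  shows "weights_mid \<mu> \<nu> \<in> convex_weights S"
proof -
  have half: "(\<Sum>(c, g)\<leftarrow>map (\<lambda>(c, g). (c / 2, g)) \<rho>. c) = (\<Sum>(c, g)\<leftarrow>\<rho>. c) / 2" for \<rho> :: "(real \<times> 'a) list"
    by (induction \<rho>) (auto simp: field_simps)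
  show ?thesis using assms half[of \<mu>] half[of \<nu>]
    by (auto simp: convex_weights_def weights_mid_def)
qed

lemma weighted_sum_add:
  "weighted_sum \<mu> (\<lambda>x. f x + g x) = weighted_sum \<mu> f + weighted_sum \<mu> g"
  unfolding weighted_sum_def by (induction \<mu>) (auto simp: algebra_simps)

lemma weighted_sum_cmult: "weighted_sum \<mu> (\<lambda>x. c * f x) = c * weighted_sum \<mu> f"
  unfolding weighted_sum_def by (induction \<mu>) (auto simp: algebra_simps)

lemma weighted_sum_sum:
  "weighted_sum \<mu> (\<lambda>x. \<Sum>i\<in>A. f i x) = (\<Sum>i\<in>A. weighted_sum \<mu> (f i))"
proof (induction A rule: infinite_finite_induct)
  case (insert a A)
  then show ?case by (simp add: weighted_sum_add)
qed (unfold weighted_sum_def, (induction \<mu>; auto)+)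

lemma weighted_sum_const:
  assumes "\<mu> \<in> convex_weights S" shows "weighted_sum \<mu> (\<lambda>_. c) = c"
proof -
  have "weighted_sum \<mu> (\<lambda>_. c) = of_real (\<Sum>(c, g)\<leftarrow>\<mu>. c) * c"
    unfolding weighted_sum_def by (induction \<mu>) (auto simp: algebra_simps)
  then show ?thesis using assms by (simp add: convex_weights_def)
qed

lemma weighted_sum_cong:
  assumes "\<mu> \<in> convex_weights S" "\<And>x. x \<in> S \<Longrightarrow> f x = g x"
  shows "weighted_sum \<mu> f = weighted_sum \<mu> g"
  unfolding weighted_sum_def using assms
  by (intro arg_cong[where f = sum_list] map_cong) (auto simp: convex_weights_def)

lemma weighted_sum_bound:
  assumes "\<mu> \<in> convex_weights S" "\<And>x. x \<in> S \<Longrightarrow> cmod (f x) \<le> B"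
  shows "cmod (weighted_sum \<mu> f) \<le> B"
proof -
  have "\<forall>(c, g)\<in>set \<mu>. 0 \<le> c \<and> g \<in> S \<Longrightarrow> cmod (weighted_sum \<mu> f) \<le> (\<Sum>(c, g)\<leftarrow>\<mu>. c) * B"
    unfolding weighted_sum_def
  proof (induction \<mu>)
    case (Cons a \<mu>)
    obtain c g where a: "a = (c, g)" by force
    with Cons have c: "0 \<le> c" "g \<in> S" by auto
    have "cmod (of_real c * f g) \<le> c * B"
      using c assms(2)[of g] by (simp add: norm_mult mult_left_mono)
    then show ?case using Cons a norm_triangle_ineq[of "of_real c * f g" "\<Sum>(c, g)\<leftarrow>\<mu>. of_real c * f g"]
      by (auto simp: algebra_simps)
  qed auto
  then show ?thesis using assms(1) by (simp add: convex_weights_def)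
qed

context group
begin

definition weights_translate :: "'a \<Rightarrow> (real \<times> 'a) list \<Rightarrow> (real \<times> 'a) list" where
  "weights_translate h \<mu> = map (\<lambda>(c, g). (c, h \<otimes> g)) \<mu>"

lemma weighted_sum_translate:
  "weighted_sum (weights_translate h \<mu>) f = weighted_sum \<mu> (\<lambda>x. f (h \<otimes> x))"
  unfolding weighted_sum_def weights_translate_def by (induction \<mu>) auto

lemma weights_translate_convex:
  assumes "\<mu> \<in> convex_weights (carrier G)" "h \<in> carrier G"
  shows "weights_translate h \<mu> \<in> convex_weights (carrier G)"
proof -
  have "(\<Sum>(c, g)\<leftarrow>weights_translate h \<mu>. c) = (\<Sum>(c, g)\<leftarrow>\<mu>. c)"
    unfolding weights_translate_def by (induction \<mu>) auto
  then show ?thesis using assms by (auto simp: convex_weights_def weights_translate_def)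
qed

text \<open>
  Minimise \<open>sup\<^sub>h \<Sum>\<^sub>i |\<mu>(f\<^sub>i (h \<cdot>))|\<^sup>2\<close> over convex combinations \<open>\<mu>\<close> of point evaluations. This
  functional is translation invariant, and the parallelogram law makes near-minimisers close.
\<close>

theorem invariant_mean_exists:
  fixes f :: "'i \<Rightarrow> 'a \<Rightarrow> complex" and m :: "'a \<Rightarrow> 'i \<Rightarrow> 'i \<Rightarrow> complex"
  assumes fin: "finite I"
    and bf: "\<And>i x. i \<in> I \<Longrightarrow> x \<in> carrier G \<Longrightarrow> cmod (f i x) \<le> B"
    and bm: "\<And>i j h. i \<in> I \<Longrightarrow> j \<in> I \<Longrightarrow> h \<in> carrier G \<Longrightarrow> cmod (m h i j) \<le> C"
    and tr: "\<And>i h x. i \<in> I \<Longrightarrow> h \<in> carrier G \<Longrightarrow> x \<in> carrier G \<Longrightarrow>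
               f i (h \<otimes> x) = (\<Sum>j\<in>I. m h i j * f j x)"
  shows "\<exists>F M. invariant_mean G F M \<and> (\<forall>i\<in>I. f i \<in> F)"
proof -
  define D where "D = convex_weights (carrier G)"
  define q where "q \<mu> h = (\<Sum>i\<in>I. (cmod (weighted_sum \<mu> (\<lambda>x. f i (h \<otimes> x))))\<^sup>2)" for \<mu> h
  define N where "N \<mu> = (SUP h\<in>carrier G. q \<mu> h)" for \<mu>
  define m0 where "m0 = (INF \<mu>\<in>D. N \<mu>)"
  have q0: "0 \<le> q \<mu> h" for \<mu> h unfolding q_def by (intro sum_nonneg) auto
  have qb: "q \<mu> h \<le> (\<Sum>i\<in>I. B\<^sup>2)" if "\<mu> \<in> D" "h \<in> carrier G" for \<mu> h
    unfolding q_def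
  proof (rule sum_mono)
    fix i assume "i \<in> I"
    then have "cmod (weighted_sum \<mu> (\<lambda>x. f i (h \<otimes> x))) \<le> B"
      by (intro weighted_sum_bound[OF that(1)[unfolded D_def]] bf m_closed that(2))
    then show "(cmod (weighted_sum \<mu> (\<lambda>x. f i (h \<otimes> x))))\<^sup>2 \<le> B\<^sup>2" by (rule power_mono) simp
  qed
  have bddq: "bdd_above (q \<mu> ` carrier G)" if "\<mu> \<in> D" for \<mu>
    by (rule bdd_aboveI2, rule qb[OF that])
  have qN: "q \<mu> h \<le> N \<mu>" if "\<mu> \<in> D" "h \<in> carrier G" for \<mu> h
    unfolding N_def by (rule cSUP_upper[OF that(2) bddq[OF that(1)]])
  have "[(1, \<one>)] \<in> D" by (simp add: D_def convex_weights_def)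
  then have Dne: "D \<noteq> {}" by auto
  have bddN: "bdd_below (N ` D)"
  proof (rule bdd_belowI2)
    show "0 \<le> N \<mu>" if "\<mu> \<in> D" for \<mu>
      using order_trans[OF q0 qN[OF that one_closed]] .
  qed
  have mN: "m0 \<le> N \<mu>" if "\<mu> \<in> D" for \<mu>
    unfolding m0_def by (rule cINF_lower[OF bddN that])
  \<comment> \<open>Near-minimisers agree on every \<open>f i\<close>. The midpoint is again in
    \<open>D\<close>, so at some \<open>h\<close> its \<open>q\<close> exceeds
    \<open>m0 - \<epsilon>\<close>, and the parallelogram law bounds the squared distance by
    \<open>2 (m0 + \<epsilon>) + 2 (m0 + \<epsilon>) - 4 (m0 - \<epsilon>) = 8 \<epsilon>\<close>.
    This holds at the translate by \<open>h\<close>; the matrix \<open>m (inv h)\<close>, bounded by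
    \<open>C\<close> uniformly in \<open>h\<close>, carries it back.\<close>
  have close: "cmod (weighted_sum \<mu> (f i) - weighted_sum \<nu> (f i)) \<le> card I * (C * sqrt (8 * \<epsilon>))"
    if D: "\<mu> \<in> D" "\<nu> \<in> D" and N: "N \<mu> \<le> m0 + \<epsilon>" "N \<nu> \<le> m0 + \<epsilon>" and "0 < \<epsilon>" and i: "i \<in> I"
    for \<mu> \<nu> \<epsilon> i
  proof -
    have mid: "weights_mid \<mu> \<nu> \<in> D" using D weights_mid_convex unfolding D_def by blast
    have "m0 - \<epsilon> < N (weights_mid \<mu> \<nu>)" using mN[OF mid] \<open>0 < \<epsilon>\<close> by linarith
    then obtain h where h: "h \<in> carrier G" "m0 - \<epsilon> < q (weights_mid \<mu> \<nu>) h"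
      unfolding N_def using less_cSUP_iff[OF carrier_not_empty bddq[OF mid]] by blast
    define a where "a j = weighted_sum \<mu> (\<lambda>x. f j (h \<otimes> x))" for j
    define b where "b j = weighted_sum \<nu> (\<lambda>x. f j (h \<otimes> x))" for j
    have pl: "(cmod (a j - b j))\<^sup>2 = 2 * (cmod (a j))\<^sup>2 + 2 * (cmod (b j))\<^sup>2 - 4 * (cmod ((a j + b j) / 2))\<^sup>2" for j
    proof -
      have "(cmod (z - w))\<^sup>2 = 2 * (cmod z)\<^sup>2 + 2 * (cmod w)\<^sup>2 - (cmod (z + w))\<^sup>2" for z w
        unfolding cmod_power2 by (simp add: power2_eq_square algebra_simps)
      then show ?thesis by (simp add: norm_divide power_divide)
    qed
    have "(\<Sum>j\<in>I. (cmod (a j - b j))\<^sup>2) = 2 * q \<mu> h + 2 * q \<nu> h - 4 * q (weights_mid \<mu> \<nu>) h"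
      unfolding q_def weighted_sum_mid a_def[symmetric] b_def[symmetric] pl
      by (simp only: sum.distrib sum_subtractf sum_distrib_left)
    also have "\<dots> \<le> 8 * \<epsilon>" using qN[OF D(1) h(1)] qN[OF D(2) h(1)] N h(2) by linarith
    finally have S: "(\<Sum>j\<in>I. (cmod (a j - b j))\<^sup>2) \<le> 8 * \<epsilon>" .
    have dj: "cmod (a j - b j) \<le> sqrt (8 * \<epsilon>)" if "j \<in> I" for j
    proof (rule real_le_rsqrt)
      show "(cmod (a j - b j))\<^sup>2 \<le> 8 * \<epsilon>"
        using S member_le_sum[OF that, of "\<lambda>j. (cmod (a j - b j))\<^sup>2"] fin by fastforce
    qed
    have ev: "weighted_sum \<rho> (f i) = (\<Sum>j\<in>I. m (inv h) i j * weighted_sum \<rho> (\<lambda>x. f j (h \<otimes> x)))"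
      if "\<rho> \<in> D" for \<rho>
    proof -
      have "weighted_sum \<rho> (f i) = weighted_sum \<rho> (\<lambda>x. \<Sum>j\<in>I. m (inv h) i j * f j (h \<otimes> x))"
      proof (rule weighted_sum_cong[OF that[unfolded D_def]])
        fix x assume x: "x \<in> carrier G"
        have "f i x = f i (inv h \<otimes> (h \<otimes> x))" using x h by (simp add: m_assoc[symmetric])
        also have "\<dots> = (\<Sum>j\<in>I. m (inv h) i j * f j (h \<otimes> x))" using tr[OF i] h x by simp
        finally show "f i x = \<dots>" .
      qed
      then show ?thesis by (simp add: weighted_sum_sum weighted_sum_cmult)
    qed
    have "weighted_sum \<mu> (f i) - weighted_sum \<nu> (f i) = (\<Sum>j\<in>I. m (inv h) i j * (a j - b j))"
      unfolding ev[OF D(1)] ev[OF D(2)] a_def b_def by (simp add: sum_subtractf algebra_simps)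
    also have "cmod \<dots> \<le> (\<Sum>j\<in>I. C * sqrt (8 * \<epsilon>))"
    proof (rule sum_norm_le)
      fix j assume j: "j \<in> I"
      have "0 \<le> C" using bm[OF i i h(1)] norm_ge_zero order_trans by blast
      then show "cmod (m (inv h) i j * (a j - b j)) \<le> C * sqrt (8 * \<epsilon>)"
        unfolding norm_mult using bm[OF i j, of "inv h"] dj[OF j] h by (intro mult_mono) auto
    qed
    finally show ?thesis by simp
  qed
  have "\<exists>\<mu>\<in>D. N \<mu> < m0 + 1 / real (Suc k)" for k
    using cINF_less_iff[OF Dne bddN, of "m0 + 1 / real (Suc k)"] unfolding m0_def by auto
  then obtain \<mu> where \<mu>: "\<And>k. \<mu> k \<in> D" "\<And>k. N (\<mu> k) < m0 + 1 / real (Suc k)" by metis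
  \<comment> \<open>A left translate of the measure amounts to a right translation of the variable
    \<open>y\<close>, which permutes the carrier, so the supremum is unchanged.\<close>
  have Ntr: "N (weights_translate h \<nu>) = N \<nu>" if "\<nu> \<in> D" "h \<in> carrier G" for \<nu> h
  proof -
    have "q (weights_translate h \<nu>) y = q \<nu> (y \<otimes> h)" if y: "y \<in> carrier G" for y
      unfolding q_def weighted_sum_translate
      by (intro sum.cong refl arg_cong[where f = "\<lambda>z. (cmod z)\<^sup>2"]
          weighted_sum_cong[OF \<open>\<nu> \<in> D\<close>[unfolded D_def]])
        (use y \<open>h \<in> carrier G\<close> in \<open>simp add: m_assoc\<close>)
    then have "q (weights_translate h \<nu>) ` carrier G = q \<nu> ` ((\<lambda>y. y \<otimes> h) ` carrier G)"
      by (auto simp: image_image)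
    moreover have "(\<lambda>y. y \<otimes> h) ` carrier G = carrier G"
    proof safe
      fix y assume y: "y \<in> carrier G"
      then show "y \<in> (\<lambda>y. y \<otimes> h) ` carrier G"
        using that(2) by (intro image_eqI[of _ _ "y \<otimes> inv h"]) (auto simp: m_assoc)
    qed (use that(2) in auto)
    ultimately show ?thesis unfolding N_def by simp
  qed
  define \<epsilon> where "\<epsilon> k = real (card I) * (C * sqrt (8 * (1 / real (Suc k))))" for k
  have "(\<lambda>k. 1 / real (Suc k)) \<longlonglongrightarrow> 0" using LIMSEQ_inverse_real_of_nat by (simp add: inverse_eq_divide)
  then have "(\<lambda>k. real (card I) * (C * sqrt (8 * (1 / real (Suc k))))) \<longlonglongrightarrow> real (card I) * (C * sqrt (8 * 0))"
    by (intro tendsto_intros)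
  then have \<epsilon>0: "\<epsilon> \<longlonglongrightarrow> 0" unfolding \<epsilon>_def by simp
  \<comment> \<open>Stated for arbitrary near-minimisers \<open>\<nu>\<close>: later members of the
    sequence give the Cauchy property, left translates of \<open>\<mu> k\<close> give the invariance
    of the limit.\<close>
  have small: "cmod (weighted_sum (\<mu> k) (f i) - weighted_sum \<nu> (f i)) \<le> \<epsilon> k"
    if "\<nu> \<in> D" "N \<nu> \<le> m0 + 1 / real (Suc k)" "i \<in> I" for k \<nu> i
    unfolding \<epsilon>_def by (rule close[OF \<mu>(1) that(1)]) (use \<mu>(2)[of k] that in auto)
  have lim: "\<exists>L. \<forall>h\<in>carrier G. (\<lambda>k. weighted_sum (\<mu> k) (\<lambda>x. f i (h \<otimes> x))) \<longlonglongrightarrow> L" if i: "i \<in> I" for i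
  proof -
    have "Cauchy (\<lambda>k. weighted_sum (\<mu> k) (f i))"
    proof (rule CauchyI')
      fix e :: real assume "0 < e"
      then obtain K where K: "\<And>k. k \<ge> K \<Longrightarrow> \<bar>\<epsilon> k\<bar> < e"
        using \<epsilon>0 unfolding LIMSEQ_iff by auto
      have "cmod (weighted_sum (\<mu> k) (f i) - weighted_sum (\<mu> l) (f i)) < e" if "k \<ge> K" "k < l" for k l
      proof -
        have "1 / real (Suc l) \<le> 1 / real (Suc k)" using that by (simp add: frac_le)
        then have "cmod (weighted_sum (\<mu> k) (f i) - weighted_sum (\<mu> l) (f i)) \<le> \<epsilon> k"
          using \<mu>(2)[of l] by (intro small[OF \<mu>(1) _ i]) linarith
        then show ?thesis using K[OF that(1)] by linarith
      qed
      then show "\<exists>K. \<forall>k\<ge>K. \<forall>l>k. dist (weighted_sum (\<mu> k) (f i)) (weighted_sum (\<mu> l) (f i)) < e"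
        unfolding dist_norm by blast
    qed
    then obtain L where L: "(\<lambda>k. weighted_sum (\<mu> k) (f i)) \<longlonglongrightarrow> L"
      by (metis Cauchy_convergent_iff convergent_def)
    have "(\<lambda>k. weighted_sum (\<mu> k) (\<lambda>x. f i (h \<otimes> x))) \<longlonglongrightarrow> L" if h: "h \<in> carrier G" for h
    proof -
      have "cmod (weighted_sum (\<mu> k) (f i) - weighted_sum (\<mu> k) (\<lambda>x. f i (h \<otimes> x))) \<le> \<epsilon> k" for k
        unfolding weighted_sum_translate[symmetric]
        by (rule small[OF _ _ i])
          (use \<mu>[of k] Ntr[OF \<mu>(1) h] weights_translate_convex[OF _ h] in \<open>auto simp: D_def less_imp_le\<close>)
      then have "(\<lambda>k. weighted_sum (\<mu> k) (f i) - weighted_sum (\<mu> k) (\<lambda>x. f i (h \<otimes> x))) \<longlonglongrightarrow> 0"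
        by (intro Lim_null_comparison[OF _ \<epsilon>0]) auto
      from tendsto_diff[OF L this] show ?thesis by simp
    qed
    then show ?thesis by blast
  qed
  \<comment> \<open>Membership asks for one limit common to all translates, so invariance of
    \<open>F\<close> and \<open>M\<close> is built in. Reading \<open>M\<close> off at the translate
    by \<open>\<one>\<close> makes its value an instance of that condition.\<close>
  define F where "F = {f. \<exists>L. \<forall>h\<in>carrier G. (\<lambda>k. weighted_sum (\<mu> k) (\<lambda>x. f (h \<otimes> x))) \<longlonglongrightarrow> L}"
  define M where "M f = Lim sequentially (\<lambda>k. weighted_sum (\<mu> k) (\<lambda>x. f (\<one> \<otimes> x)))" for f
  have F: "f \<in> F \<and> M f = L"
    if "\<And>h. h \<in> carrier G \<Longrightarrow> (\<lambda>k. weighted_sum (\<mu> k) (\<lambda>x. f (h \<otimes> x))) \<longlonglongrightarrow> L" for f L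
    using that[OF one_closed] that unfolding F_def M_def by (auto simp: tendsto_Lim)
  have FD: "(\<lambda>k. weighted_sum (\<mu> k) (\<lambda>x. f (h \<otimes> x))) \<longlonglongrightarrow> M f" if "f \<in> F" "h \<in> carrier G" for f h
    using that F unfolding F_def by blast
  have "invariant_mean G F M"
    unfolding invariant_mean_def
  proof (intro conjI allI ballI impI)
    fix c show "(\<lambda>_. c) \<in> F" "M (\<lambda>_. c) = c"
      using F[of "\<lambda>_. c" c] weighted_sum_const[OF \<mu>(1)[unfolded D_def]] by auto
  next
    fix f g assume "f \<in> F" "g \<in> F"
    then show "(\<lambda>x. f x + g x) \<in> F" "M (\<lambda>x. f x + g x) = M f + M g"
      using F[of "\<lambda>x. f x + g x" "M f + M g"] FD tendsto_add unfolding weighted_sum_add by blast+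
  next
    fix f c assume "f \<in> F"
    then show "(\<lambda>x. c * f x) \<in> F" "M (\<lambda>x. c * f x) = c * M f"
      using F[of "\<lambda>x. c * f x" "c * M f"] FD tendsto_mult_left unfolding weighted_sum_cmult by blast+
  next
    fix f h assume f: "f \<in> F" and h: "h \<in> carrier G"
    have "(\<lambda>k. weighted_sum (\<mu> k) (\<lambda>x. f (h \<otimes> (y \<otimes> x)))) \<longlonglongrightarrow> M f" if y: "y \<in> carrier G" for y
    proof -
      have "weighted_sum (\<mu> k) (\<lambda>x. f (h \<otimes> (y \<otimes> x))) = weighted_sum (\<mu> k) (\<lambda>x. f ((h \<otimes> y) \<otimes> x))" for k
        by (rule weighted_sum_cong[OF \<mu>(1)[unfolded D_def]]) (use y h in \<open>simp add: m_assoc\<close>)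
      then show ?thesis using FD[OF f, of "h \<otimes> y"] h y by simp
    qed
    then show "(\<lambda>x. f (h \<otimes> x)) \<in> F" "M (\<lambda>x. f (h \<otimes> x)) = M f"
      using F[of "\<lambda>x. f (h \<otimes> x)" "M f"] by auto
  next
    fix f g assume f: "f \<in> F" and fg: "\<forall>x\<in>carrier G. f x = g x"
    have "(\<lambda>k. weighted_sum (\<mu> k) (\<lambda>x. g (y \<otimes> x))) \<longlonglongrightarrow> M f" if y: "y \<in> carrier G" for y
    proof -
      have "weighted_sum (\<mu> k) (\<lambda>x. g (y \<otimes> x)) = weighted_sum (\<mu> k) (\<lambda>x. f (y \<otimes> x))" for k
        by (rule weighted_sum_cong[OF \<mu>(1)[unfolded D_def]]) (use y fg in simp)
      then show ?thesis using FD[OF f y] by simp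
    qed
    then show "g \<in> F" "M g = M f" using F[of g "M f"] by auto
  qed
  moreover have "\<forall>i\<in>I. f i \<in> F" using lim unfolding F_def by blast
  ultimately show ?thesis by blast
qed

end

section \<open>Linear algebra\<close>

lemma mat_mult_entry:
  assumes "A \<in> carrier_mat nr n" "B \<in> carrier_mat n nc" "i < nr" "j < nc"
  shows "(A * B) $$ (i, j) = (\<Sum>k<n. A $$ (i, k) * B $$ (k, j))"
  using assms by (auto simp: scalar_prod_def atLeast0LessThan)

lemma mat_vec_entry:
  assumes "A \<in> carrier_mat nr n" "v \<in> carrier_vec n" "i < nr"
  shows "(A *\<^sub>v v) $ i = (\<Sum>k<n. A $$ (i, k) * v $ k)"
  using assms by (auto simp: scalar_prod_def atLeast0LessThan)

lemma mult_mat_unit_vec: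
  fixes A :: "'a :: comm_semiring_1 mat"
  assumes A: "A \<in> carrier_mat n k" and j: "j < k"
  shows "A *\<^sub>v unit_vec k j = col A j"
  using col_mult2[OF A one_carrier_mat j] A j by simp

lemma mat_trace_mult_commute:
  assumes A: "A \<in> carrier_mat n k" and B: "B \<in> carrier_mat k n"
  shows "mat_trace (A * B) = mat_trace (B * A)"
proof -
  have "mat_trace (A * B) = (\<Sum>i<n. \<Sum>j<k. A $$ (i, j) * B $$ (j, i))"
    unfolding mat_trace_def using A B by (auto simp: scalar_prod_def atLeast0LessThan)
  also have "\<dots> = (\<Sum>j<k. \<Sum>i<n. B $$ (j, i) * A $$ (i, j))"
    by (subst sum.swap) (simp add: mult.commute)
  also have "\<dots> = mat_trace (B * A)"
    unfolding mat_trace_def using A B by (auto simp: scalar_prod_def atLeast0LessThan)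
  finally show ?thesis .
qed

lemma mat_trace_one: "mat_trace (1\<^sub>m n) = of_nat n"
  by (simp add: mat_trace_def)

lemma mat_trace_add:
  assumes "A \<in> carrier_mat n n" "B \<in> carrier_mat n n"
  shows "mat_trace (A + B) = mat_trace A + mat_trace B"
  using assms by (simp add: mat_trace_def sum.distrib)

text \<open>Padded with zeros to \<open>k\<close> by \<open>k\<close> matrices, the factors still
  satisfy \<open>B' * A' = 1\<close>, hence also \<open>A' * B' = 1\<close>; but for
  \<open>n < k\<close> the last row of \<open>A'\<close> is zero.\<close>

lemma left_inverse_dim_le:
  fixes A B :: "'a :: field mat"
  assumes A: "A \<in> carrier_mat n k" and B: "B \<in> carrier_mat k n" and BA: "B * A = 1\<^sub>m k"
  shows "k \<le> n"
proof (rule ccontr)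
  assume "\<not> k \<le> n"
  then have nk: "n < k" by simp
  define A' where "A' = mat k k (\<lambda>(i, j). if i < n then A $$ (i, j) else 0)"
  define B' where "B' = mat k k (\<lambda>(i, j). if j < n then B $$ (i, j) else 0)"
  have c: "A' \<in> carrier_mat k k" "B' \<in> carrier_mat k k" by (auto simp: A'_def B'_def)
  have "B' * A' = 1\<^sub>m k"
  proof (rule eq_matI)
    fix i j assume ij: "i < dim_row (1\<^sub>m k :: 'a mat)" "j < dim_col (1\<^sub>m k :: 'a mat)"
    then have "(B' * A') $$ (i, j) = (\<Sum>l<k. B' $$ (i, l) * A' $$ (l, j))"
      using mat_mult_entry[OF c(2,1)] by simp
    also have "\<dots> = (\<Sum>l<n. B $$ (i, l) * A $$ (l, j))"
      using nk ij by (intro sum.mono_neutral_cong_right) (auto simp: A'_def B'_def)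
    also have "\<dots> = (B * A) $$ (i, j)" using mat_mult_entry[OF B A] ij by simp
    finally show "(B' * A') $$ (i, j) = 1\<^sub>m k $$ (i, j)" unfolding BA .
  qed (use c in auto)
  from mat_mult_left_right_inverse[OF c(2,1) this]
  have "(A' * B') $$ (k - 1, k - 1) = 1" using nk by simp
  moreover have "(A' * B') $$ (k - 1, k - 1) = 0"
    using mat_mult_entry[OF c, of "k - 1" "k - 1"] nk by (simp add: A'_def)
  ultimately show False by simp
qed

section \<open>Subspaces, bases and idempotents in coordinates\<close>

definition lin_closed :: "nat \<Rightarrow> complex vec set \<Rightarrow> bool" where
  "lin_closed n W \<longleftrightarrow> W \<subseteq> carrier_vec n \<and> 0\<^sub>v n \<in> W \<and> (\<forall>v\<in>W. \<forall>w\<in>W. v + w \<in> W) \<and>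
     (\<forall>c. \<forall>v\<in>W. c \<cdot>\<^sub>v v \<in> W)"

lemma subspace_iff_lin_closed:
  "VectorSpace.subspace class_ring W (module_vec TYPE(complex) n) \<longleftrightarrow> lin_closed n W"
  using vec_vs[of n, where 'a = complex] vec_module[of n, where 'a = complex]
  unfolding subspace_def submodule_def lin_closed_def module_vec_simps by auto

text \<open>The columns of \<open>A\<close> form a basis of \<open>W\<close> and \<open>B\<close> is
  a coordinate map. Take \<open>k\<close> maximal among maps into \<open>W\<close> with a left
  inverse, possible because \<open>k \<le> n\<close>. Were some \<open>w\<close> in \<open>W\<close>
  not fixed by \<open>A * B\<close>, its residual \<open>u = w - A B w\<close> would lie in
  \<open>W\<close>, be killed by \<open>B\<close>, and supply one more column.\<close>

lemma subspace_basis: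
  assumes W: "lin_closed n W"
  obtains k A B where "A \<in> carrier_mat n k" "B \<in> carrier_mat k n" "B * A = 1\<^sub>m k"
    "\<And>v. v \<in> carrier_vec k \<Longrightarrow> A *\<^sub>v v \<in> W" "\<And>w. w \<in> W \<Longrightarrow> A *\<^sub>v (B *\<^sub>v w) = w"
proof -
  define P where "P k \<longleftrightarrow> (\<exists>A B. A \<in> carrier_mat n k \<and> B \<in> carrier_mat k n \<and> B * A = 1\<^sub>m k \<and>
    (\<forall>v\<in>carrier_vec k. A *\<^sub>v v \<in> W))" for k
  have "0\<^sub>m n 0 *\<^sub>v v \<in> W" if "v \<in> carrier_vec 0" for v :: "complex vec"
  proof -
    have "0\<^sub>m n 0 *\<^sub>v v = 0\<^sub>v n" using that by (intro eq_vecI) (auto simp: scalar_prod_def)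
    then show ?thesis using W by (simp add: lin_closed_def)
  qed
  then have "P 0" unfolding P_def
    by (intro exI[of _ "0\<^sub>m n 0"] exI[of _ "0\<^sub>m 0 n"]) auto
  moreover have le: "k \<le> n" if "P k" for k using that left_inverse_dim_le unfolding P_def by blast
  ultimately obtain k where k: "P k" "\<And>l. P l \<Longrightarrow> l \<le> k"
    using ex_has_greatest_nat[of P 0 "\<lambda>x. x" "Suc n"] by (auto simp: less_Suc_eq_le)
  from k(1) obtain A B where A: "A \<in> carrier_mat n k" and B: "B \<in> carrier_mat k n"
    and BA: "B * A = 1\<^sub>m k" and AW: "\<And>v. v \<in> carrier_vec k \<Longrightarrow> A *\<^sub>v v \<in> W" unfolding P_def by blast
  have "A *\<^sub>v (B *\<^sub>v w) = w" if w: "w \<in> W" for w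
  proof (rule ccontr)
    assume ne: "A *\<^sub>v (B *\<^sub>v w) \<noteq> w"
    have wc: "w \<in> carrier_vec n" using w W by (auto simp: lin_closed_def)
    define u where "u = w + (-1) \<cdot>\<^sub>v (A *\<^sub>v (B *\<^sub>v w))"
    have ABw: "A *\<^sub>v (B *\<^sub>v w) \<in> W" using AW B wc by simp
    then have uW: "u \<in> W" using w W unfolding u_def lin_closed_def by blast
    have uc: "u \<in> carrier_vec n" using uW W by (auto simp: lin_closed_def)
    obtain p where p: "p < n" "u $ p \<noteq> 0"
    proof (rule ccontr)
      assume "\<not> thesis"
      then have 0: "u $ i = 0" if "i < n" for i using that \<open>\<And>p. \<lbrakk>p < n; u $ p \<noteq> 0\<rbrakk> \<Longrightarrow> thesis\<close> by blast
      have "A *\<^sub>v (B *\<^sub>v w) = w"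
      proof (rule eq_vecI)
        fix i assume "i < dim_vec w"
        then show "(A *\<^sub>v (B *\<^sub>v w)) $ i = w $ i" using 0[of i] wc A by (simp add: u_def)
      qed (use A wc in auto)
      with ne show False by simp
    qed
    have Bu: "B *\<^sub>v u = 0\<^sub>v k"
    proof -
      have "B *\<^sub>v u = B *\<^sub>v w + B *\<^sub>v ((-1) \<cdot>\<^sub>v (A *\<^sub>v (B *\<^sub>v w)))"
        unfolding u_def using A B wc by (intro mult_add_distrib_mat_vec) auto
      also have "B *\<^sub>v ((-1) \<cdot>\<^sub>v (A *\<^sub>v (B *\<^sub>v w))) = (-1) \<cdot>\<^sub>v (B *\<^sub>v (A *\<^sub>v (B *\<^sub>v w)))"
        using A B wc by (intro mult_mat_vec[OF B]) auto
      also have "B *\<^sub>v (A *\<^sub>v (B *\<^sub>v w)) = B *\<^sub>v w"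
      proof -
        have "B *\<^sub>v (A *\<^sub>v (B *\<^sub>v w)) = (B * A) *\<^sub>v (B *\<^sub>v w)" using A B wc by simp
        then show ?thesis unfolding BA using B wc by simp
      qed
      finally show ?thesis using B wc by (intro eq_vecI) auto
    qed
    \<comment> \<open>The new row of the left inverse: the \<open>p\<close>-th coordinate of
      \<open>1 - A * B\<close>, scaled to be 1 on \<open>u\<close>. It vanishes on the columns of
      \<open>A\<close> because \<open>B * A = 1\<close>.\<close>
    define \<rho> where "\<rho> j = ((if j = p then 1 else 0) - (A * B) $$ (p, j)) / u $ p" for j
    define A' where "A' = mat n (Suc k) (\<lambda>(i, j). if j < k then A $$ (i, j) else u $ i)"
    define B' where "B' = mat (Suc k) n (\<lambda>(i, j). if i < k then B $$ (i, j) else \<rho> j)"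
    have c: "A' \<in> carrier_mat n (Suc k)" "B' \<in> carrier_mat (Suc k) n" by (auto simp: A'_def B'_def)
    have eBA: "(\<Sum>j<n. B $$ (i, j) * A $$ (j, l)) = (if i = l then 1 else 0)" if "i < k" "l < k" for i l
      using mat_mult_entry[OF B A that] that unfolding BA by simp
    have eBu: "(\<Sum>j<n. B $$ (i, j) * u $ j) = 0" if "i < k" for i
      using mat_vec_entry[OF B uc that] that unfolding Bu by simp
    have \<rho>s: "(\<Sum>j<n. \<rho> j * x j) = (x p - (\<Sum>l<k. A $$ (p, l) * (\<Sum>j<n. B $$ (l, j) * x j))) / u $ p" for x
    proof -
      have "(\<Sum>j<n. \<rho> j * x j) = (\<Sum>j<n. ((if j = p then x j else 0) - (A * B) $$ (p, j) * x j) / u $ p)"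
        by (intro sum.cong) (auto simp: \<rho>_def algebra_simps)
      also have "\<dots> = ((\<Sum>j<n. if j = p then x j else 0) - (\<Sum>j<n. (A * B) $$ (p, j) * x j)) / u $ p"
        by (simp add: sum_divide_distrib[symmetric] sum_subtractf)
      also have "(\<Sum>j<n. (A * B) $$ (p, j) * x j) = (\<Sum>j<n. \<Sum>l<k. A $$ (p, l) * (B $$ (l, j) * x j))"
        using mat_mult_entry[OF A B p(1)] by (intro sum.cong) (auto simp: sum_distrib_right mult.assoc)
      also have "\<dots> = (\<Sum>l<k. A $$ (p, l) * (\<Sum>j<n. B $$ (l, j) * x j))"
        by (subst sum.swap) (simp add: sum_distrib_left)
      finally show ?thesis using p(1) by simp
    qed
    have "B' * A' = 1\<^sub>m (Suc k)"
    proof (rule eq_matI)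
      fix i l assume "i < dim_row (1\<^sub>m (Suc k) :: complex mat)" "l < dim_col (1\<^sub>m (Suc k) :: complex mat)"
      then have il: "i < Suc k" "l < Suc k" by auto
      have "(B' * A') $$ (i, l) = (\<Sum>j<n. B' $$ (i, j) * A' $$ (j, l))"
        by (rule mat_mult_entry[OF c(2,1) il])
      also have "\<dots> = (\<Sum>j<n. (if i < k then B $$ (i, j) else \<rho> j) * (if l < k then A $$ (j, l) else u $ j))"
        using il by (intro sum.cong) (auto simp: A'_def B'_def)
      also have "\<dots> = (if i = l then 1 else 0)"
      proof (cases "i < k"; cases "l < k")
        assume "i < k" "l < k" then show ?thesis using eBA by simp
      next
        assume "i < k" "\<not> l < k" then show ?thesis using eBu by simp
      next
        assume i: "\<not> i < k" and l: "l < k"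
        have "(\<Sum>j<n. \<rho> j * A $$ (j, l)) = (A $$ (p, l) - (\<Sum>m<k. A $$ (p, m) * (if m = l then 1 else 0))) / u $ p"
          unfolding \<rho>s using eBA l by (intro arg_cong2[where f = "(/)"] arg_cong2[where f = "(-)"] sum.cong) auto
        also have "(\<Sum>m<k. A $$ (p, m) * (if m = l then 1 else 0)) = A $$ (p, l)"
          using l by (simp add: if_distrib[of "\<lambda>x. _ * x"] cong: if_cong)
        also have "(A $$ (p, l) - A $$ (p, l)) / u $ p = 0" by simp
        finally show ?thesis using i l by simp
      next
        assume i: "\<not> i < k" and l: "\<not> l < k"
        have "(\<Sum>j<n. \<rho> j * u $ j) = 1" unfolding \<rho>s using eBu p by simp
        then show ?thesis using i l il by simp
      qed
      finally show "(B' * A') $$ (i, l) = 1\<^sub>m (Suc k) $$ (i, l)" using il by simp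
    qed (use c in auto)
    moreover have "A' *\<^sub>v v \<in> W" if v: "v \<in> carrier_vec (Suc k)" for v
    proof -
      define v1 where "v1 = vec k (\<lambda>i. v $ i)"
      have "A' *\<^sub>v v = A *\<^sub>v v1 + v $ k \<cdot>\<^sub>v u"
      proof (rule eq_vecI)
        fix i assume "i < dim_vec (A *\<^sub>v v1 + v $ k \<cdot>\<^sub>v u)"
        then have i: "i < n" using uc by simp
        have "(A' *\<^sub>v v) $ i = (\<Sum>j<Suc k. A' $$ (i, j) * v $ j)"
          by (rule mat_vec_entry[OF c(1) v i])
        also have "\<dots> = (\<Sum>j<k. A $$ (i, j) * v1 $ j) + u $ i * v $ k"
          using i by (auto simp: A'_def v1_def intro!: sum.cong)
        also have "(\<Sum>j<k. A $$ (i, j) * v1 $ j) = (A *\<^sub>v v1) $ i"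
          by (rule mat_vec_entry[OF A _ i, symmetric]) (simp add: v1_def)
        finally show "(A' *\<^sub>v v) $ i = (A *\<^sub>v v1 + v $ k \<cdot>\<^sub>v u) $ i" using i A uc by simp
      qed (use c A uc in auto)
      moreover have "A *\<^sub>v v1 \<in> W" by (rule AW) (simp add: v1_def)
      ultimately show ?thesis using uW W by (simp add: lin_closed_def)
    qed
    ultimately have "P (Suc k)" unfolding P_def using c by blast
    from k(2)[OF this] show False by simp
  qed
  with A B BA AW that show thesis by blast
qed

text \<open>The range of an idempotent is its fixed space; take a basis \<open>A\<close> of it. The
  coordinate map \<open>B\<close> is arbitrary off that space, so the second factor has to be
  \<open>B * p\<close>.\<close>

lemma idempotent_factorization:
  fixes p :: "complex mat"
  assumes p: "p \<in> carrier_mat n n" and idem: "p * p = p"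
  obtains k A B where "A \<in> carrier_mat n k" "B \<in> carrier_mat k n" "B * A = 1\<^sub>m k" "A * B = p"
proof -
  define W where "W = {v \<in> carrier_vec n. p *\<^sub>v v = v}"
  have "lin_closed n W"
    unfolding lin_closed_def W_def using p
    by (auto simp: mult_add_distrib_mat_vec[OF p] mult_mat_vec[OF p])
  then obtain k A B where A: "A \<in> carrier_mat n k" and B: "B \<in> carrier_mat k n" and BA: "B * A = 1\<^sub>m k"
    and AW: "\<And>v. v \<in> carrier_vec k \<Longrightarrow> A *\<^sub>v v \<in> W" and ABW: "\<And>w. w \<in> W \<Longrightarrow> A *\<^sub>v (B *\<^sub>v w) = w"
    using subspace_basis by metis
  have pA: "p * A = A"
  proof (rule eq_matI)
    fix i j assume ij: "i < dim_row A" "j < dim_col A"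
    have "col (p * A) j = p *\<^sub>v col A j" using p A ij by (intro col_mult2) auto
    also have "col A j = A *\<^sub>v unit_vec k j" using A ij by (simp add: mult_mat_unit_vec[OF A])
    also have "p *\<^sub>v (A *\<^sub>v unit_vec k j) = A *\<^sub>v unit_vec k j"
      using AW[of "unit_vec k j"] by (simp add: W_def)
    also have "\<dots> = col A j" using A ij by (simp add: mult_mat_unit_vec[OF A])
    finally have "col (p * A) j $ i = col A j $ i" by simp
    then show "(p * A) $$ (i, j) = A $$ (i, j)" using p A ij by simp
  qed (use p A in auto)
  have "A * (B * p) = p"
  proof (rule eq_matI)
    fix i j assume ij: "i < dim_row p" "j < dim_col p"
    then have j: "j < n" using p by simp
    have "col p j \<in> W"
    proof -
      have "p *\<^sub>v col p j = col (p * p) j" by (simp only: col_mult2[OF p p j])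
      then show ?thesis using p j by (simp add: W_def idem)
    qed
    moreover have "col (A * (B * p)) j = A *\<^sub>v (B *\<^sub>v col p j)"
      by (simp only: col_mult2[OF A mult_carrier_mat[OF B p] j] col_mult2[OF B p j])
    ultimately have "col (A * (B * p)) j $ i = col p j $ i" using ABW by simp
    then show "(A * (B * p)) $$ (i, j) = p $$ (i, j)" using p A B ij by simp
  qed (use p A B in auto)
  moreover have "B * p * A = 1\<^sub>m k" using A B p BA pA by simp
  ultimately show thesis using that[of A k "B * p"] A B p by simp
qed

section \<open>Block-diagonal sums\<close>

definition diag2 :: "'a :: zero mat \<Rightarrow> 'a mat \<Rightarrow> 'a mat" where
  "diag2 A B = four_block_mat A (0\<^sub>m (dim_row A) (dim_col B)) (0\<^sub>m (dim_row B) (dim_col A)) B"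

lemma diag2_carrier[simp]:
  "A \<in> carrier_mat n n \<Longrightarrow> B \<in> carrier_mat m m \<Longrightarrow> diag2 A B \<in> carrier_mat (n + m) (n + m)"
  by (simp add: diag2_def)

lemma diag2_dim[simp]: "dim_row (diag2 A B) = dim_row A + dim_row B"
  by (simp add: diag2_def)

lemma diag2_index:
  assumes "A \<in> carrier_mat n n" "B \<in> carrier_mat m m" "i < n + m" "j < n + m"
  shows "diag2 A B $$ (i, j) = (if i < n then if j < n then A $$ (i, j) else 0
    else if j < n then 0 else B $$ (i - n, j - n))"
  using assms by (auto simp: diag2_def)

lemma diag2_mult:
  fixes A B C D :: "complex mat"
  assumes "A \<in> carrier_mat n n" "B \<in> carrier_mat n n" "C \<in> carrier_mat m m" "D \<in> carrier_mat m m"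
  shows "diag2 A C * diag2 B D = diag2 (A * B) (C * D)"
proof -
  have "diag2 A C * diag2 B D = four_block_mat (A * B + 0\<^sub>m n m * 0\<^sub>m m n) (A * 0\<^sub>m n m + 0\<^sub>m n m * D)
      (0\<^sub>m m n * B + C * 0\<^sub>m m n) (0\<^sub>m m n * 0\<^sub>m n m + C * D)"
    using assms unfolding diag2_def carrier_mat_def
    by (subst mult_four_block_mat[of _ n n _ m _ m _ _ n _ m]) auto
  then show ?thesis using assms by (simp add: diag2_def)
qed

lemma diag2_one: "diag2 (1\<^sub>m n) (1\<^sub>m m) = (1\<^sub>m (n + m) :: complex mat)"
  by (simp add: diag2_def)

lemma mat_trace_diag2:
  assumes "A \<in> carrier_mat n n" "B \<in> carrier_mat m m"
  shows "mat_trace (diag2 A B) = mat_trace A + mat_trace B"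
proof -
  have "mat_trace (diag2 A B) = (\<Sum>i<n + m. if i < n then A $$ (i, i) else B $$ (i - n, i - n))"
    unfolding mat_trace_def using assms by (auto simp: diag2_def intro!: sum.cong)
  also have "\<dots> = (\<Sum>i<n. A $$ (i, i)) + (\<Sum>i<m. B $$ (i, i))"
    by (induction m) auto
  finally show ?thesis using assms by (simp add: mat_trace_def)
qed

lemma diag_block_mat_Cons: "diag_block_mat (A # As) = diag2 A (diag_block_mat As)"
  by (simp add: diag2_def Let_def)

lemma diag_block_mat_append_diag2:
  "diag_block_mat (As @ Bs) = diag2 (diag_block_mat As) (diag_block_mat Bs)"
  by (simp add: diag2_def diag_block_mat_append Let_def)


section \<open>Equivalence and direct sums of representations\<close>

text \<open>Only the shape of the matrices, without a homomorphism law or positive dimension.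
  Equivalences are manipulated at this level, which also admits the empty direct sum.\<close>

definition square_rep :: "('a, 'b) monoid_scheme \<Rightarrow> 'a rep \<Rightarrow> bool" where
  "square_rep G \<pi> \<longleftrightarrow> (\<forall>g\<in>carrier G. \<pi> g \<in> carrier_mat (rep_dim G \<pi>) (rep_dim G \<pi>))"

lemma square_repD:
  "square_rep G \<pi> \<Longrightarrow> g \<in> carrier G \<Longrightarrow> \<pi> g \<in> carrier_mat (rep_dim G \<pi>) (rep_dim G \<pi>)"
  by (simp add: square_rep_def)

lemma rep_equivI:
  assumes "rep_dim G \<pi> = n" "rep_dim G \<sigma> = n" "P \<in> carrier_mat n n" "Q \<in> carrier_mat n n"
    "P * Q = 1\<^sub>m n" "\<And>g. g \<in> carrier G \<Longrightarrow> P * \<pi> g = \<sigma> g * P"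
  shows "rep_equiv G \<pi> \<sigma>"
  using assms mat_mult_left_right_inverse[OF assms(3-5)]
  unfolding rep_equiv_def invertible_mat_def inverts_mat_def
  by (metis carrier_matD square_mat.simps)

lemma rep_equivE:
  assumes "rep_equiv G \<pi> \<sigma>"
  obtains P Q where "P \<in> carrier_mat (rep_dim G \<pi>) (rep_dim G \<pi>)"
    "Q \<in> carrier_mat (rep_dim G \<pi>) (rep_dim G \<pi>)" "P * Q = 1\<^sub>m (rep_dim G \<pi>)"
    "Q * P = 1\<^sub>m (rep_dim G \<pi>)" "\<And>g. g \<in> carrier G \<Longrightarrow> P * \<pi> g = \<sigma> g * P"
    "rep_dim G \<sigma> = rep_dim G \<pi>"
proof -
  let ?n = "rep_dim G \<pi>"
  obtain P Q where P: "P \<in> carrier_mat ?n ?n" and i: "inverts_mat P Q" "inverts_mat Q P"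
    and eq: "\<And>g. g \<in> carrier G \<Longrightarrow> P * \<pi> g = \<sigma> g * P"
    using assms unfolding rep_equiv_def invertible_mat_def by blast
  have PQ: "P * Q = 1\<^sub>m ?n" using i P by (simp add: inverts_mat_def)
  have QP: "Q * P = 1\<^sub>m (dim_row Q)" using i by (simp add: inverts_mat_def)
  \<comment> \<open>\<open>inverts_mat\<close> leaves the shape of \<open>Q\<close> open; it is read
    off from the two products.\<close>
  have "dim_col Q = ?n" using arg_cong[OF PQ, of dim_col] by simp
  moreover have "dim_row Q = ?n" using arg_cong[OF QP, of dim_col] P by simp
  ultimately have Q: "Q \<in> carrier_mat ?n ?n" by auto
  show thesis using that[OF P Q PQ _ eq] QP Q assms by (auto simp: rep_equiv_def)
qed

lemma rep_equiv_refl: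
  assumes "square_rep G \<pi>" shows "rep_equiv G \<pi> \<pi>"
  by (rule rep_equivI[of _ _ "rep_dim G \<pi>" _ "1\<^sub>m (rep_dim G \<pi>)" "1\<^sub>m (rep_dim G \<pi>)"])
    (use square_repD[OF assms] in \<open>auto simp: left_mult_one_mat[of _ _ "rep_dim G \<pi>"] right_mult_one_mat[of _ "rep_dim G \<pi>"]\<close>)

lemma rep_equiv_trans:
  assumes "rep_equiv G \<pi> \<sigma>" "rep_equiv G \<sigma> \<rho>" "square_rep G \<pi>" "square_rep G \<sigma>" "square_rep G \<rho>"
  shows "rep_equiv G \<pi> \<rho>"
proof -
  let ?n = "rep_dim G \<pi>"
  obtain P Q where P: "P \<in> carrier_mat ?n ?n" "Q \<in> carrier_mat ?n ?n" "P * Q = 1\<^sub>m ?n"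
    "\<And>g. g \<in> carrier G \<Longrightarrow> P * \<pi> g = \<sigma> g * P" and d: "rep_dim G \<sigma> = ?n"
    using rep_equivE[OF assms(1)] by metis
  obtain P' Q' where P': "P' \<in> carrier_mat ?n ?n" "Q' \<in> carrier_mat ?n ?n" "P' * Q' = 1\<^sub>m ?n"
    "\<And>g. g \<in> carrier G \<Longrightarrow> P' * \<sigma> g = \<rho> g * P'" and d': "rep_dim G \<rho> = ?n"
    using rep_equivE[OF assms(2)] unfolding d by metis
  show ?thesis
  proof (rule rep_equivI[of _ _ ?n _ "P' * P" "Q * Q'"])
    have "P' * P * (Q * Q') = P' * (P * Q) * Q'"
      using P(1,2) P'(1,2) by (simp add: assoc_mult_mat[of _ ?n ?n _ ?n _ ?n])
    then show "P' * P * (Q * Q') = 1\<^sub>m ?n" using P P' by simp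
    fix g assume g: "g \<in> carrier G"
    have c: "\<pi> g \<in> carrier_mat ?n ?n" "\<sigma> g \<in> carrier_mat ?n ?n" "\<rho> g \<in> carrier_mat ?n ?n"
      using square_repD assms(3-5) g d d' by metis+
    have "P' * P * \<pi> g = P' * (P * \<pi> g)" using c P P' by simp
    also have "\<dots> = (P' * \<sigma> g) * P" unfolding P(4)[OF g] using c P P' by simp
    also have "\<dots> = \<rho> g * (P' * P)" unfolding P'(4)[OF g] using c P P' by simp
    finally show "P' * P * \<pi> g = \<rho> g * (P' * P)" .
  qed (use P P' d d' in auto)
qed

lemma rep_equiv_sym:
  assumes "rep_equiv G \<pi> \<sigma>" "square_rep G \<pi>" "square_rep G \<sigma>"
  shows "rep_equiv G \<sigma> \<pi>"
proof -
  let ?n = "rep_dim G \<pi>"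
  obtain P Q where P: "P \<in> carrier_mat ?n ?n" "Q \<in> carrier_mat ?n ?n" "P * Q = 1\<^sub>m ?n" "Q * P = 1\<^sub>m ?n"
    "\<And>g. g \<in> carrier G \<Longrightarrow> P * \<pi> g = \<sigma> g * P" and d: "rep_dim G \<sigma> = ?n"
    using rep_equivE[OF assms(1)] by metis
  show ?thesis
  proof (rule rep_equivI[of _ _ ?n _ Q P])
    fix g assume g: "g \<in> carrier G"
    have c: "\<pi> g \<in> carrier_mat ?n ?n" "\<sigma> g \<in> carrier_mat ?n ?n"
      using square_repD assms(2,3) g d by metis+
    have "Q * \<sigma> g = Q * (\<sigma> g * (P * Q))" using c P by simp
    also have "\<dots> = Q * (\<sigma> g * P) * Q" using c P(1,2) by (simp add: assoc_mult_mat[of _ ?n ?n _ ?n _ ?n])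
    also have "\<dots> = (Q * P) * \<pi> g * Q"
      unfolding P(5)[OF g, symmetric] using c P(1,2) by (simp add: assoc_mult_mat[of _ ?n ?n _ ?n _ ?n])
    finally show "Q * \<sigma> g = \<pi> g * Q" using c P by simp
  qed (use P d in auto)
qed

lemma ch_rep_equiv:
  assumes "rep_equiv G \<pi> \<sigma>" "square_rep G \<pi>" "square_rep G \<sigma>"
  shows "ch G \<pi> = ch G \<sigma>"
proof -
  let ?n = "rep_dim G \<pi>"
  obtain P Q where P: "P \<in> carrier_mat ?n ?n" "Q \<in> carrier_mat ?n ?n" "P * Q = 1\<^sub>m ?n" "Q * P = 1\<^sub>m ?n"
    "\<And>g. g \<in> carrier G \<Longrightarrow> P * \<pi> g = \<sigma> g * P" and d: "rep_dim G \<sigma> = ?n"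
    using rep_equivE[OF assms(1)] by metis
  have "mat_trace (\<pi> g) = mat_trace (\<sigma> g)" if g: "g \<in> carrier G" for g
  proof -
    have c: "\<pi> g \<in> carrier_mat ?n ?n" "\<sigma> g \<in> carrier_mat ?n ?n"
      using square_repD assms(2,3) g d by metis+
    have "mat_trace (\<pi> g) = mat_trace (Q * (P * \<pi> g))"
      using P c by (simp add: assoc_mult_mat[symmetric, of _ ?n ?n _ ?n _ ?n])
    also have "\<dots> = mat_trace ((P * \<pi> g) * Q)" using P c by (intro mat_trace_mult_commute) auto
    also have "(P * \<pi> g) * Q = \<sigma> g"
      unfolding P(5)[OF g] using P c by simp
    finally show ?thesis .
  qed
  then show ?thesis unfolding ch_def d by (intro restrict_ext) simp
qed

definition rep_dsum :: "'a rep \<Rightarrow> 'a rep \<Rightarrow> 'a rep" where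
  "rep_dsum \<pi> \<sigma> = (\<lambda>g. diag2 (\<pi> g) (\<sigma> g))"

definition rep_dlist :: "'a rep list \<Rightarrow> 'a rep" where
  "rep_dlist rs = (\<lambda>g. diag_block_mat (map (\<lambda>\<rho>. \<rho> g) rs))"

lemma rep_dim_rep_dsum: "rep_dim G (rep_dsum \<pi> \<sigma>) = rep_dim G \<pi> + rep_dim G \<sigma>"
  by (simp add: rep_dim_def rep_dsum_def)

lemma square_rep_rep_dsum: "square_rep G \<pi> \<Longrightarrow> square_rep G \<sigma> \<Longrightarrow> square_rep G (rep_dsum \<pi> \<sigma>)"
  unfolding square_rep_def rep_dim_rep_dsum by (simp add: rep_dsum_def)

lemma rep_dlist_Nil: "rep_dlist [] = (\<lambda>g. 0\<^sub>m 0 0)" by (simp add: rep_dlist_def)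

lemma rep_dlist_singleton: "rep_dlist [\<rho>] = \<rho>" by (simp only: rep_dlist_def list.map diag_block_mat_singleton)

lemma rep_dlist_Cons: "rep_dlist (\<rho> # rs) = rep_dsum \<rho> (rep_dlist rs)"
  by (simp only: rep_dlist_def rep_dsum_def list.map diag_block_mat_Cons)

lemma rep_dlist_append: "rep_dlist (rs @ ss) = rep_dsum (rep_dlist rs) (rep_dlist ss)"
  by (simp only: rep_dlist_def rep_dsum_def map_append diag_block_mat_append_diag2)

lemma square_rep_rep_dlist: "(\<And>\<rho>. \<rho> \<in> set rs \<Longrightarrow> square_rep G \<rho>) \<Longrightarrow> square_rep G (rep_dlist rs)"
proof (induction rs)
  case Nil
  then show ?case by (simp add: rep_dlist_Nil square_rep_def rep_dim_def)
next
  case (Cons a rs)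
  then show ?case unfolding rep_dlist_Cons by (intro square_rep_rep_dsum) auto
qed

lemma rep_dsum_cong:
  assumes "rep_equiv G \<pi> \<pi>'" "rep_equiv G \<sigma> \<sigma>'" "square_rep G \<pi>" "square_rep G \<pi>'"
    "square_rep G \<sigma>" "square_rep G \<sigma>'"
  shows "rep_equiv G (rep_dsum \<pi> \<sigma>) (rep_dsum \<pi>' \<sigma>')"
proof -
  let ?n = "rep_dim G \<pi>" and ?m = "rep_dim G \<sigma>"
  obtain P Q where P: "P \<in> carrier_mat ?n ?n" "Q \<in> carrier_mat ?n ?n" "P * Q = 1\<^sub>m ?n" "Q * P = 1\<^sub>m ?n"
    "\<And>g. g \<in> carrier G \<Longrightarrow> P * \<pi> g = \<pi>' g * P" and d: "rep_dim G \<pi>' = ?n"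
    using rep_equivE[OF assms(1)] by metis
  obtain P' Q' where P': "P' \<in> carrier_mat ?m ?m" "Q' \<in> carrier_mat ?m ?m" "P' * Q' = 1\<^sub>m ?m" "Q' * P' = 1\<^sub>m ?m"
    "\<And>g. g \<in> carrier G \<Longrightarrow> P' * \<sigma> g = \<sigma>' g * P'" and d': "rep_dim G \<sigma>' = ?m"
    using rep_equivE[OF assms(2)] by metis
  show ?thesis
  proof (rule rep_equivI[of _ _ "?n + ?m" _ "diag2 P P'" "diag2 Q Q'"])
    show "diag2 P P' * diag2 Q Q' = 1\<^sub>m (?n + ?m)" using P P' by (simp add: diag2_mult diag2_one)
    fix g assume g: "g \<in> carrier G"
    have c: "\<pi> g \<in> carrier_mat ?n ?n" "\<pi>' g \<in> carrier_mat ?n ?n" "\<sigma> g \<in> carrier_mat ?m ?m" "\<sigma>' g \<in> carrier_mat ?m ?m"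
      using square_repD assms(3-) g d d' by metis+
    show "diag2 P P' * rep_dsum \<pi> \<sigma> g = rep_dsum \<pi>' \<sigma>' g * diag2 P P'"
      unfolding rep_dsum_def using c P P' g by (simp add: diag2_mult[of _ ?n _ _ ?m])
  qed (use P P' d d' in \<open>auto simp: rep_dim_rep_dsum\<close>)
qed

lemma rep_dsum_commute:
  assumes "square_rep G \<pi>" "square_rep G \<sigma>"
  shows "rep_equiv G (rep_dsum \<pi> \<sigma>) (rep_dsum \<sigma> \<pi>)"
proof -
  let ?n = "rep_dim G \<pi>" and ?m = "rep_dim G \<sigma>"
  \<comment> \<open>The block permutations exchanging the two summands, inverse to each
    other.\<close>
  let ?P = "four_block_mat (0\<^sub>m ?m ?n) (1\<^sub>m ?m) (1\<^sub>m ?n) (0\<^sub>m ?n ?m) :: complex mat"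
  let ?Q = "four_block_mat (0\<^sub>m ?n ?m) (1\<^sub>m ?n) (1\<^sub>m ?m) (0\<^sub>m ?m ?n) :: complex mat"
  show ?thesis
  proof (rule rep_equivI[of _ _ "?n + ?m" _ ?P ?Q])
    show "?P \<in> carrier_mat (?n + ?m) (?n + ?m)" "?Q \<in> carrier_mat (?n + ?m) (?n + ?m)"
      unfolding carrier_mat_def by auto
    show "?P * ?Q = 1\<^sub>m (?n + ?m)"
      by (subst mult_four_block_mat[of _ ?m ?n _ ?m _ ?n _ _ ?m _ ?n]) (auto simp: add.commute)
    fix g assume g: "g \<in> carrier G"
    have c: "\<pi> g \<in> carrier_mat ?n ?n" "\<sigma> g \<in> carrier_mat ?m ?m"
      using square_repD assms g by metis+
    have z: "dim_row (\<pi> g) = ?n" "dim_col (\<pi> g) = ?n" "dim_row (\<sigma> g) = ?m" "dim_col (\<sigma> g) = ?m"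
      using c by auto
    have "?P * rep_dsum \<pi> \<sigma> g = four_block_mat (0\<^sub>m ?m ?n) (\<sigma> g) (\<pi> g) (0\<^sub>m ?n ?m)"
      unfolding rep_dsum_def diag2_def z using c
      by (subst mult_four_block_mat[of _ ?m ?n _ ?m _ ?n _ _ ?n _ ?m]) auto
    also have "\<dots> = rep_dsum \<sigma> \<pi> g * ?P"
      unfolding rep_dsum_def diag2_def z using c
      by (subst mult_four_block_mat[of _ ?m ?m _ ?n _ ?n _ _ ?n _ ?m]) auto
    finally show "?P * rep_dsum \<pi> \<sigma> g = rep_dsum \<sigma> \<pi> g * ?P" .
  qed (auto simp: rep_dim_rep_dsum)
qed

lemma rep_dlist_insert:
  assumes "square_rep G \<rho>" "\<And>\<pi>. \<pi> \<in> set rs \<Longrightarrow> square_rep G \<pi>" "\<And>\<pi>. \<pi> \<in> set ss \<Longrightarrow> square_rep G \<pi>"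
  shows "rep_equiv G (rep_dlist (\<rho> # rs @ ss)) (rep_dlist (rs @ \<rho> # ss))"
proof -
  have c: "square_rep G (rep_dlist rs)" "square_rep G (rep_dlist ss)"
    using assms square_rep_rep_dlist by blast+
  have "rep_equiv G (rep_dsum (rep_dsum \<rho> (rep_dlist rs)) (rep_dlist ss)) (rep_dsum (rep_dsum (rep_dlist rs) \<rho>) (rep_dlist ss))"
    using assms(1) c by (intro rep_dsum_cong rep_dsum_commute rep_equiv_refl square_rep_rep_dsum)
  moreover have "rep_dlist (\<rho> # rs @ ss) = rep_dsum (rep_dsum \<rho> (rep_dlist rs)) (rep_dlist ss)"
    using rep_dlist_append[of "\<rho> # rs" ss] by (simp add: rep_dlist_Cons)
  moreover have "rep_dlist (rs @ \<rho> # ss) = rep_dsum (rep_dsum (rep_dlist rs) \<rho>) (rep_dlist ss)"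
    using rep_dlist_append[of "rs @ [\<rho>]" ss] rep_dlist_append[of rs "[\<rho>]"] by (simp add: rep_dlist_singleton)
  ultimately show ?thesis by simp
qed

section \<open>Collecting equivalent summands into multiplicities\<close>

definition expand :: "(nat \<times> 'a rep) list \<Rightarrow> 'a rep list" where
  "expand ks = concat (map (\<lambda>(m, \<rho>). replicate m \<rho>) ks)"

lemma set_expand: "set (expand ks) \<subseteq> snd ` set ks"
  by (force simp: expand_def)

lemma decomposition_rep_dlist:
  "decomposition G T \<sigma> ks \<longleftrightarrow>
     (\<forall>(m, \<rho>)\<in>set ks. 0 < m \<and> irr_rep G T \<rho>) \<and>
     (\<forall>i<length ks. \<forall>j<length ks. i \<noteq> j \<longrightarrow> \<not> rep_equiv G (snd (ks ! i)) (snd (ks ! j))) \<and>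
     rep_equiv G \<sigma> (rep_dlist (expand ks))"
proof -
  have "concat (map (\<lambda>(m, \<rho>). replicate m (\<rho> g)) ks) = map (\<lambda>\<rho>. \<rho> g) (expand ks)" for g
    unfolding expand_def by (induction ks) auto
  then show ?thesis by (simp add: decomposition_def rep_dlist_def)
qed

text \<open>Induction over the summands: the head either raises the multiplicity of an equivalent
  entry or starts a new entry of multiplicity 1. Irreducibility is hidden in the predicate
  \<open>I\<close>, since only the shape of the matrices matters here.\<close>

lemma group_equivalent_summands:
  assumes "\<And>\<rho>. \<rho> \<in> set rs \<Longrightarrow> I \<rho>" and sq: "\<And>\<rho>. I \<rho> \<Longrightarrow> square_rep G \<rho>"
  shows "\<exists>ks. (\<forall>(m, \<rho>)\<in>set ks. 0 < m \<and> I \<rho>) \<and>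
     (\<forall>i<length ks. \<forall>j<length ks. i \<noteq> j \<longrightarrow> \<not> rep_equiv G (snd (ks ! i)) (snd (ks ! j))) \<and>
     rep_equiv G (rep_dlist rs) (rep_dlist (expand ks))"
  using assms(1)
proof (induction rs)
  case Nil
  then show ?case
    by (intro exI[of _ "[]"]) (auto simp: expand_def intro!: rep_equiv_refl square_rep_rep_dlist)
next
  case (Cons \<rho> rs)
  then obtain ks where ks: "\<forall>(m, \<rho>)\<in>set ks. 0 < m \<and> I \<rho>"
    and ne: "\<forall>i<length ks. \<forall>j<length ks. i \<noteq> j \<longrightarrow> \<not> rep_equiv G (snd (ks ! i)) (snd (ks ! j))"
    and eq: "rep_equiv G (rep_dlist rs) (rep_dlist (expand ks))" by auto
  have I: "I \<rho>" using Cons.prems by simp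
  have sqe: "square_rep G \<pi>" if "\<pi> \<in> set (expand ks)" for \<pi>
  proof -
    from that set_expand[of ks] obtain m where "(m, \<pi>) \<in> set ks" by auto
    then have "I \<pi>" using ks by auto
    then show ?thesis by (rule sq)
  qed
  have sqs: "square_rep G \<rho>" "square_rep G (rep_dlist rs)" "square_rep G (rep_dlist (expand ks))"
    using sq[OF I] sq[OF Cons.prems] sqe by (simp_all add: square_rep_rep_dlist)
  show ?case
  proof (cases "\<exists>i<length ks. rep_equiv G \<rho> (snd (ks ! i))")
    case True
    then obtain i where i: "i < length ks" "rep_equiv G \<rho> (snd (ks ! i))" by blast
    obtain m \<rho>' where mi: "ks ! i = (m, \<rho>')" by force
    define ks1 ks2 where "ks1 = take i ks" and "ks2 = drop (Suc i) ks"
    have kseq: "ks = ks1 @ (m, \<rho>') # ks2" using i mi id_take_nth_drop unfolding ks1_def ks2_def by metis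
    define ks' where "ks' = ks1 @ (Suc m, \<rho>') # ks2"
    have sn: "map snd ks' = map snd ks" by (simp add: ks'_def kseq)
    then have len: "length ks' = length ks" by (metis length_map)
    have nth: "snd (ks' ! j) = snd (ks ! j)" if "j < length ks" for j
      using that len sn by (metis nth_map)
    have "I \<rho>'" using ks by (simp add: kseq)
    then have \<rho>': "square_rep G \<rho>'" "rep_equiv G \<rho> \<rho>'" using sq i mi by simp_all
    have e: "expand ks = expand ks1 @ (replicate m \<rho>' @ expand ks2)"
      "expand ks' = expand ks1 @ \<rho>' # (replicate m \<rho>' @ expand ks2)"
      by (simp_all add: kseq ks'_def expand_def)
    \<comment> \<open>The new summand is first exchanged for its equivalent \<open>\<rho>'\<close>
      at the head, then moved past \<open>expand ks1\<close> to the other copies of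
      \<open>\<rho>'\<close>.\<close>
    have "rep_equiv G (rep_dlist (\<rho> # rs)) (rep_dlist (\<rho>' # expand ks))"
      unfolding rep_dlist_Cons by (intro rep_dsum_cong sqs \<rho>' eq)
    moreover have "rep_equiv G (rep_dlist (\<rho>' # expand ks)) (rep_dlist (expand ks'))"
      unfolding e using sqe \<rho>'(1) by (intro rep_dlist_insert) (auto simp: e)
    ultimately have "rep_equiv G (rep_dlist (\<rho> # rs)) (rep_dlist (expand ks'))"
    proof (rule rep_equiv_trans)
      show "square_rep G (rep_dlist (expand ks'))"
        using sqe \<rho>'(1) by (intro square_rep_rep_dlist) (auto simp: e)
    qed (auto simp: rep_dlist_Cons intro!: square_rep_rep_dsum sqs \<rho>')
    moreover have "\<forall>(m, \<rho>)\<in>set ks'. 0 < m \<and> I \<rho>" using ks by (auto simp: kseq ks'_def)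
    ultimately show ?thesis using ne nth len by (intro exI[of _ ks']) auto
  next
    case False
    let ?ks = "(1, \<rho>) # ks"
    have sqk: "square_rep G (snd (ks ! j))" if "j < length ks" for j
    proof -
      obtain m \<pi> where k: "ks ! j = (m, \<pi>)" by force
      then have "I \<pi>" using ks nth_mem[OF that] by auto
      then show ?thesis using sq k by simp
    qed
    have "\<not> rep_equiv G (snd (?ks ! i)) (snd (?ks ! j))" if "i < length ?ks" "j < length ?ks" "i \<noteq> j" for i j
    proof (cases i; cases j)
      fix i' assume "i = Suc i'" "j = 0"
      then show ?thesis using False that rep_equiv_sym[of G "snd (ks ! i')" \<rho>] sqk[of i'] sqs by auto
    qed (use that False ne in auto)
    moreover have "rep_equiv G (rep_dlist (\<rho> # rs)) (rep_dlist (expand ?ks))"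
    proof -
      have "expand ?ks = \<rho> # expand ks" by (simp add: expand_def)
      then show ?thesis unfolding rep_dlist_Cons by (simp only: rep_dlist_Cons) (intro rep_dsum_cong sqs eq rep_equiv_refl)
    qed
    ultimately show ?thesis using ks I by (intro exI[of _ ?ks]) auto
  qed
qed

text \<open>\<open>P = [B; D]\<close> with inverse \<open>[A C]\<close> splits \<open>\<sigma>\<close>, where \<open>A B\<close> and \<open>C D\<close> factor \<open>p\<close> and \<open>1 - p\<close>.\<close>

lemma invariant_idempotent_split:
  fixes \<sigma> :: "'a rep"
  assumes p: "p \<in> carrier_mat n n" and idem: "p * p = p"
    and \<sigma>: "\<And>g. g \<in> carrier G \<Longrightarrow> \<sigma> g \<in> carrier_mat n n" "rep_dim G \<sigma> = n"
    and one: "\<one>\<^bsub>G\<^esub> \<in> carrier G"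
    and comm: "\<And>g. g \<in> carrier G \<Longrightarrow> p * \<sigma> g = \<sigma> g * p"
  obtains k l A B C D where "k + l = n" "A \<in> carrier_mat n k" "B \<in> carrier_mat k n" "B * A = 1\<^sub>m k" "A * B = p"
    "C \<in> carrier_mat n l" "D \<in> carrier_mat l n" "D * C = 1\<^sub>m l" "C * D = 1\<^sub>m n - p"
    "rep_equiv G \<sigma> (rep_dsum (\<lambda>g. B * \<sigma> g * A) (\<lambda>g. D * \<sigma> g * C))"
proof -
  define q where "q = 1\<^sub>m n - p"
  have q: "q \<in> carrier_mat n n" using p unfolding q_def by (intro minus_carrier_mat)
  have pq: "p * q = 0\<^sub>m n n" unfolding q_def using p idem by (simp add: mult_minus_distrib_mat[OF p one_carrier_mat p])
  have qp: "q * p = 0\<^sub>m n n" unfolding q_def using p idem by (simp add: minus_mult_distrib_mat[OF one_carrier_mat p p])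
  have "q * q = 1\<^sub>m n * q - p * q" unfolding q_def[symmetric]
    by (subst q_def) (use p q in \<open>simp add: minus_mult_distrib_mat[of _ n n]\<close>)
  moreover have "q - 0\<^sub>m n n = q" using q by (intro eq_matI) auto
  ultimately have qq: "q * q = q" using q pq by simp
  have psq: "p + q = 1\<^sub>m n" unfolding q_def using p by auto
  obtain k A B where A: "A \<in> carrier_mat n k" and B: "B \<in> carrier_mat k n" and BA: "B * A = 1\<^sub>m k" and AB: "A * B = p"
    using idempotent_factorization[OF p idem] by metis
  obtain l C D where C: "C \<in> carrier_mat n l" and D: "D \<in> carrier_mat l n" and DC: "D * C = 1\<^sub>m l" and CD: "C * D = q"
    using idempotent_factorization[OF q qq] by metis
  \<comment> \<open>Ranks are counted by traces: those of \<open>p\<close> and \<open>q\<close> are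
    \<open>k\<close> and \<open>l\<close>, and they add up to the trace of the identity.\<close>
  have "of_nat (k + l) = mat_trace (B * A) + mat_trace (D * C)" by (simp add: BA DC mat_trace_one)
  also have "\<dots> = mat_trace p + mat_trace q"
    using mat_trace_mult_commute[OF A B] mat_trace_mult_commute[OF C D] by (simp add: AB CD)
  also have "\<dots> = (of_nat n :: complex)" using mat_trace_add[OF p q] by (simp add: psq mat_trace_one)
  finally have kl: "k + l = n" by (simp only: of_nat_eq_iff)
  note ac = assoc_mult_mat
  have Bp: "B * p = B" using ac[OF B A B] BA B by (simp add: AB)
  have pA: "p * A = A" using ac[OF A B A] BA A by (simp add: AB)
  have Dq: "D * q = D" using ac[OF D C D] DC D by (simp add: CD)
  have qC: "q * C = C" using ac[OF C D C] DC C by (simp add: CD)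
  \<comment> \<open>The mixed products vanish: \<open>p\<close> is absorbed by \<open>A\<close> and
    \<open>B\<close>, \<open>q\<close> by \<open>C\<close> and \<open>D\<close>, and
    \<open>p\<close> and \<open>q\<close> annihilate each other.\<close>
  have pC: "p * C = 0\<^sub>m n l" using ac[OF p q C] qC pq C by simp
  have qA: "q * A = 0\<^sub>m n k" using ac[OF q p A] pA qp A by simp
  have BC: "B * C = 0\<^sub>m k l" using ac[OF B p C] Bp pC B by simp
  have DA: "D * A = 0\<^sub>m l k" using ac[OF D q A] Dq qA D by simp
  define P where "P = mat n n (\<lambda>(i, j). if i < k then B $$ (i, j) else D $$ (i - k, j))"
  define Q where "Q = mat n n (\<lambda>(i, j). if j < k then A $$ (i, j) else C $$ (i, j - k))"
  have Pc: "P \<in> carrier_mat n n" and Qc: "Q \<in> carrier_mat n n" by (auto simp: P_def Q_def)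
  have PQ: "P * Q = 1\<^sub>m n"
  proof (rule eq_matI)
    fix i j assume "i < dim_row (1\<^sub>m n :: complex mat)" "j < dim_col (1\<^sub>m n :: complex mat)"
    then have ij: "i < n" "j < n" by auto
    have "(P * Q) $$ (i, j) = (\<Sum>m<n. (if i < k then B $$ (i, m) else D $$ (i - k, m)) *
        (if j < k then A $$ (m, j) else C $$ (m, j - k)))"
      unfolding mat_mult_entry[OF Pc Qc ij] using ij by (intro sum.cong) (auto simp: P_def Q_def)
    also have "\<dots> = (if i < k then if j < k then (B * A) $$ (i, j) else (B * C) $$ (i, j - k)
        else if j < k then (D * A) $$ (i - k, j) else (D * C) $$ (i - k, j - k))"
      using ij kl mat_mult_entry[OF B A] mat_mult_entry[OF B C] mat_mult_entry[OF D A] mat_mult_entry[OF D C]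
      by auto
    also have "\<dots> = 1\<^sub>m n $$ (i, j)" using ij kl by (auto simp: BA BC DA DC)
    finally show "(P * Q) $$ (i, j) = 1\<^sub>m n $$ (i, j)" .
  qed (use Pc Qc in auto)
  have eq: "P * \<sigma> g = rep_dsum (\<lambda>g. B * \<sigma> g * A) (\<lambda>g. D * \<sigma> g * C) g * P" if g: "g \<in> carrier G" for g
  proof -
    have s: "\<sigma> g \<in> carrier_mat n n" using \<sigma> g by blast
    have Bs: "B * \<sigma> g \<in> carrier_mat k n" and Ds: "D * \<sigma> g \<in> carrier_mat l n" using B D s by auto
    have "B * \<sigma> g * A * B = B * \<sigma> g * p" using ac[OF Bs A B] by (simp add: AB)
    also have "\<dots> = B * (p * \<sigma> g)" using ac[OF B s p] comm[OF g] by simp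
    also have "\<dots> = B * \<sigma> g" using ac[OF B p s] Bp by simp
    finally have 1: "B * \<sigma> g * A * B = B * \<sigma> g" .
    have qs: "q * \<sigma> g = \<sigma> g * q"
      unfolding q_def using p s comm[OF g]
      by (simp add: minus_mult_distrib_mat[OF one_carrier_mat p s] mult_minus_distrib_mat[OF s one_carrier_mat p])
    have "D * \<sigma> g * C * D = D * \<sigma> g * q" using ac[OF Ds C D] by (simp add: CD)
    also have "\<dots> = D * (q * \<sigma> g)" using ac[OF D s q] qs by simp
    also have "\<dots> = D * \<sigma> g" using ac[OF D q s] Dq by simp
    finally have 2: "D * \<sigma> g * C * D = D * \<sigma> g" .
    let ?X = "B * \<sigma> g * A" and ?Y = "D * \<sigma> g * C"
    have X: "?X \<in> carrier_mat k k" and Y: "?Y \<in> carrier_mat l l" using A B C D s by auto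
    have XY: "diag2 ?X ?Y \<in> carrier_mat n n" using diag2_carrier[OF X Y] kl by simp
    show ?thesis unfolding rep_dsum_def
    proof (rule eq_matI)
      fix i j assume "i < dim_row (diag2 ?X ?Y * P)" "j < dim_col (diag2 ?X ?Y * P)"
      then have ij: "i < n" "j < n" using XY Pc by auto
      have "(P * \<sigma> g) $$ (i, j) = (if i < k then (B * \<sigma> g) $$ (i, j) else (D * \<sigma> g) $$ (i - k, j))"
        using ij kl mat_mult_entry[OF Pc s ij] mat_mult_entry[OF B s] mat_mult_entry[OF D s]
        by (auto simp: P_def)
      moreover have "(diag2 ?X ?Y * P) $$ (i, j) = (if i < k then (?X * B) $$ (i, j) else (?Y * D) $$ (i - k, j))"
      proof -
        \<comment> \<open>The summation index splits at \<open>k\<close>: the first \<open>k\<close>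
          values belong to the first summand, the other \<open>l\<close>, shifted by
          \<open>k\<close>, to the second.\<close>
        have n: "{..<n} = {..<k} \<union> (\<lambda>m. m + k) ` {..<l}"
        proof safe
          fix x assume "x \<notin> (\<lambda>m. m + k) ` {..<l}" "x < n"
          then show "x < k" using kl by (metis image_eqI le_add_diff_inverse2 lessThan_iff linorder_not_le nat_add_left_cancel_less add.commute)
        qed (use kl in auto)
        have "(diag2 ?X ?Y * P) $$ (i, j) = (\<Sum>m<n. diag2 ?X ?Y $$ (i, m) * P $$ (m, j))"
          by (rule mat_mult_entry[OF XY Pc ij])
        also have "\<dots> = (\<Sum>m<k. diag2 ?X ?Y $$ (i, m) * P $$ (m, j)) + (\<Sum>m<l. diag2 ?X ?Y $$ (i, m + k) * P $$ (m + k, j))"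
          unfolding n by (subst sum.union_disjoint) (auto simp: sum.reindex)
        also have "\<dots> = (\<Sum>m<k. (if i < k then ?X $$ (i, m) else 0) * B $$ (m, j)) +
            (\<Sum>m<l. (if i < k then 0 else ?Y $$ (i - k, m)) * D $$ (m, j))"
          using ij kl by (intro arg_cong2[where f = "(+)"] sum.cong) (auto simp: P_def diag2_index[OF X Y])
        also have "\<dots> = (if i < k then (?X * B) $$ (i, j) else (?Y * D) $$ (i - k, j))"
          using ij kl mat_mult_entry[OF X B] mat_mult_entry[OF Y D] by auto
        finally show ?thesis .
      qed
      ultimately show "(P * \<sigma> g) $$ (i, j) = (diag2 ?X ?Y * P) $$ (i, j)" using 1 2 by simp
    qed (use XY Pc s in auto)
  qed
  have "rep_equiv G \<sigma> (rep_dsum (\<lambda>g. B * \<sigma> g * A) (\<lambda>g. D * \<sigma> g * C))"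
  proof (rule rep_equivI[OF \<sigma>(2) _ Pc Qc PQ eq])
    show "rep_dim G (rep_dsum (\<lambda>g. B * \<sigma> g * A) (\<lambda>g. D * \<sigma> g * C)) = n"
      using B D kl by (simp add: rep_dim_def rep_dsum_def)
  qed
  then show thesis using that[OF kl A B BA AB C D DC] CD by (simp add: q_def)
qed

section \<open>Products of coefficients, Kronecker products and matrix units\<close>

lemma continuous_map_mult_complex:
  fixes f g :: "'a \<Rightarrow> complex"
  assumes "continuous_map T euclidean f" "continuous_map T euclidean g"
  shows "continuous_map T euclidean (\<lambda>x. f x * g x)"
  using assms by (simp add: continuous_map_atin tendsto_mult)

text \<open>Row-major pairing of indices. Entries of Kronecker products and of the block matrices of
  induced representations are both summed through it.\<close>

lemma sum_div_mod:
  fixes f :: "nat \<Rightarrow> nat \<Rightarrow> 'a :: comm_monoid_add"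
  shows "(\<Sum>k<n * m. f (k div m) (k mod m)) = (\<Sum>a<n. \<Sum>b<m. f a b)"
proof (induction n)
  case (Suc n)
  have "{..<Suc n * m} = {..<n * m} \<union> {n * m..<n * m + m}"
    using ivl_disj_un_one(2)[of "n * m" "n * m + m"] by (simp add: add.commute)
  moreover have "{..<n * m} \<inter> {n * m..<n * m + m} = {}" by auto
  ultimately have "(\<Sum>k<Suc n * m. f (k div m) (k mod m)) =
      (\<Sum>k<n * m. f (k div m) (k mod m)) + (\<Sum>k\<in>{n * m..<n * m + m}. f (k div m) (k mod m))"
    by (simp only: sum.union_disjoint[OF finite_lessThan finite_atLeastLessThan])
  also have "(\<Sum>k\<in>{n * m..<n * m + m}. f (k div m) (k mod m)) = (\<Sum>b<m. f n b)"
  proof -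
    have "(\<Sum>k\<in>{n * m..<n * m + m}. f (k div m) (k mod m)) = (\<Sum>k\<in>(+) (n * m) ` {0..<m}. f (k div m) (k mod m))"
      by (simp add: add.commute)
    also have "\<dots> = (\<Sum>b\<in>{0..<m}. f ((n * m + b) div m) ((n * m + b) mod m))"
      by (subst sum.reindex) auto
    also have "\<dots> = (\<Sum>b<m. f n b)" by (rule sum.cong) auto
    finally show ?thesis .
  qed
  finally show ?case using Suc by simp
qed simp

lemma nat_div_mod_less:
  assumes "i < n * (m :: nat)" shows "i div m < n" "i mod m < m"
  using assms by (auto simp: less_mult_imp_div_less) (metis mod_less_divisor mult_0_right not_gr_zero not_less_zero)

lemma nat_mult_add_less:
  assumes "a < n" "b < (m :: nat)" shows "a * m + b < n * m"
proof -
  have "a * m + b < Suc a * m" using assms by simp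
  also have "\<dots> \<le> n * m" using assms by (intro mult_le_mono1) simp
  finally show ?thesis .
qed

lemma mat_trace_tensor:
  assumes "A \<in> carrier_mat n n" "B \<in> carrier_mat m m"
  shows "mat_trace (tensor_mat A B) = mat_trace A * mat_trace B"
proof -
  have "mat_trace (tensor_mat A B) =
      (\<Sum>k<n * m. A $$ (k div m, k div m) * B $$ (k mod m, k mod m))"
    unfolding mat_trace_def tensor_mat_def using assms by (auto intro!: sum.cong)
  also have "\<dots> = (\<Sum>a<n. \<Sum>b<m. A $$ (a, a) * B $$ (b, b))" by (rule sum_div_mod)
  also have "\<dots> = mat_trace A * mat_trace B"
    unfolding mat_trace_def using assms by (simp add: sum_product)
  finally show ?thesis .
qed

lemma tensor_mat_carrier:
  assumes "A \<in> carrier_mat n n'" "B \<in> carrier_mat m m'"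
  shows "tensor_mat A B \<in> carrier_mat (n * m) (n' * m')"
  using assms by (auto simp: tensor_mat_def)

lemma tensor_mat_index:
  assumes "A \<in> carrier_mat n n" "B \<in> carrier_mat m m" "i < n * m" "j < n * m"
  shows "tensor_mat A B $$ (i, j) = A $$ (i div m, j div m) * B $$ (i mod m, j mod m)"
  using assms by (auto simp: tensor_mat_def)

lemma tensor_mat_mult:
  assumes A: "A \<in> carrier_mat n n" and B: "B \<in> carrier_mat n n"
    and C: "C \<in> carrier_mat m m" and D: "D \<in> carrier_mat m m"
  shows "tensor_mat (A * B) (C * D) = tensor_mat A C * tensor_mat B D"
proof (rule eq_matI)
  note t = tensor_mat_carrier[OF A C] tensor_mat_carrier[OF B D]
  have AB: "A * B \<in> carrier_mat n n" and CD: "C * D \<in> carrier_mat m m" using A B C D by auto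
  fix i j assume "i < dim_row (tensor_mat A C * tensor_mat B D)" "j < dim_col (tensor_mat A C * tensor_mat B D)"
  then have ij: "i < n * m" "j < n * m" using t by auto
  note dm = nat_div_mod_less[OF ij(1)] nat_div_mod_less[OF ij(2)]
  have "(tensor_mat A C * tensor_mat B D) $$ (i, j) = (\<Sum>k<n * m. tensor_mat A C $$ (i, k) * tensor_mat B D $$ (k, j))"
    by (rule mat_mult_entry[OF t ij])
  also have "\<dots> = (\<Sum>k<n * m. (A $$ (i div m, k div m) * C $$ (i mod m, k mod m)) *
      (B $$ (k div m, j div m) * D $$ (k mod m, j mod m)))"
    using ij by (intro sum.cong) (auto simp: tensor_mat_index[OF A C] tensor_mat_index[OF B D])
  also have "\<dots> = (\<Sum>a<n. \<Sum>b<m. (A $$ (i div m, a) * C $$ (i mod m, b)) * (B $$ (a, j div m) * D $$ (b, j mod m)))"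
    by (rule sum_div_mod)
  also have "\<dots> = (A * B) $$ (i div m, j div m) * (C * D) $$ (i mod m, j mod m)"
    unfolding mat_mult_entry[OF A B dm(1,3)] mat_mult_entry[OF C D dm(2,4)] sum_product
    by (simp add: mult_ac)
  also have "\<dots> = tensor_mat (A * B) (C * D) $$ (i, j)" by (rule tensor_mat_index[OF AB CD ij, symmetric])
  finally show "tensor_mat (A * B) (C * D) $$ (i, j) = (tensor_mat A C * tensor_mat B D) $$ (i, j)" by simp
qed (use tensor_mat_carrier[OF A C] tensor_mat_carrier[OF B D] A B C D in \<open>auto simp: tensor_mat_def\<close>)

lemma tensor_mat_one: "tensor_mat (1\<^sub>m n) (1\<^sub>m m) = 1\<^sub>m (n * m)"
proof (rule eq_matI)
  fix i j assume "i < dim_row (1\<^sub>m (n * m) :: complex mat)" "j < dim_col (1\<^sub>m (n * m) :: complex mat)"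
  then have ij: "i < n * m" "j < n * m" by auto
  have "i = j \<longleftrightarrow> i div m = j div m \<and> i mod m = j mod m" by (metis div_mult_mod_eq)
  then show "tensor_mat (1\<^sub>m n) (1\<^sub>m m) $$ (i, j) = 1\<^sub>m (n * m) $$ (i, j)"
    using ij nat_div_mod_less[OF ij(1)] nat_div_mod_less[OF ij(2)]
    by (subst tensor_mat_index[of _ n _ m]) auto
qed (auto simp: tensor_mat_def)

definition elem_mat :: "nat \<Rightarrow> nat \<Rightarrow> nat \<Rightarrow> nat \<Rightarrow> complex mat" where
  "elem_mat n m a b = mat n m (\<lambda>(i, j). if i = a \<and> j = b then 1 else 0)"

lemma triple_mat_entry:
  fixes A X B :: "'a :: comm_semiring_1 mat"
  assumes A: "A \<in> carrier_mat r n" and X: "X \<in> carrier_mat n m" and B: "B \<in> carrier_mat m c"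
    and ij: "i < r" "j < c"
  shows "(A * X * B) $$ (i, j) = (\<Sum>a<n. \<Sum>b<m. A $$ (i, a) * X $$ (a, b) * B $$ (b, j))"
proof -
  have AX: "A * X \<in> carrier_mat r m" using A X by simp
  have "(A * X * B) $$ (i, j) = (\<Sum>b<m. (\<Sum>a<n. A $$ (i, a) * X $$ (a, b)) * B $$ (b, j))"
    using mat_mult_entry[OF AX B ij] mat_mult_entry[OF A X ij(1)] by simp
  also have "\<dots> = (\<Sum>a<n. \<Sum>b<m. A $$ (i, a) * X $$ (a, b) * B $$ (b, j))"
    by (subst sum.swap) (simp add: sum_distrib_right)
  finally show ?thesis .
qed

text \<open>A matrix unit between two factors isolates the product of one coefficient of each. Means
  of products of coefficients thereby become entries of means of matrix-valued functions.\<close>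

lemma triple_elem_mat_entry:
  assumes A: "A \<in> carrier_mat r n" and B: "B \<in> carrier_mat m c" and "i < r" "j < c" "a < n" "b < m"
  shows "(A * elem_mat n m a b * B) $$ (i, j) = A $$ (i, a) * B $$ (b, j)"
proof -
  have "(A * elem_mat n m a b * B) $$ (i, j) =
      (\<Sum>a'<n. \<Sum>b'<m. if a' = a then if b' = b then A $$ (i, a) * B $$ (b, j) else 0 else 0)"
    using assms by (subst triple_mat_entry[OF A _ B]) (auto simp: elem_mat_def intro!: sum.cong)
  also have "\<dots> = (\<Sum>a'<n. if a' = a then A $$ (i, a) * B $$ (b, j) else 0)"
    using \<open>b < m\<close> by (intro sum.cong) auto
  finally show ?thesis using \<open>a < n\<close> by simp
qed


section \<open>Entrywise means of matrix-valued functions\<close>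

definition entries_in :: "('a \<Rightarrow> complex) set \<Rightarrow> nat \<Rightarrow> nat \<Rightarrow> ('a \<Rightarrow> complex mat) \<Rightarrow> bool" where
  "entries_in F r c f \<longleftrightarrow> (\<forall>i<r. \<forall>j<c. (\<lambda>x. f x $$ (i, j)) \<in> F)"

definition mat_mean :: "(('a \<Rightarrow> complex) \<Rightarrow> complex) \<Rightarrow> nat \<Rightarrow> nat \<Rightarrow> ('a \<Rightarrow> complex mat) \<Rightarrow> complex mat" where
  "mat_mean M r c f = mat r c (\<lambda>(i, j). M (\<lambda>x. f x $$ (i, j)))"

lemma mat_mean_carrier[simp]: "mat_mean M r c f \<in> carrier_mat r c"
  by (simp add: mat_mean_def)

lemma mat_mean_index: "i < r \<Longrightarrow> j < c \<Longrightarrow> mat_mean M r c f $$ (i, j) = M (\<lambda>x. f x $$ (i, j))"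
  by (simp add: mat_mean_def)

lemma mat_mean_cong:
  assumes "invariant_mean G F M" "entries_in F r c f" "\<And>x. x \<in> carrier G \<Longrightarrow> f x = g x"
  shows "mat_mean M r c f = mat_mean M r c g"
proof (rule eq_matI)
  fix i j assume "i < dim_row (mat_mean M r c g)" "j < dim_col (mat_mean M r c g)"
  then have ij: "i < r" "j < c" by (auto simp: mat_mean_def)
  then show "mat_mean M r c f $$ (i, j) = mat_mean M r c g $$ (i, j)"
    using invariant_mean_cong(2)[OF assms(1), of "\<lambda>x. f x $$ (i, j)" "\<lambda>x. g x $$ (i, j)"] assms
    by (simp add: mat_mean_index entries_in_def)
qed (auto simp: mat_mean_def)

lemma mat_mean_const:
  assumes "invariant_mean G F M" "A \<in> carrier_mat r c"
  shows "mat_mean M r c (\<lambda>_. A) = A"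
  using assms invariant_mean_const(2)[OF assms(1)] by (intro eq_matI) (auto simp: mat_mean_def)

text \<open>Each entry of the product is a fixed linear combination of entries of \<open>f\<close>,
  so constant matrices leave the mean on both sides at once.\<close>

lemma mat_mean_mult:
  assumes M: "invariant_mean G F M" and f: "entries_in F n m f"
    and fc: "\<And>x. x \<in> carrier G \<Longrightarrow> f x \<in> carrier_mat n m"
    and A: "A \<in> carrier_mat r n" and B: "B \<in> carrier_mat m c"
  shows "entries_in F r c (\<lambda>x. A * f x * B)" "mat_mean M r c (\<lambda>x. A * f x * B) = A * mat_mean M n m f * B"
proof -
  have *: "(\<lambda>x. (A * f x * B) $$ (i, j)) \<in> F \<and>
      M (\<lambda>x. (A * f x * B) $$ (i, j)) = (A * mat_mean M n m f * B) $$ (i, j)"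
    if ij: "i < r" "j < c" for i j
  proof -
    define h where "h x = (\<Sum>a<n. \<Sum>b<m. (A $$ (i, a) * B $$ (b, j)) * f x $$ (a, b))" for x
    have in1: "(\<lambda>x. (A $$ (i, a) * B $$ (b, j)) * f x $$ (a, b)) \<in> F" if "a < n" "b < m" for a b
      using f that by (intro invariant_mean_cmult(1)[OF M]) (auto simp: entries_in_def)
    have in2: "(\<lambda>x. \<Sum>b<m. (A $$ (i, a) * B $$ (b, j)) * f x $$ (a, b)) \<in> F" if "a < n" for a
      using in1[OF that] by (rule invariant_mean_sum(1)[OF M]) simp
    have hF: "h \<in> F" unfolding h_def using in2 by (rule invariant_mean_sum(1)[OF M]) simp
    have heq: "h x = (A * f x * B) $$ (i, j)" if "x \<in> carrier G" for x
      unfolding triple_mat_entry[OF A fc[OF that] B ij] h_def by (simp add: mult_ac)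
    have "M h = (\<Sum>a<n. M (\<lambda>x. \<Sum>b<m. (A $$ (i, a) * B $$ (b, j)) * f x $$ (a, b)))"
      unfolding h_def using in2 by (rule invariant_mean_sum(2)[OF M]) simp
    also have "\<dots> = (\<Sum>a<n. \<Sum>b<m. M (\<lambda>x. (A $$ (i, a) * B $$ (b, j)) * f x $$ (a, b)))"
    proof (rule sum.cong[OF refl])
      fix a assume "a \<in> {..<n}"
      then show "M (\<lambda>x. \<Sum>b<m. (A $$ (i, a) * B $$ (b, j)) * f x $$ (a, b)) =
          (\<Sum>b<m. M (\<lambda>x. (A $$ (i, a) * B $$ (b, j)) * f x $$ (a, b)))"
        using in1 by (intro invariant_mean_sum(2)[OF M]) simp
    qed
    also have "\<dots> = (\<Sum>a<n. \<Sum>b<m. A $$ (i, a) * mat_mean M n m f $$ (a, b) * B $$ (b, j))"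
    proof (intro sum.cong refl)
      fix a b assume ab: "a \<in> {..<n}" "b \<in> {..<m}"
      then have "(\<lambda>x. f x $$ (a, b)) \<in> F" using f by (simp add: entries_in_def)
      then show "M (\<lambda>x. (A $$ (i, a) * B $$ (b, j)) * f x $$ (a, b)) = A $$ (i, a) * mat_mean M n m f $$ (a, b) * B $$ (b, j)"
        using invariant_mean_cmult(2)[OF M] ab by (simp add: mat_mean_index)
    qed
    also have "\<dots> = (A * mat_mean M n m f * B) $$ (i, j)"
      by (rule triple_mat_entry[OF A mat_mean_carrier B ij, symmetric])
    finally show ?thesis using invariant_mean_cong[OF M hF heq] by simp
  qed
  then show "entries_in F r c (\<lambda>x. A * f x * B)" by (simp add: entries_in_def)
  show "mat_mean M r c (\<lambda>x. A * f x * B) = A * mat_mean M n m f * B"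
    using * A B by (intro eq_matI) (auto simp: mat_mean_def)
qed

lemma mat_mean_translate:
  assumes M: "invariant_mean G F M" and f: "entries_in F n m f" and h: "h \<in> carrier G"
  shows "mat_mean M n m (\<lambda>x. f (h \<otimes>\<^bsub>G\<^esub> x)) = mat_mean M n m f"
  using f invariant_mean_translate(2)[OF M _ h]
  by (intro eq_matI) (auto simp: mat_mean_def entries_in_def)


section \<open>Representations of compact groups\<close>

text \<open>The contragredient, formed with transposed inverses instead of complex conjugates, since
  no invariant inner product is fixed on the representations.\<close>

definition dual_rep :: "('a, 'b) monoid_scheme \<Rightarrow> 'a rep \<Rightarrow> 'a rep" where
  "dual_rep G \<pi> = (\<lambda>g. transpose_mat (\<pi> (inv\<^bsub>G\<^esub> g)))"

definition trivial_rep :: "'a rep" where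
  "trivial_rep = (\<lambda>_. 1\<^sub>m 1)"

definition irr_chars :: "('a, 'b) monoid_scheme \<Rightarrow> 'a topology \<Rightarrow> ('a \<Rightarrow> complex) set" where
  "irr_chars G T = {ch G \<pi> | \<pi>. irr_rep G T \<pi>}"

locale compact_grp =
  fixes G :: "('a, 'b) monoid_scheme" (structure) and T :: "'a topology"
  assumes compact_group: "compact_group G T"
begin

sublocale group G
  using compact_group by (simp add: compact_group_def topological_group_def)

lemma topspace: "topspace T = carrier G"
  and continuous_mult: "continuous_map (prod_topology T T) T (\<lambda>(x, y). x \<otimes> y)"
  and continuous_inv: "continuous_map T T (\<lambda>x. inv x)"
  and compact: "compact_space T"
  using compact_group by (auto simp: compact_group_def topological_group_def)

lemma continuous_mult_map:
  assumes "continuous_map T T f" "continuous_map T T g"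
  shows "continuous_map T T (\<lambda>x. f x \<otimes> g x)"
  using continuous_map_compose[OF continuous_map_pairedI[OF assms] continuous_mult] by (simp add: o_def)

lemma continuous_bounded:
  fixes f :: "'a \<Rightarrow> complex"
  assumes "continuous_map T euclidean f"
  obtains B where "\<And>x. x \<in> carrier G \<Longrightarrow> cmod (f x) \<le> B"
proof -
  have "compact (f ` carrier G)"
    using image_compactin[OF _ assms, of "carrier G"] compact by (simp add: compact_space_def topspace)
  from compact_imp_bounded[OF this] that show thesis unfolding bounded_iff by blast
qed

lemma fd_repD:
  assumes "fd_rep G T \<pi>"
  shows "0 < rep_dim G \<pi>" "\<pi> \<one> = 1\<^sub>m (rep_dim G \<pi>)"
    and "g \<in> carrier G \<Longrightarrow> \<pi> g \<in> carrier_mat (rep_dim G \<pi>) (rep_dim G \<pi>)"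
    and "g \<in> carrier G \<Longrightarrow> h \<in> carrier G \<Longrightarrow> \<pi> (g \<otimes> h) = \<pi> g * \<pi> h"
    and "i < rep_dim G \<pi> \<Longrightarrow> j < rep_dim G \<pi> \<Longrightarrow> continuous_map T euclidean (\<lambda>g. \<pi> g $$ (i, j))"
  using assms unfolding fd_rep_def Let_def by blast+

lemma fd_repI:
  assumes "0 < n" "\<And>g. g \<in> carrier G \<Longrightarrow> \<pi> g \<in> carrier_mat n n" "\<pi> \<one> = 1\<^sub>m n"
    "\<And>g h. g \<in> carrier G \<Longrightarrow> h \<in> carrier G \<Longrightarrow> \<pi> (g \<otimes> h) = \<pi> g * \<pi> h"
    "\<And>i j. i < n \<Longrightarrow> j < n \<Longrightarrow> continuous_map T euclidean (\<lambda>g. \<pi> g $$ (i, j))"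
  shows "fd_rep G T \<pi>" "rep_dim G \<pi> = n"
proof -
  show "rep_dim G \<pi> = n" using assms(3) by (simp add: rep_dim_def)
  then show "fd_rep G T \<pi>" unfolding fd_rep_def Let_def using assms by blast
qed

lemma fd_rep_square: "fd_rep G T \<pi> \<Longrightarrow> square_rep G \<pi>"
  using fd_repD(3) by (simp add: square_rep_def)

lemma irr_rep_fd: "irr_rep G T \<pi> \<Longrightarrow> fd_rep G T \<pi>"
  by (simp add: irr_rep_def)

lemma irr_repD:
  assumes "irr_rep G T \<pi>" "lin_closed (rep_dim G \<pi>) W"
    "\<And>g v. g \<in> carrier G \<Longrightarrow> v \<in> W \<Longrightarrow> \<pi> g *\<^sub>v v \<in> W"
  shows "W = {0\<^sub>v (rep_dim G \<pi>)} \<or> W = carrier_vec (rep_dim G \<pi>)"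
  using assms unfolding irr_rep_def invariant_subspace_def subspace_iff_lin_closed by blast

lemma irr_repI:
  assumes "fd_rep G T \<pi>"
    "\<And>W. lin_closed (rep_dim G \<pi>) W \<Longrightarrow> (\<And>g v. g \<in> carrier G \<Longrightarrow> v \<in> W \<Longrightarrow> \<pi> g *\<^sub>v v \<in> W) \<Longrightarrow>
       W = {0\<^sub>v (rep_dim G \<pi>)} \<or> W = carrier_vec (rep_dim G \<pi>)"
  shows "irr_rep G T \<pi>"
  using assms unfolding irr_rep_def invariant_subspace_def subspace_iff_lin_closed by blast

lemma fd_rep_inv:
  assumes "fd_rep G T \<pi>" "g \<in> carrier G"
  shows "\<pi> g * \<pi> (inv g) = 1\<^sub>m (rep_dim G \<pi>)" "\<pi> (inv g) * \<pi> g = 1\<^sub>m (rep_dim G \<pi>)"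
  using fd_repD(4)[OF assms(1,2), of "inv g"] fd_repD(4)[OF assms(1) _ assms(2), of "inv g"]
    fd_repD(2)[OF assms(1)] assms(2) by simp_all

lemma ch_eq: "g \<in> carrier G \<Longrightarrow> ch G \<pi> g = mat_trace (\<pi> g) / of_nat (rep_dim G \<pi>)"
  by (simp add: ch_def)

lemma ch_one:
  assumes "fd_rep G T \<pi>" shows "ch G \<pi> \<one> = 1"
  using fd_repD(1)[OF assms] by (simp add: ch_eq fd_repD(2)[OF assms] mat_trace_one)

lemma ch_conj:
  assumes "fd_rep G T \<pi>" "g \<in> carrier G" "s \<in> carrier G"
  shows "ch G \<pi> (s \<otimes> g \<otimes> inv s) = ch G \<pi> g"
proof -
  let ?n = "rep_dim G \<pi>"
  note c = fd_repD(3)[OF assms(1)]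
  have "\<pi> (s \<otimes> g \<otimes> inv s) = \<pi> s * \<pi> g * \<pi> (inv s)"
    using assms fd_repD(4)[OF assms(1)] by simp
  moreover have "mat_trace (\<pi> s * \<pi> g * \<pi> (inv s)) = mat_trace (\<pi> (inv s) * (\<pi> s * \<pi> g))"
    using assms(2,3) by (intro mat_trace_mult_commute[of _ ?n ?n] mult_carrier_mat[of _ ?n ?n] c) auto
  moreover have "\<pi> (inv s) * (\<pi> s * \<pi> g) = \<pi> g"
    using assoc_mult_mat[OF c[of "inv s"] c[of s] c[of g]] left_mult_one_mat[OF c[of g]]
      fd_rep_inv(2)[OF assms(1,3)] assms(2,3) by simp
  ultimately show ?thesis using assms by (simp add: ch_eq)
qed

section \<open>Trivial, tensor and dual representations\<close>

lemma fd_rep_trivial: "fd_rep G T trivial_rep" "rep_dim G trivial_rep = 1"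
  using fd_repI[of 1 trivial_rep] by (auto simp: trivial_rep_def)

lemma ch_trivial: "ch G trivial_rep = (\<lambda>g\<in>carrier G. 1)"
  unfolding ch_def fd_rep_trivial(2) by (simp add: trivial_rep_def mat_trace_one)

lemma irr_rep_trivial: "irr_rep G T trivial_rep"
proof (rule irr_repI[OF fd_rep_trivial(1)], unfold fd_rep_trivial(2))
  fix W assume W: "lin_closed 1 W"
  have "W = carrier_vec 1" if w: "w \<in> W" "w \<noteq> 0\<^sub>v 1" for w
  proof -
    have wc: "w \<in> carrier_vec 1" using W w by (auto simp: lin_closed_def)
    have w0: "w $ 0 \<noteq> 0"
    proof
      assume "w $ 0 = 0"
      then have "w = 0\<^sub>v 1" using wc by (intro eq_vecI) auto
      with w(2) show False by simp
    qed
    have "v \<in> W" if v: "v \<in> carrier_vec 1" for v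
    proof -
      have "v = (v $ 0 / w $ 0) \<cdot>\<^sub>v w" using v wc w0 by (intro eq_vecI) auto
      moreover have "(v $ 0 / w $ 0) \<cdot>\<^sub>v w \<in> W" using W w by (simp add: lin_closed_def)
      ultimately show ?thesis by simp
    qed
    then show ?thesis using W by (auto simp: lin_closed_def)
  qed
  then show "W = {0\<^sub>v 1} \<or> W = carrier_vec 1" using W by (auto simp: lin_closed_def)
qed

lemma fd_rep_tensor:
  assumes "fd_rep G T \<pi>" "fd_rep G T \<sigma>"
  shows "fd_rep G T (tensor_rep \<pi> \<sigma>)" "rep_dim G (tensor_rep \<pi> \<sigma>) = rep_dim G \<pi> * rep_dim G \<sigma>"
proof -
  let ?n = "rep_dim G \<pi>" and ?m = "rep_dim G \<sigma>"
  note p = fd_repD[OF assms(1)] and s = fd_repD[OF assms(2)]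
  have cont: "continuous_map T euclidean (\<lambda>g. tensor_rep \<pi> \<sigma> g $$ (i, j))"
    if ij: "i < ?n * ?m" "j < ?n * ?m" for i j
  proof (rule continuous_map_eq)
    show "continuous_map T euclidean (\<lambda>g. \<pi> g $$ (i div ?m, j div ?m) * \<sigma> g $$ (i mod ?m, j mod ?m))"
      using nat_div_mod_less[OF ij(1)] nat_div_mod_less[OF ij(2)] p(5) s(5)
      by (intro continuous_map_mult_complex) auto
    show "\<pi> g $$ (i div ?m, j div ?m) * \<sigma> g $$ (i mod ?m, j mod ?m) = tensor_rep \<pi> \<sigma> g $$ (i, j)"
      if "g \<in> topspace T" for g
      using tensor_mat_index[OF p(3) s(3) ij] that by (simp add: topspace tensor_rep_def)
  qed
  have "0 < ?n * ?m" using p(1) s(1) by simp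
  note * = fd_repI[OF this, of "tensor_rep \<pi> \<sigma>"]
  show "fd_rep G T (tensor_rep \<pi> \<sigma>)"
    by (rule *(1)) (use p s cont in \<open>auto simp: tensor_rep_def tensor_mat_carrier tensor_mat_one tensor_mat_mult[OF p(3) p(3) s(3) s(3)]\<close>)
  show "rep_dim G (tensor_rep \<pi> \<sigma>) = ?n * ?m"
    by (rule *(2)) (use p s cont in \<open>auto simp: tensor_rep_def tensor_mat_carrier tensor_mat_one tensor_mat_mult[OF p(3) p(3) s(3) s(3)]\<close>)
qed

lemma ch_tensor:
  assumes "fd_rep G T \<pi>" "fd_rep G T \<sigma>"
  shows "ch G (tensor_rep \<pi> \<sigma>) = (\<lambda>g\<in>carrier G. ch G \<pi> g * ch G \<sigma> g)"
proof -
  have "mat_trace (tensor_rep \<pi> \<sigma> g) = mat_trace (\<pi> g) * mat_trace (\<sigma> g)" if "g \<in> carrier G" for g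
    unfolding tensor_rep_def using mat_trace_tensor fd_repD(3)[OF assms(1) that] fd_repD(3)[OF assms(2) that] by blast
  then show ?thesis unfolding ch_def fd_rep_tensor(2)[OF assms] by (intro restrict_ext) simp
qed

lemma fd_rep_dual:
  assumes "fd_rep G T \<pi>"
  shows "fd_rep G T (dual_rep G \<pi>)" "rep_dim G (dual_rep G \<pi>) = rep_dim G \<pi>"
proof -
  let ?n = "rep_dim G \<pi>"
  note p = fd_repD[OF assms]
  have mult: "dual_rep G \<pi> (g \<otimes> h) = dual_rep G \<pi> g * dual_rep G \<pi> h" if "g \<in> carrier G" "h \<in> carrier G" for g h
    using that p(4)[of "inv h" "inv g"] p(3)[of "inv h"] p(3)[of "inv g"]
    by (simp add: dual_rep_def inv_mult_group transpose_mult[of _ ?n ?n _ ?n])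
  have cont: "continuous_map T euclidean (\<lambda>g. dual_rep G \<pi> g $$ (i, j))" if ij: "i < ?n" "j < ?n" for i j
  proof (rule continuous_map_eq)
    show "continuous_map T euclidean (\<lambda>g. \<pi> (inv g) $$ (j, i))"
      using continuous_map_compose[OF continuous_inv p(5)[OF ij(2,1)]] by (simp add: o_def)
    show "\<pi> (inv g) $$ (j, i) = dual_rep G \<pi> g $$ (i, j)" if "g \<in> topspace T" for g
      using p(3)[of "inv g"] that ij by (simp add: topspace dual_rep_def)
  qed
  note * = fd_repI[OF p(1), of "dual_rep G \<pi>"]
  show "fd_rep G T (dual_rep G \<pi>)" by (rule *(1)) (use p mult cont in \<open>auto simp: dual_rep_def\<close>)
  show "rep_dim G (dual_rep G \<pi>) = ?n" by (rule *(2)) (use p mult cont in \<open>auto simp: dual_rep_def\<close>)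
qed

lemma ch_dual:
  assumes "fd_rep G T \<pi>"
  shows "ch G (dual_rep G \<pi>) = (\<lambda>g\<in>carrier G. ch G \<pi> (inv g))"
proof -
  have "mat_trace (dual_rep G \<pi> g) = mat_trace (\<pi> (inv g))" if "g \<in> carrier G" for g
    using fd_repD(3)[OF assms, of "inv g"] that by (simp add: mat_trace_def dual_rep_def)
  then show ?thesis unfolding ch_def fd_rep_dual(2)[OF assms] by (intro restrict_ext) simp
qed

text \<open>The annihilator \<open>U\<close> of a subspace \<open>W\<close> invariant under the dual
  is invariant under \<open>\<pi>\<close>, hence zero or everything. If it is everything,
  \<open>W\<close> is zero. If it is zero, the rows of \<open>1 - A * B\<close>, which annihilate
  \<open>W\<close>, vanish, so the projection \<open>A * B\<close> onto \<open>W\<close> is the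
  identity.\<close>

lemma irr_rep_dual:
  assumes irr: "irr_rep G T \<pi>"
  shows "irr_rep G T (dual_rep G \<pi>)"
proof (rule irr_repI)
  note fd = irr_rep_fd[OF irr]
  show "fd_rep G T (dual_rep G \<pi>)" by (rule fd_rep_dual[OF fd])
  let ?n = "rep_dim G \<pi>"
  fix W assume "lin_closed (rep_dim G (dual_rep G \<pi>)) W"
    and inv: "\<And>g v. g \<in> carrier G \<Longrightarrow> v \<in> W \<Longrightarrow> dual_rep G \<pi> g *\<^sub>v v \<in> W"
  then have W: "lin_closed ?n W" by (simp add: fd_rep_dual(2)[OF fd])
  then have Wc: "\<And>w. w \<in> W \<Longrightarrow> w \<in> carrier_vec ?n" and W0: "0\<^sub>v ?n \<in> W"
    unfolding lin_closed_def by blast+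
  obtain k A B where A: "A \<in> carrier_mat ?n k" and B: "B \<in> carrier_mat k ?n" and BA: "B * A = 1\<^sub>m k"
    and AW: "\<And>v. v \<in> carrier_vec k \<Longrightarrow> A *\<^sub>v v \<in> W" and ABw: "\<And>w. w \<in> W \<Longrightarrow> A *\<^sub>v (B *\<^sub>v w) = w"
    using subspace_basis[OF W] by metis
  define U where "U = {v \<in> carrier_vec ?n. \<forall>w\<in>W. w \<bullet> v = 0}"
  have "lin_closed ?n U"
    unfolding lin_closed_def U_def using Wc
    by (auto simp: scalar_prod_add_distrib[of _ ?n])
  moreover have "\<pi> g *\<^sub>v v \<in> U" if g: "g \<in> carrier G" and v: "v \<in> U" for g v
  proof -
    have "w \<bullet> (\<pi> g *\<^sub>v v) = 0" if w: "w \<in> W" for w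
    proof -
      have "w \<bullet> (\<pi> g *\<^sub>v v) = (transpose_mat (\<pi> g) *\<^sub>v w) \<bullet> v"
        using transpose_vec_mult_scalar[OF fd_repD(3)[OF fd g], of v w] v Wc[OF w] by (simp add: U_def)
      moreover have "transpose_mat (\<pi> g) *\<^sub>v w \<in> W"
        using inv[of "inv g" w] g w by (simp add: dual_rep_def)
      ultimately show ?thesis using v by (simp add: U_def)
    qed
    then show ?thesis using fd_repD(3)[OF fd g] v by (simp add: U_def)
  qed
  ultimately have "U = {0\<^sub>v ?n} \<or> U = carrier_vec ?n" by (rule irr_repD[OF irr])
  then show "W = {0\<^sub>v (rep_dim G (dual_rep G \<pi>))} \<or> W = carrier_vec (rep_dim G (dual_rep G \<pi>))"
    unfolding fd_rep_dual(2)[OF fd]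
  proof
    assume U: "U = carrier_vec ?n"
    have wz: "w = 0\<^sub>v ?n" if w: "w \<in> W" for w
    proof (rule eq_vecI)
      fix i assume "i < dim_vec (0\<^sub>v ?n :: complex vec)"
      then have i: "i < ?n" by simp
      have "unit_vec ?n i \<in> U" unfolding U by simp
      then have "w \<bullet> unit_vec ?n i = 0" using w by (simp add: U_def)
      then show "w $ i = 0\<^sub>v ?n $ i" using i Wc[OF w] by simp
    qed (use Wc[OF w] in simp)
    have "W = {0\<^sub>v ?n}"
    proof (rule subset_antisym)
      show "W \<subseteq> {0\<^sub>v ?n}" by (rule subsetI) (simp only: wz singleton_iff)
    qed (simp add: W0)
    then show "W = {0\<^sub>v ?n} \<or> W = carrier_vec ?n" by (rule disjI1)
  next
    assume U: "U = {0\<^sub>v ?n}"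
    have AB: "A * B \<in> carrier_mat ?n ?n" using A B by simp
    have "A * B = 1\<^sub>m ?n"
    proof (rule eq_matI)
      fix i j assume "i < dim_row (1\<^sub>m ?n :: complex mat)" "j < dim_col (1\<^sub>m ?n :: complex mat)"
      then have ij: "i < ?n" "j < ?n" by auto
      define r where "r = row (1\<^sub>m ?n - A * B) i"
      have rc: "r \<in> carrier_vec ?n" using row_carrier[of "1\<^sub>m ?n - A * B" i] B by (simp add: r_def)
      have "w \<bullet> r = 0" if w: "w \<in> W" for w
      proof -
        have "w \<bullet> r = r \<bullet> w" using rc Wc[OF w] by (rule comm_scalar_prod[rotated])
        also have "\<dots> = ((1\<^sub>m ?n - A * B) *\<^sub>v w) $ i" using ij A B by (simp add: r_def)
        also have "(1\<^sub>m ?n - A * B) *\<^sub>v w = w - (A * B) *\<^sub>v w"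
          using minus_mult_distrib_mat_vec[OF one_carrier_mat AB Wc[OF w]] Wc[OF w] by simp
        also have "(A * B) *\<^sub>v w = w" using ABw[OF w] A B Wc[OF w] by simp
        finally show ?thesis using Wc[OF w] ij by simp
      qed
      then have "r = 0\<^sub>v ?n" using rc U by (auto simp: U_def)
      then have "r $ j = 0" using ij by simp
      then show "(A * B) $$ (i, j) = 1\<^sub>m ?n $$ (i, j)" unfolding r_def using ij A B by simp
    qed (use A B in auto)
    then have "v = A *\<^sub>v (B *\<^sub>v v)" if "v \<in> carrier_vec ?n" for v
      using that A B assoc_mult_mat_vec[OF A B that] by simp
    then have "v \<in> W" if "v \<in> carrier_vec ?n" for v
      using that AW[of "B *\<^sub>v v"] B by (metis mult_mat_vec_carrier)
    then have "W = carrier_vec ?n" using Wc by (intro subset_antisym subsetI)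
    then show "W = {0\<^sub>v ?n} \<or> W = carrier_vec ?n" by (rule disjI2)
  qed
qed

text \<open>Because \<open>\<pi> (h \<otimes> x) = \<pi> h * \<pi> x\<close>, the coefficients are
  closed under left translation, with a translation matrix \<open>m\<close> whose entries are again
  coefficients or 0. One bound \<open>B\<close> therefore serves the functions and the
  matrices.\<close>

lemma mean_for_reps:
  assumes fin: "finite S" and fd: "\<And>\<pi>. \<pi> \<in> S \<Longrightarrow> fd_rep G T \<pi>"
  obtains F M where "invariant_mean G F M"
    "\<And>\<pi>. \<pi> \<in> S \<Longrightarrow> entries_in F (rep_dim G \<pi>) (rep_dim G \<pi>) \<pi>"
proof -
  let ?d = "rep_dim G"
  define I where "I = (SIGMA \<pi>:S. {..<?d \<pi>} \<times> {..<?d \<pi>})"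
  define f where "f = (\<lambda>(\<pi> :: 'a rep, i, j) x. \<pi> x $$ (i, j))"
  define m where "m h = (\<lambda>(\<pi> :: 'a rep, i :: nat, j :: nat) (\<pi>', i', j').
    if \<pi>' = \<pi> \<and> j' = j then \<pi> h $$ (i, i') else 0)" for h
  have finI: "finite I" unfolding I_def using fin by auto
  have "\<exists>b. \<forall>x\<in>carrier G. cmod (f k x) \<le> b" if k: "k \<in> I" for k
  proof -
    obtain \<pi> i j where "k = (\<pi>, i, j)" "\<pi> \<in> S" "i < ?d \<pi>" "j < ?d \<pi>" using k by (auto simp: I_def)
    then have "continuous_map T euclidean (f k)" using fd_repD(5)[OF fd] by (simp add: f_def)
    then show ?thesis using continuous_bounded by metis
  qed
  then obtain b where b: "\<And>k x. k \<in> I \<Longrightarrow> x \<in> carrier G \<Longrightarrow> cmod (f k x) \<le> b k" by metis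
  define B where "B = (\<Sum>k\<in>I. \<bar>b k\<bar>)"
  have bf: "cmod (f k x) \<le> B" if "k \<in> I" "x \<in> carrier G" for k x
    using b[OF that] member_le_sum[OF that(1) _ finI, of "\<lambda>k. \<bar>b k\<bar>"] unfolding B_def by fastforce
  have bm: "cmod (m h k l) \<le> B" if kl: "k \<in> I" "l \<in> I" and h: "h \<in> carrier G" for k l h
  proof -
    obtain \<pi> i j where k: "k = (\<pi>, i, j)" "\<pi> \<in> S" "i < ?d \<pi>" "j < ?d \<pi>" using kl by (auto simp: I_def)
    obtain \<pi>' i' j' where l: "l = (\<pi>', i', j')" "i' < ?d \<pi>'" using kl by (auto simp: I_def)
    have "0 \<le> B" by (simp add: B_def sum_nonneg)
    moreover have "cmod (\<pi> h $$ (i, i')) \<le> B" if "\<pi>' = \<pi>"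
      using bf[of "(\<pi>, i, i')" h] k l h that by (simp add: I_def f_def)
    ultimately show ?thesis by (simp add: m_def k l)
  qed
  have tr: "f k (h \<otimes> x) = (\<Sum>l\<in>I. m h k l * f l x)"
    if k: "k \<in> I" and h: "h \<in> carrier G" and x: "x \<in> carrier G" for k h x
  proof -
    obtain \<pi> i j where k: "k = (\<pi>, i, j)" "\<pi> \<in> S" "i < ?d \<pi>" "j < ?d \<pi>" using k by (auto simp: I_def)
    note p = fd_repD[OF fd[OF k(2)]]
    have "(\<Sum>l\<in>I. m h k l * f l x) = (\<Sum>l\<in>(\<lambda>i'. (\<pi>, i', j)) ` {..<?d \<pi>}. m h k l * f l x)"
      by (rule sum.mono_neutral_right[OF finI]) (auto simp: I_def m_def k split: if_splits)
    also have "\<dots> = (\<Sum>i'<?d \<pi>. \<pi> h $$ (i, i') * \<pi> x $$ (i', j))"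
      by (subst sum.reindex) (auto simp: inj_on_def m_def f_def k)
    also have "\<dots> = (\<pi> h * \<pi> x) $$ (i, j)"
      by (rule mat_mult_entry[OF p(3)[OF h] p(3)[OF x] k(3,4), symmetric])
    finally show ?thesis using p(4)[OF h x] by (simp add: f_def k)
  qed
  obtain F M where FM: "invariant_mean G F M" "\<forall>k\<in>I. f k \<in> F"
    using invariant_mean_exists[of I f B m B, OF finI bf bm tr] by blast
  have "(\<lambda>x. \<pi> x $$ (i, j)) \<in> F" if "\<pi> \<in> S" "i < ?d \<pi>" "j < ?d \<pi>" for \<pi> i j
    using FM(2) that by (force simp: I_def f_def)
  then show thesis using that FM(1) unfolding entries_in_def by blast
qed

text \<open>The average \<open>P\<close> intertwines the dual of \<open>\<sigma>\<close> with
  \<open>\<rho>\<close>. A transpose in place of an inverse keeps the entries of \<open>f\<close>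
  linear in the coefficients of the tensor product; when \<open>\<sigma>\<close> is itself a dual,
  \<open>f\<close> is the usual integrand of a conjugation average.\<close>

lemma mean_intertwines:
  assumes M: "invariant_mean G F M" and r: "fd_rep G T \<rho>" and s: "fd_rep G T \<sigma>"
    and ent: "entries_in F (rep_dim G \<rho> * rep_dim G \<sigma>) (rep_dim G \<rho> * rep_dim G \<sigma>) (tensor_rep \<rho> \<sigma>)"
    and X: "X \<in> carrier_mat (rep_dim G \<rho>) (rep_dim G \<sigma>)"
  defines "f \<equiv> \<lambda>x. \<rho> x * X * transpose_mat (\<sigma> x)"
  defines "P \<equiv> mat_mean M (rep_dim G \<rho>) (rep_dim G \<sigma>) f"
  shows "entries_in F (rep_dim G \<rho>) (rep_dim G \<sigma>) f"
    and "h \<in> carrier G \<Longrightarrow> \<rho> h * P * transpose_mat (\<sigma> h) = P"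
proof -
  let ?n = "rep_dim G \<rho>" and ?m = "rep_dim G \<sigma>"
  note rD = fd_repD[OF r] and sD = fd_repD[OF s]
  have sT: "transpose_mat (\<sigma> x) \<in> carrier_mat ?m ?m" if "x \<in> carrier G" for x using sD(3)[OF that] by simp
  have fc: "f x \<in> carrier_mat ?n ?m" if "x \<in> carrier G" for x
    unfolding f_def using rD(3)[OF that] sT[OF that] X by simp
  have coef: "(\<lambda>x. \<rho> x $$ (i, a) * \<sigma> x $$ (j, b)) \<in> F" if "i < ?n" "a < ?n" "j < ?m" "b < ?m" for i a j b
  proof -
    \<comment> \<open>Row-major positions at which the Kronecker product carries the desired product
      of coefficients.\<close>
    have ij: "i * ?m + j < ?n * ?m" "a * ?m + b < ?n * ?m" using that by (auto intro!: nat_mult_add_less)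
    then have "(\<lambda>x. tensor_rep \<rho> \<sigma> x $$ (i * ?m + j, a * ?m + b)) \<in> F" using ent by (simp add: entries_in_def)
    then show ?thesis
    proof (rule invariant_mean_cong(1)[OF M])
      fix x assume "x \<in> carrier G"
      then show "tensor_rep \<rho> \<sigma> x $$ (i * ?m + j, a * ?m + b) = \<rho> x $$ (i, a) * \<sigma> x $$ (j, b)"
        using tensor_mat_index[OF rD(3) sD(3) ij] that by (simp add: tensor_rep_def)
    qed
  qed
  show ent_f: "entries_in F ?n ?m f" unfolding entries_in_def
  proof (intro allI impI)
    fix i j assume ij: "i < ?n" "j < ?m"
    have "(\<lambda>x. \<Sum>a<?n. \<Sum>b<?m. X $$ (a, b) * (\<rho> x $$ (i, a) * \<sigma> x $$ (j, b))) \<in> F"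
      using ij by (intro invariant_mean_sum(1)[OF M] invariant_mean_cmult(1)[OF M] coef) auto
    then show "(\<lambda>x. f x $$ (i, j)) \<in> F"
    proof (rule invariant_mean_cong(1)[OF M])
      fix x assume x: "x \<in> carrier G"
      show "(\<Sum>a<?n. \<Sum>b<?m. X $$ (a, b) * (\<rho> x $$ (i, a) * \<sigma> x $$ (j, b))) = f x $$ (i, j)"
        unfolding f_def triple_mat_entry[OF rD(3)[OF x] X sT[OF x] ij]
        using sD(3)[OF x] ij by (intro sum.cong refl) (auto simp: mult_ac)
    qed
  qed
  assume h: "h \<in> carrier G"
  have "P = mat_mean M ?n ?m (\<lambda>x. f (h \<otimes> x))" unfolding P_def using mat_mean_translate[OF M ent_f h] by simp
  also have "\<dots> = mat_mean M ?n ?m (\<lambda>x. \<rho> h * f x * transpose_mat (\<sigma> h))"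
  proof (rule mat_mean_cong[OF M])
    show "entries_in F ?n ?m (\<lambda>x. f (h \<otimes> x))"
      unfolding entries_in_def
    proof (intro allI impI)
      fix i j assume "i < ?n" "j < ?m"
      then have "(\<lambda>x. f x $$ (i, j)) \<in> F" using ent_f by (simp add: entries_in_def)
      from invariant_mean_translate(1)[OF M this h] show "(\<lambda>x. f (h \<otimes> x) $$ (i, j)) \<in> F" .
    qed
    fix x assume x: "x \<in> carrier G"
    have c: "\<rho> h \<in> carrier_mat ?n ?n" "\<rho> x \<in> carrier_mat ?n ?n" "transpose_mat (\<sigma> x) \<in> carrier_mat ?m ?m"
      "transpose_mat (\<sigma> h) \<in> carrier_mat ?m ?m" using rD(3) sT h x by auto
    have "f (h \<otimes> x) = \<rho> h * \<rho> x * X * (transpose_mat (\<sigma> x) * transpose_mat (\<sigma> h))"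
      unfolding f_def rD(4)[OF h x] sD(4)[OF h x] transpose_mult[OF sD(3)[OF h] sD(3)[OF x]] ..
    also have "\<dots> = \<rho> h * \<rho> x * X * transpose_mat (\<sigma> x) * transpose_mat (\<sigma> h)"
      by (rule assoc_mult_mat[symmetric, of _ ?n ?m _ ?m _ ?m]) (use c X in auto)
    also have "\<rho> h * \<rho> x * X * transpose_mat (\<sigma> x) = \<rho> h * f x"
      unfolding f_def using c X
      by (simp add: assoc_mult_mat[of _ ?n ?n _ ?n _ ?m] assoc_mult_mat[of _ ?n ?n _ ?m _ ?m])
    finally show "f (h \<otimes> x) = \<rho> h * f x * transpose_mat (\<sigma> h)" .
  qed
  also have "\<dots> = \<rho> h * P * transpose_mat (\<sigma> h)"
    unfolding P_def using mat_mean_mult(2)[OF M ent_f fc rD(3)[OF h] sT[OF h]] .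
  finally show "\<rho> h * P * transpose_mat (\<sigma> h) = P" by simp
qed

end

section \<open>Schur's lemma\<close>

context compact_grp
begin

text \<open>The relation says that \<open>X\<close> intertwines the dual of \<open>\<sigma>\<close>
  with \<open>\<rho>\<close>. The range of \<open>X\<close> is invariant and nonzero, hence
  everything, which gives a right inverse. The transpose of \<open>X\<close> satisfies the same
  relation with the roles exchanged, and its right inverse, transposed, is a left inverse of
  \<open>X\<close>. Kernels and irreducibility of the dual are thus avoided.\<close>

lemma schur:
  assumes r: "irr_rep G T \<rho>" and s: "irr_rep G T \<sigma>"
    and X: "X \<in> carrier_mat (rep_dim G \<rho>) (rep_dim G \<sigma>)"
    and inv: "\<And>h. h \<in> carrier G \<Longrightarrow> \<rho> h * X * transpose_mat (\<sigma> h) = X"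
    and ne: "X \<noteq> 0\<^sub>m (rep_dim G \<rho>) (rep_dim G \<sigma>)"
  obtains Y where "Y \<in> carrier_mat (rep_dim G \<sigma>) (rep_dim G \<rho>)"
    "X * Y = 1\<^sub>m (rep_dim G \<rho>)" "Y * X = 1\<^sub>m (rep_dim G \<sigma>)"
proof -
  have surj: "\<exists>Y. Y \<in> carrier_mat (rep_dim G \<sigma>') (rep_dim G \<rho>') \<and> Z * Y = 1\<^sub>m (rep_dim G \<rho>')"
    if r': "irr_rep G T \<rho>'" and s': "irr_rep G T \<sigma>'"
      and Z: "Z \<in> carrier_mat (rep_dim G \<rho>') (rep_dim G \<sigma>')"
      and inv': "\<And>h. h \<in> carrier G \<Longrightarrow> \<rho>' h * Z * transpose_mat (\<sigma>' h) = Z"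
      and ne': "Z \<noteq> 0\<^sub>m (rep_dim G \<rho>') (rep_dim G \<sigma>')" for \<rho>' \<sigma>' :: "'a rep" and Z
  proof -
    let ?n = "rep_dim G \<rho>'" and ?m = "rep_dim G \<sigma>'"
    note rD = fd_repD[OF irr_rep_fd[OF r']] and sD = fd_repD[OF irr_rep_fd[OF s']]
    define W where "W = (\<lambda>v. Z *\<^sub>v v) ` carrier_vec ?m"
    have "lin_closed ?n W"
      unfolding lin_closed_def
    proof (intro conjI ballI allI)
      show "W \<subseteq> carrier_vec ?n" using Z by (auto simp: W_def)
      show "0\<^sub>v ?n \<in> W" unfolding W_def
        by (rule image_eqI[of _ _ "0\<^sub>v ?m"]) (use Z in auto)
      fix v assume "v \<in> W"
      then obtain v' where v': "v' \<in> carrier_vec ?m" "v = Z *\<^sub>v v'" by (auto simp: W_def)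
      show "c \<cdot>\<^sub>v v \<in> W" for c
        unfolding W_def v'(2) mult_mat_vec[OF Z v'(1), symmetric] using v'(1) by (intro imageI) simp
      fix w assume "w \<in> W"
      then obtain w' where w': "w' \<in> carrier_vec ?m" "w = Z *\<^sub>v w'" by (auto simp: W_def)
      show "v + w \<in> W"
        unfolding W_def v'(2) w'(2) mult_add_distrib_mat_vec[OF Z v'(1) w'(1), symmetric]
        using v'(1) w'(1) by (intro imageI) simp
    qed
    moreover have "\<rho>' g *\<^sub>v v \<in> W" if g: "g \<in> carrier G" and v: "v \<in> W" for g v
    proof -
      obtain v' where v': "v' \<in> carrier_vec ?m" "v = Z *\<^sub>v v'" using v by (auto simp: W_def)
      let ?S = "transpose_mat (\<sigma>' g)" and ?S' = "transpose_mat (\<sigma>' (inv g))"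
      have S: "?S \<in> carrier_mat ?m ?m" "?S' \<in> carrier_mat ?m ?m" using sD(3) g by auto
      have SS: "?S * ?S' = 1\<^sub>m ?m"
        using transpose_mult[OF sD(3)[of "inv g"] sD(3)[of g]] fd_rep_inv(2)[OF irr_rep_fd[OF s'] g] g by simp
      have "\<rho>' g * Z = \<rho>' g * Z * (?S * ?S')" unfolding SS using rD(3)[OF g] Z by simp
      also have "\<dots> = \<rho>' g * Z * ?S * ?S'"
        by (rule assoc_mult_mat[symmetric, OF mult_carrier_mat[OF rD(3)[OF g] Z] S])
      also have "\<dots> = Z * ?S'" unfolding inv'[OF g] ..
      finally have "\<rho>' g *\<^sub>v v = Z *\<^sub>v (?S' *\<^sub>v v')"
        using assoc_mult_mat_vec[OF rD(3)[OF g] Z v'(1)] assoc_mult_mat_vec[OF Z S(2) v'(1)] v'(2) by simp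
      then show ?thesis unfolding W_def using S(2) v'(1)
        by (intro image_eqI[of _ _ "?S' *\<^sub>v v'"]) auto
    qed
    ultimately have "W = {0\<^sub>v ?n} \<or> W = carrier_vec ?n" by (rule irr_repD[OF r'])
    moreover have "W \<noteq> {0\<^sub>v ?n}"
    proof
      assume W0: "W = {0\<^sub>v ?n}"
      have "Z = 0\<^sub>m ?n ?m"
      proof (rule eq_matI)
        fix i j assume "i < dim_row (0\<^sub>m ?n ?m :: complex mat)" "j < dim_col (0\<^sub>m ?n ?m :: complex mat)"
        then have ij: "i < ?n" "j < ?m" by auto
        have "Z *\<^sub>v unit_vec ?m j \<in> W" unfolding W_def by (intro imageI) simp
        then have "col Z j = 0\<^sub>v ?n" using W0 mult_mat_unit_vec[OF Z ij(2)] by simp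
        then have "col Z j $ i = 0" using ij by simp
        then show "Z $$ (i, j) = 0\<^sub>m ?n ?m $$ (i, j)" using ij Z by simp
      qed (use Z in auto)
      with ne' show False by simp
    qed
    ultimately have W: "W = carrier_vec ?n" by blast
    have "\<exists>y\<in>carrier_vec ?m. Z *\<^sub>v y = unit_vec ?n j" for j
      using W unit_vec_carrier[of ?n j] unfolding W_def by (metis imageE)
    then obtain y where y: "\<And>j. y j \<in> carrier_vec ?m" "\<And>j. Z *\<^sub>v y j = unit_vec ?n j" by metis
    define Y where "Y = mat ?m ?n (\<lambda>(i, j). y j $ i)"
    have Y: "Y \<in> carrier_mat ?m ?n" by (simp add: Y_def)
    have "Z * Y = 1\<^sub>m ?n"
    proof (rule eq_matI)
      fix i j assume "i < dim_row (1\<^sub>m ?n :: complex mat)" "j < dim_col (1\<^sub>m ?n :: complex mat)"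
      then have ij: "i < ?n" "j < ?n" by auto
      have "(Z * Y) $$ (i, j) = (Z *\<^sub>v y j) $ i"
        unfolding mat_mult_entry[OF Z Y ij] mat_vec_entry[OF Z y(1) ij(1)]
        using ij by (intro sum.cong) (auto simp: Y_def)
      then show "(Z * Y) $$ (i, j) = 1\<^sub>m ?n $$ (i, j)" unfolding y(2) using ij by simp
    qed (use Z Y in auto)
    with Y show ?thesis by blast
  qed
  let ?n = "rep_dim G \<rho>" and ?m = "rep_dim G \<sigma>"
  obtain Y where Y: "Y \<in> carrier_mat ?m ?n" "X * Y = 1\<^sub>m ?n" using surj[OF r s X inv ne] by blast
  have XT: "transpose_mat X \<in> carrier_mat ?m ?n" using X by simp
  have "\<sigma> h * transpose_mat X * transpose_mat (\<rho> h) = transpose_mat X" if h: "h \<in> carrier G" for h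
  proof -
    have c: "\<rho> h \<in> carrier_mat ?n ?n" "\<sigma> h \<in> carrier_mat ?m ?m"
      using fd_repD(3)[OF irr_rep_fd[OF r] h] fd_repD(3)[OF irr_rep_fd[OF s] h] .
    have cT: "transpose_mat (\<rho> h) \<in> carrier_mat ?n ?n" "transpose_mat (\<sigma> h) \<in> carrier_mat ?m ?m"
      using c by auto
    have "transpose_mat X = transpose_mat (\<rho> h * X * transpose_mat (\<sigma> h))" unfolding inv[OF h] ..
    also have "\<dots> = transpose_mat (transpose_mat (\<sigma> h)) * transpose_mat (\<rho> h * X)"
      by (rule transpose_mult[OF mult_carrier_mat[OF c(1) X] cT(2)])
    also have "\<dots> = \<sigma> h * (transpose_mat X * transpose_mat (\<rho> h))"
      unfolding transpose_mult[OF c(1) X] by simp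
    also have "\<dots> = \<sigma> h * transpose_mat X * transpose_mat (\<rho> h)"
      by (rule assoc_mult_mat[symmetric, OF c(2) XT cT(1)])
    finally show ?thesis by simp
  qed
  moreover have "transpose_mat X \<noteq> 0\<^sub>m ?m ?n" using ne by (metis transpose_transpose zero_transpose_mat)
  ultimately obtain V where V: "V \<in> carrier_mat ?n ?m" "transpose_mat X * V = 1\<^sub>m ?m"
    using surj[OF s r XT] by blast
  have VT: "transpose_mat V \<in> carrier_mat ?m ?n" using V by simp
  have VX: "transpose_mat V * X = 1\<^sub>m ?m"
    using transpose_mult[OF XT V(1)] V(2) by simp
  have "transpose_mat V = transpose_mat V * (X * Y)" using VT Y by simp
  also have "\<dots> = Y" using assoc_mult_mat[OF VT X Y(1)] VX Y(1) by simp
  finally show thesis using that[OF Y] VX by simp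
qed

text \<open>\<open>X\<close> is invertible by Schur's lemma, so \<open>\<rho> g\<close> is conjugate
  to the transpose of \<open>\<sigma> (inv g)\<close>. Invertibility also makes the dimensions
  equal, as the normalisation of the characters demands.\<close>

lemma ch_eq_inverse_if_intertwined:
  assumes r: "irr_rep G T \<rho>" and s: "irr_rep G T \<sigma>"
    and X: "X \<in> carrier_mat (rep_dim G \<rho>) (rep_dim G \<sigma>)"
    and inv: "\<And>h. h \<in> carrier G \<Longrightarrow> \<rho> h * X * transpose_mat (\<sigma> h) = X"
    and ne: "X \<noteq> 0\<^sub>m (rep_dim G \<rho>) (rep_dim G \<sigma>)" and g: "g \<in> carrier G"
  shows "ch G \<rho> g = ch G \<sigma> (inv g)"
proof -
  let ?n = "rep_dim G \<rho>" and ?m = "rep_dim G \<sigma>"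
  obtain Y where Y: "Y \<in> carrier_mat ?m ?n" and XY: "X * Y = 1\<^sub>m ?n" and YX: "Y * X = 1\<^sub>m ?m"
    using schur[OF r s X inv ne] by blast
  have nm: "?n = ?m" using left_inverse_dim_le[OF X Y YX] left_inverse_dim_le[OF Y X XY] by simp
  note fr = irr_rep_fd[OF r] and fs = irr_rep_fd[OF s]
  have gi: "inv g \<in> carrier G" using g by simp
  note c = fd_repD(3)[OF fr g] fd_repD(3)[OF fs g] fd_repD(3)[OF fs gi]
  let ?S = "transpose_mat (\<sigma> g)" and ?S' = "transpose_mat (\<sigma> (inv g))"
  have S: "?S \<in> carrier_mat ?m ?m" "?S' \<in> carrier_mat ?m ?m" using c by auto
  have SS: "?S * ?S' = 1\<^sub>m ?m"
    using transpose_mult[OF c(3,2)] fd_rep_inv(2)[OF fs g] by simp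
  have rX: "\<rho> g * X \<in> carrier_mat ?n ?m" using c X by simp
  have "\<rho> g * X = \<rho> g * X * (?S * ?S')" unfolding SS by (rule right_mult_one_mat[OF rX, symmetric])
  also have "\<dots> = X * ?S'" unfolding assoc_mult_mat[symmetric, OF rX S] inv[OF g] ..
  finally have eq: "\<rho> g * X = X * ?S'" .
  have "\<rho> g = \<rho> g * (X * Y)" unfolding XY using c by simp
  also have "\<dots> = X * ?S' * Y" unfolding assoc_mult_mat[symmetric, OF c(1) X Y] eq ..
  finally have "mat_trace (\<rho> g) = mat_trace (X * ?S' * Y)" by simp
  also have "\<dots> = mat_trace (Y * (X * ?S'))"
    by (rule mat_trace_mult_commute[OF mult_carrier_mat[OF X S(2)] Y])
  also have "Y * (X * ?S') = ?S'" unfolding assoc_mult_mat[symmetric, OF Y X S(2)] YX using S by simp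
  also have "mat_trace ?S' = mat_trace (\<sigma> (inv g))" using c by (simp add: mat_trace_def)
  finally show ?thesis using g nm by (simp add: ch_eq)
qed

text \<open>Over the complex numbers \<open>X\<close> has an eigenvalue; its eigenspace is nonzero
  and invariant, hence the whole space.\<close>

lemma schur_scalar:
  assumes r: "irr_rep G T \<rho>" and X: "X \<in> carrier_mat (rep_dim G \<rho>) (rep_dim G \<rho>)"
    and comm: "\<And>h. h \<in> carrier G \<Longrightarrow> \<rho> h * X = X * \<rho> h"
  obtains c where "X = c \<cdot>\<^sub>m 1\<^sub>m (rep_dim G \<rho>)"
proof -
  let ?n = "rep_dim G \<rho>"
  note rD = fd_repD[OF irr_rep_fd[OF r]]
  obtain c where "c \<in> spectrum X" using spectrum_non_empty[OF X rD(1)] by blast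
  then obtain u where u: "u \<in> carrier_vec ?n" "u \<noteq> 0\<^sub>v ?n" "X *\<^sub>v u = c \<cdot>\<^sub>v u"
    using X unfolding spectrum_def eigenvalue_def eigenvector_def by auto
  define W where "W = {v \<in> carrier_vec ?n. X *\<^sub>v v = c \<cdot>\<^sub>v v}"
  have "lin_closed ?n W"
    unfolding lin_closed_def W_def using X
    by (auto simp: mult_add_distrib_mat_vec[OF X] mult_mat_vec[OF X] smult_add_distrib_vec[of _ ?n]
        smult_smult_assoc mult.commute)
  moreover have "\<rho> g *\<^sub>v v \<in> W" if g: "g \<in> carrier G" and v: "v \<in> W" for g v
  proof -
    have vc: "v \<in> carrier_vec ?n" "X *\<^sub>v v = c \<cdot>\<^sub>v v" using v by (auto simp: W_def)
    have "X *\<^sub>v (\<rho> g *\<^sub>v v) = \<rho> g *\<^sub>v (X *\<^sub>v v)"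
      using assoc_mult_mat_vec[OF X rD(3)[OF g] vc(1)] assoc_mult_mat_vec[OF rD(3)[OF g] X vc(1)] comm[OF g] by simp
    also have "\<dots> = c \<cdot>\<^sub>v (\<rho> g *\<^sub>v v)" unfolding vc(2) by (rule mult_mat_vec[OF rD(3)[OF g] vc(1)])
    finally show ?thesis using rD(3)[OF g] vc by (simp add: W_def)
  qed
  ultimately have "W = {0\<^sub>v ?n} \<or> W = carrier_vec ?n" by (rule irr_repD[OF r])
  moreover have "u \<in> W" using u by (simp add: W_def)
  ultimately have W: "W = carrier_vec ?n" using u by auto
  have "X = c \<cdot>\<^sub>m 1\<^sub>m ?n"
  proof (rule eq_matI)
    fix i j assume "i < dim_row (c \<cdot>\<^sub>m 1\<^sub>m ?n)" "j < dim_col (c \<cdot>\<^sub>m 1\<^sub>m ?n)"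
    then have ij: "i < ?n" "j < ?n" by auto
    have "unit_vec ?n j \<in> W" unfolding W by simp
    then have "col X j = c \<cdot>\<^sub>v unit_vec ?n j" using mult_mat_unit_vec[OF X ij(2)] by (simp add: W_def)
    then have "col X j $ i = (c \<cdot>\<^sub>v unit_vec ?n j) $ i" by simp
    then show "X $$ (i, j) = (c \<cdot>\<^sub>m 1\<^sub>m ?n) $$ (i, j)" using ij X by auto
  qed (use X in auto)
  with that show thesis by blast
qed


subsection \<open>Orthogonality and independence of characters\<close>

text \<open>The product \<open>\<rho> x $$ (a, a) * \<sigma> x $$ (b, b)\<close> is the
  \<open>(a, b)\<close> entry of the integrand formed with the matrix unit at \<open>(a, b)\<close>.
  Summing over \<open>a\<close> and \<open>b\<close> expresses the mean of a product of characters
  by averaged intertwiners, to which Schur's lemma applies.\<close>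

lemma ch_product_mean:
  assumes M: "invariant_mean G F M" and r: "fd_rep G T \<rho>" and s: "fd_rep G T \<sigma>"
    and ent: "entries_in F (rep_dim G \<rho> * rep_dim G \<sigma>) (rep_dim G \<rho> * rep_dim G \<sigma>) (tensor_rep \<rho> \<sigma>)"
  defines "n \<equiv> rep_dim G \<rho>" and "m \<equiv> rep_dim G \<sigma>"
  shows "(\<lambda>x. ch G \<rho> x * ch G \<sigma> x) \<in> F"
    and "M (\<lambda>x. ch G \<rho> x * ch G \<sigma> x) = (\<Sum>a<n. \<Sum>b<m.
      mat_mean M n m (\<lambda>x. \<rho> x * elem_mat n m a b * transpose_mat (\<sigma> x)) $$ (a, b)) / (of_nat n * of_nat m)"
proof -
  define h where "h a b x = (\<rho> x * elem_mat n m a b * transpose_mat (\<sigma> x)) $$ (a, b)" for a b x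
  have h_eq: "h a b = (\<lambda>x. (\<rho> x * elem_mat n m a b * transpose_mat (\<sigma> x)) $$ (a, b))" for a b
    by (simp add: h_def fun_eq_iff)
  have e: "elem_mat n m a b \<in> carrier_mat n m" for a b by (simp add: elem_mat_def)
  have hF: "h a b \<in> F" if "a < n" "b < m" for a b
    using mean_intertwines(1)[OF M r s ent e[unfolded n_def m_def], of a b] that
    unfolding entries_in_def h_def n_def m_def by blast
  have h: "h a b x = \<rho> x $$ (a, a) * \<sigma> x $$ (b, b)" if "a < n" "b < m" "x \<in> carrier G" for a b x
  proof -
    have "\<rho> x \<in> carrier_mat n n" "\<sigma> x \<in> carrier_mat m m"
      using fd_repD(3)[OF r that(3)] fd_repD(3)[OF s that(3)] by (auto simp: n_def m_def)
    then show ?thesis unfolding h_def using that by (subst triple_elem_mat_entry) auto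
  qed
  define c :: complex where "c = 1 / (of_nat n * of_nat m)"
  have inF1: "(\<lambda>x. \<Sum>b<m. h a b x) \<in> F" if "a < n" for a
    using hF[OF that] by (rule invariant_mean_sum(1)[OF M]) simp
  have inF2: "(\<lambda>x. \<Sum>a<n. \<Sum>b<m. h a b x) \<in> F"
    using inF1 by (rule invariant_mean_sum(1)[OF M]) simp
  have eq: "c * (\<Sum>a<n. \<Sum>b<m. h a b x) = ch G \<rho> x * ch G \<sigma> x" if x: "x \<in> carrier G" for x
  proof -
    have "(\<Sum>a<n. \<Sum>b<m. h a b x) = (\<Sum>a<n. \<Sum>b<m. \<rho> x $$ (a, a) * \<sigma> x $$ (b, b))"
      using h x by (intro sum.cong) auto
    also have "\<dots> = mat_trace (\<rho> x) * mat_trace (\<sigma> x)"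
      using fd_repD(3)[OF r x] fd_repD(3)[OF s x] by (simp add: mat_trace_def sum_product n_def m_def)
    finally show ?thesis using x by (simp add: ch_eq c_def n_def m_def)
  qed
  note inF3 = invariant_mean_cmult[OF M inF2, of c]
  note * = invariant_mean_cong[OF M inF3(1) eq]
  show "(\<lambda>x. ch G \<rho> x * ch G \<sigma> x) \<in> F" by (rule *(1))
  have "M (\<lambda>x. ch G \<rho> x * ch G \<sigma> x) = c * M (\<lambda>x. \<Sum>a<n. \<Sum>b<m. h a b x)"
    using *(2) inF3(2) by simp
  also have "M (\<lambda>x. \<Sum>a<n. \<Sum>b<m. h a b x) = (\<Sum>a<n. M (\<lambda>x. \<Sum>b<m. h a b x))"
    using inF1 by (rule invariant_mean_sum(2)[OF M]) simp
  also have "\<dots> = (\<Sum>a<n. \<Sum>b<m. M (h a b))"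
  proof (rule sum.cong[OF refl])
    fix a assume "a \<in> {..<n}"
    then show "M (\<lambda>x. \<Sum>b<m. h a b x) = (\<Sum>b<m. M (h a b))"
      using hF[of a] by (intro invariant_mean_sum(2)[OF M]) simp
  qed
  finally show "M (\<lambda>x. ch G \<rho> x * ch G \<sigma> x) = (\<Sum>a<n. \<Sum>b<m.
      mat_mean M n m (\<lambda>x. \<rho> x * elem_mat n m a b * transpose_mat (\<sigma> x)) $$ (a, b)) / (of_nat n * of_nat m)"
    by (simp add: c_def mat_mean_index h_eq)
qed

text \<open>A nonzero averaged intertwiner would identify the character of \<open>\<rho>\<close>
  with that of the dual of \<open>\<sigma>\<close>. The pairing is bilinear, without conjugation,
  hence the dual in the exceptional case.\<close>

lemma ch_orthogonal:
  assumes M: "invariant_mean G F M" and r: "irr_rep G T \<rho>" and s: "irr_rep G T \<sigma>"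
    and ent: "entries_in F (rep_dim G \<rho> * rep_dim G \<sigma>) (rep_dim G \<rho> * rep_dim G \<sigma>) (tensor_rep \<rho> \<sigma>)"
    and ne: "ch G \<rho> \<noteq> ch G (dual_rep G \<sigma>)"
  shows "M (\<lambda>x. ch G \<rho> x * ch G \<sigma> x) = 0"
proof -
  let ?n = "rep_dim G \<rho>" and ?m = "rep_dim G \<sigma>"
  note fr = irr_rep_fd[OF r] and fs = irr_rep_fd[OF s]
  have 0: "mat_mean M ?n ?m (\<lambda>x. \<rho> x * X * transpose_mat (\<sigma> x)) = 0\<^sub>m ?n ?m"
    if X: "X \<in> carrier_mat ?n ?m" for X
  proof (rule ccontr)
    assume "mat_mean M ?n ?m (\<lambda>x. \<rho> x * X * transpose_mat (\<sigma> x)) \<noteq> 0\<^sub>m ?n ?m"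
    then have "ch G \<rho> g = ch G \<sigma> (inv g)" if "g \<in> carrier G" for g
      using ch_eq_inverse_if_intertwined[OF r s mat_mean_carrier mean_intertwines(2)[OF M fr fs ent X] _ that] by blast
    then have "ch G \<rho> = ch G (dual_rep G \<sigma>)"
      unfolding ch_dual[OF fs] by (auto simp: ch_def fun_eq_iff)
    with ne show False ..
  qed
  have "elem_mat ?n ?m a b \<in> carrier_mat ?n ?m" for a b by (simp add: elem_mat_def)
  from 0[OF this] show ?thesis unfolding ch_product_mean(2)[OF M fr fs ent] by simp
qed

text \<open>The average of a matrix unit commutes with \<open>\<rho>\<close> and is a scalar; having
  the trace of the matrix unit, it is \<open>1 / n\<close> for \<open>a = b\<close> and 0 otherwise.
  The \<open>n\<close> diagonal terms add up to 1, and normalising two characters of dimension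
  \<open>n\<close> leaves \<open>1 / (n * n)\<close>.\<close>

lemma ch_norm:
  assumes M: "invariant_mean G F M" and r: "irr_rep G T \<rho>"
    and ent: "entries_in F (rep_dim G \<rho> * rep_dim G \<rho>) (rep_dim G \<rho> * rep_dim G \<rho>) (tensor_rep \<rho> (dual_rep G \<rho>))"
  shows "M (\<lambda>x. ch G \<rho> x * ch G (dual_rep G \<rho>) x) = 1 / of_nat (rep_dim G \<rho> * rep_dim G \<rho>)"
proof -
  let ?n = "rep_dim G \<rho>" and ?d = "dual_rep G \<rho>"
  note fr = irr_rep_fd[OF r]
  note fs = fd_rep_dual(1)[OF fr] and dm = fd_rep_dual(2)[OF fr]
  note rD = fd_repD[OF fr]
  define P where "P a b = mat_mean M ?n ?n (\<lambda>x. \<rho> x * elem_mat ?n ?n a b * transpose_mat (?d x))" for a b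
  have e: "elem_mat ?n ?n a b \<in> carrier_mat ?n ?n" for a b by (simp add: elem_mat_def)
  have dT: "transpose_mat (?d x) = \<rho> (inv x)" for x by (simp add: dual_rep_def)
  have key: "P a b $$ (a, b) = (if a = b then 1 / of_nat ?n else 0)" if ab: "a < ?n" "b < ?n" for a b
  proof -
    note mi = mean_intertwines[OF M fr fs, unfolded dm, OF ent e[of a b]]
    have Pc: "P a b \<in> carrier_mat ?n ?n" by (simp add: P_def)
    have inv: "\<rho> h * P a b * \<rho> (inv h) = P a b" if "h \<in> carrier G" for h
      using mi(2)[OF that] unfolding P_def dT .
    have "\<rho> h * P a b = P a b * \<rho> h" if h: "h \<in> carrier G" for h
    proof -
      have hi: "inv h \<in> carrier G" using h by simp
      have "P a b * \<rho> h = \<rho> h * P a b * \<rho> (inv h) * \<rho> h" unfolding inv[OF h] ..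
      also have "\<dots> = \<rho> h * P a b * (\<rho> (inv h) * \<rho> h)"
        by (rule assoc_mult_mat[OF mult_carrier_mat[OF rD(3)[OF h] Pc] rD(3)[OF hi] rD(3)[OF h]])
      also have "\<dots> = \<rho> h * P a b"
        unfolding fd_rep_inv(2)[OF fr h] using rD(3)[OF h] Pc by simp
      finally show ?thesis by simp
    qed
    then obtain c where c: "P a b = c \<cdot>\<^sub>m 1\<^sub>m ?n" using schur_scalar[OF r Pc] by blast
    \<comment> \<open>Conjugation preserves the trace, so the integrand of the trace is
      constant.\<close>
    have "of_nat ?n * c = (\<Sum>i<?n. P a b $$ (i, i))" unfolding c by simp
    also have "\<dots> = (\<Sum>i<?n. M (\<lambda>x. (\<rho> x * elem_mat ?n ?n a b * \<rho> (inv x)) $$ (i, i)))"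
      unfolding P_def dT by (intro sum.cong) (auto simp: mat_mean_index)
    also have "\<dots> = M (\<lambda>x. \<Sum>i<?n. (\<rho> x * elem_mat ?n ?n a b * \<rho> (inv x)) $$ (i, i))"
      using mi(1) unfolding dT entries_in_def by (intro invariant_mean_sum(2)[OF M, symmetric]) simp
    also have "\<dots> = M (\<lambda>_. if a = b then 1 else 0)"
    proof (rule invariant_mean_cong(2)[OF M])
      show "(\<lambda>_. if a = b then 1 else 0) \<in> F" by (rule invariant_mean_const(1)[OF M])
      fix x assume x: "x \<in> carrier G"
      have xi: "inv x \<in> carrier G" using x by simp
      have "(\<Sum>i<?n. (\<rho> x * elem_mat ?n ?n a b * \<rho> (inv x)) $$ (i, i)) = (\<Sum>i<?n. \<rho> (inv x) $$ (b, i) * \<rho> x $$ (i, a))"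
        using triple_elem_mat_entry[OF rD(3)[OF x] rD(3)[OF xi] _ _ ab] by (intro sum.cong) auto
      also have "\<dots> = (\<rho> (inv x) * \<rho> x) $$ (b, a)"
        by (rule mat_mult_entry[OF rD(3)[OF xi] rD(3)[OF x] ab(2,1), symmetric])
      also have "\<dots> = (if a = b then 1 else 0)" unfolding fd_rep_inv(2)[OF fr x] using ab by auto
      finally show "(if a = b then 1 else 0) = (\<Sum>i<?n. (\<rho> x * elem_mat ?n ?n a b * \<rho> (inv x)) $$ (i, i))" ..
    qed
    also have "\<dots> = (if a = b then 1 else 0)" by (rule invariant_mean_const(2)[OF M])
    finally have "c = (if a = b then 1 / of_nat ?n else 0)" using rD(1) by (auto simp: field_simps split: if_splits)
    then show ?thesis unfolding c using ab by auto
  qed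
  have "M (\<lambda>x. ch G \<rho> x * ch G ?d x) = (\<Sum>a<?n. \<Sum>b<?n. P a b $$ (a, b)) / (of_nat ?n * of_nat ?n)"
    using ch_product_mean(2)[OF M fr fs, unfolded dm, OF ent] by (simp add: P_def)
  also have "(\<Sum>a<?n. \<Sum>b<?n. P a b $$ (a, b)) = (\<Sum>a<?n. \<Sum>b<?n. if b = a then 1 / of_nat ?n else 0)"
    using key by (intro sum.cong) auto
  also have "\<dots> = 1" using rD(1) by simp
  finally show ?thesis by simp
qed

lemma dual_dual_ch:
  assumes "fd_rep G T \<pi>" shows "ch G (dual_rep G (dual_rep G \<pi>)) = ch G \<pi>"
  unfolding ch_dual[OF fd_rep_dual(1)[OF assms]] ch_dual[OF assms] by (auto simp: ch_def fun_eq_iff)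

text \<open>Pairing the combination with the dual character of \<open>\<psi>\<^sub>0\<close> under a
  mean kills every other term by orthogonality and multiplies \<open>a \<psi>\<^sub>0\<close> by a
  nonzero number. The mean is chosen for the finitely many tensor products in these
  pairings.\<close>

lemma irr_chars_independent:
  assumes fin: "finite A" and A: "A \<subseteq> irr_chars G T"
    and zero: "\<And>g. g \<in> carrier G \<Longrightarrow> (\<Sum>\<psi>\<in>A. a \<psi> * \<psi> g) = 0" and \<psi>\<^sub>0: "\<psi>\<^sub>0 \<in> A"
  shows "a \<psi>\<^sub>0 = 0"
proof -
  have "\<exists>\<pi>. irr_rep G T \<pi> \<and> ch G \<pi> = \<psi>" if "\<psi> \<in> A" for \<psi>
    using that A by (auto simp: irr_chars_def)
  then obtain r where r: "\<And>\<psi>. \<psi> \<in> A \<Longrightarrow> irr_rep G T (r \<psi>)" "\<And>\<psi>. \<psi> \<in> A \<Longrightarrow> ch G (r \<psi>) = \<psi>" by metis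
  let ?d = "dual_rep G (r \<psi>\<^sub>0)"
  note fd = irr_rep_fd[OF r(1)]
  note fd0 = fd[OF \<psi>\<^sub>0]
  note d = irr_rep_dual[OF r(1)[OF \<psi>\<^sub>0]]
  obtain F M where M: "invariant_mean G F M"
    and ent: "\<And>\<pi>. \<pi> \<in> (\<lambda>\<psi>. tensor_rep (r \<psi>) ?d) ` A \<Longrightarrow> entries_in F (rep_dim G \<pi>) (rep_dim G \<pi>) \<pi>"
    using mean_for_reps[of "(\<lambda>\<psi>. tensor_rep (r \<psi>) ?d) ` A"] fin fd_rep_tensor(1)[OF fd irr_rep_fd[OF d]] by blast
  have ent': "entries_in F (rep_dim G (r \<psi>) * rep_dim G ?d) (rep_dim G (r \<psi>) * rep_dim G ?d) (tensor_rep (r \<psi>) ?d)"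
    if "\<psi> \<in> A" for \<psi>
    using ent[of "tensor_rep (r \<psi>) ?d"] that fd_rep_tensor(2)[OF fd[OF that] irr_rep_fd[OF d]] by simp
  have inF: "(\<lambda>x. \<psi> x * ch G ?d x) \<in> F" if "\<psi> \<in> A" for \<psi>
    using ch_product_mean(1)[OF M fd[OF that] irr_rep_fd[OF d] ent'[OF that]] r(2)[OF that] by simp
  have other: "M (\<lambda>x. \<psi> x * ch G ?d x) = 0" if "\<psi> \<in> A" "\<psi> \<noteq> \<psi>\<^sub>0" for \<psi>
    using ch_orthogonal[OF M r(1)[OF that(1)] d ent'[OF that(1)]] that
    unfolding dual_dual_ch[OF fd0] by (simp add: r(2)[OF that(1)] r(2)[OF \<psi>\<^sub>0])
  have same: "M (\<lambda>x. \<psi>\<^sub>0 x * ch G ?d x) \<noteq> 0"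
    using ch_norm[OF M r(1)[OF \<psi>\<^sub>0]] ent'[OF \<psi>\<^sub>0] fd_repD(1)[OF fd0]
    unfolding fd_rep_dual(2)[OF fd0] r(2)[OF \<psi>\<^sub>0] by simp
  have in2: "(\<lambda>x. a \<psi> * (\<psi> x * ch G ?d x)) \<in> F" if "\<psi> \<in> A" for \<psi>
    by (rule invariant_mean_cmult(1)[OF M inF[OF that]])
  have "0 = M (\<lambda>_. 0)" by (rule invariant_mean_const(2)[OF M, symmetric])
  also have "\<dots> = M (\<lambda>x. \<Sum>\<psi>\<in>A. a \<psi> * (\<psi> x * ch G ?d x))"
  proof (rule invariant_mean_cong(2)[OF M, symmetric])
    show "(\<lambda>_. 0) \<in> F" by (rule invariant_mean_const(1)[OF M])
    fix x assume "x \<in> carrier G"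
    from zero[OF this] show "0 = (\<Sum>\<psi>\<in>A. a \<psi> * (\<psi> x * ch G ?d x))"
      by (simp add: mult.assoc[symmetric] sum_distrib_right[symmetric])
  qed
  also have "\<dots> = (\<Sum>\<psi>\<in>A. M (\<lambda>x. a \<psi> * (\<psi> x * ch G ?d x)))"
    using in2 by (rule invariant_mean_sum(2)[OF M])
  also have "\<dots> = (\<Sum>\<psi>\<in>A. if \<psi> = \<psi>\<^sub>0 then a \<psi>\<^sub>0 * M (\<lambda>x. \<psi>\<^sub>0 x * ch G ?d x) else 0)"
    using invariant_mean_cmult(2)[OF M inF] other by (intro sum.cong) auto
  also have "\<dots> = a \<psi>\<^sub>0 * M (\<lambda>x. \<psi>\<^sub>0 x * ch G ?d x)" using fin \<psi>\<^sub>0 by simp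
  finally show ?thesis using same by simp
qed


subsection \<open>Complete reducibility\<close>

text \<open>The idempotent \<open>A * B\<close> commutes with \<open>\<sigma>\<close> and is
  absorbed by \<open>A\<close>, so it may be dropped between \<open>\<sigma> g\<close> and
  \<open>\<sigma> h\<close>; this makes the compression multiplicative.\<close>

lemma fd_rep_compress:
  assumes s: "fd_rep G T \<sigma>" and A: "A \<in> carrier_mat (rep_dim G \<sigma>) k" and B: "B \<in> carrier_mat k (rep_dim G \<sigma>)"
    and BA: "B * A = 1\<^sub>m k" and k: "0 < k"
    and comm: "\<And>g. g \<in> carrier G \<Longrightarrow> A * B * \<sigma> g = \<sigma> g * (A * B)"
  shows "fd_rep G T (\<lambda>g. B * \<sigma> g * A)" "rep_dim G (\<lambda>g. B * \<sigma> g * A) = k"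
proof -
  let ?n = "rep_dim G \<sigma>"
  note sD = fd_repD[OF s]
  have c: "B * \<sigma> g * A \<in> carrier_mat k k" if "g \<in> carrier G" for g using sD(3)[OF that] A B by simp
  have one: "B * \<sigma> \<one> * A = 1\<^sub>m k" unfolding sD(2) using A B BA by simp
  have mult: "B * \<sigma> (g \<otimes> h) * A = B * \<sigma> g * A * (B * \<sigma> h * A)" if g: "g \<in> carrier G" and h: "h \<in> carrier G" for g h
  proof -
    note gc = sD(3)[OF g] and hc = sD(3)[OF h]
    have Bg: "B * \<sigma> g \<in> carrier_mat k ?n" and AB: "A * B \<in> carrier_mat ?n ?n"
      and Bh: "B * \<sigma> h \<in> carrier_mat k ?n"
      using A B gc hc by auto
    have "B * \<sigma> g * A * (B * \<sigma> h * A) = B * \<sigma> g * (A * (B * \<sigma> h * A))"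
      by (rule assoc_mult_mat[OF Bg A c[OF h]])
    also have "A * (B * \<sigma> h * A) = A * B * \<sigma> h * A"
      using assoc_mult_mat[OF A Bh A] assoc_mult_mat[OF A B hc] by simp
    also have "\<dots> = \<sigma> h * (A * B) * A" unfolding comm[OF h] ..
    also have "\<dots> = \<sigma> h * (A * B * A)" by (rule assoc_mult_mat[OF hc AB A])
    also have "A * B * A = A" using assoc_mult_mat[OF A B A] BA A by simp
    also have "B * \<sigma> g * (\<sigma> h * A) = B * (\<sigma> g * \<sigma> h) * A"
      using assoc_mult_mat[OF Bg hc A] assoc_mult_mat[OF B gc hc] by simp
    finally show ?thesis unfolding sD(4)[OF g h] by simp
  qed
  have cont: "continuous_map T euclidean (\<lambda>g. (B * \<sigma> g * A) $$ (i, j))" if ij: "i < k" "j < k" for i j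
  proof (rule continuous_map_eq)
    show "continuous_map T euclidean (\<lambda>g. \<Sum>a<?n. \<Sum>b<?n. B $$ (i, a) * \<sigma> g $$ (a, b) * A $$ (b, j))"
      using sD(5) by (intro continuous_map_sum continuous_map_mult_complex) auto
    show "(\<Sum>a<?n. \<Sum>b<?n. B $$ (i, a) * \<sigma> g $$ (a, b) * A $$ (b, j)) = (B * \<sigma> g * A) $$ (i, j)"
      if "g \<in> topspace T" for g
      using triple_mat_entry[OF B sD(3) A ij] that by (simp add: topspace)
  qed
  show "fd_rep G T (\<lambda>g. B * \<sigma> g * A)" "rep_dim G (\<lambda>g. B * \<sigma> g * A) = k"
    using fd_repI[of k "\<lambda>g. B * \<sigma> g * A", OF k c one mult cont] by blast+
qed

text \<open>Averaging the conjugates of a projection onto \<open>W\<close> gives an equivariant projection onto \<open>W\<close>.\<close>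

lemma equivariant_projection:
  assumes s: "fd_rep G T \<sigma>" and W: "lin_closed (rep_dim G \<sigma>) W"
    and Winv: "\<And>g v. g \<in> carrier G \<Longrightarrow> v \<in> W \<Longrightarrow> \<sigma> g *\<^sub>v v \<in> W"
  shows "\<exists>P\<in>carrier_mat (rep_dim G \<sigma>) (rep_dim G \<sigma>). P * P = P \<and>
    (\<forall>g\<in>carrier G. P * \<sigma> g = \<sigma> g * P) \<and>
    (\<forall>v\<in>carrier_vec (rep_dim G \<sigma>). P *\<^sub>v v \<in> W) \<and> (\<forall>w\<in>W. P *\<^sub>v w = w)"
proof -
  let ?n = "rep_dim G \<sigma>" and ?d = "dual_rep G \<sigma>"
  note sD = fd_repD[OF s]
  note fd = fd_rep_dual(1)[OF s] and dm = fd_rep_dual(2)[OF s]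
  have Wc: "w \<in> carrier_vec ?n" if "w \<in> W" for w using W that by (auto simp: lin_closed_def)
  obtain k A B where A: "A \<in> carrier_mat ?n k" and B: "B \<in> carrier_mat k ?n"
    and AW: "\<And>v. v \<in> carrier_vec k \<Longrightarrow> A *\<^sub>v v \<in> W" and ABw: "\<And>w. w \<in> W \<Longrightarrow> A *\<^sub>v (B *\<^sub>v w) = w"
    using subspace_basis[OF W] by metis
  define p where "p = A * B"
  have p: "p \<in> carrier_mat ?n ?n" using A B by (simp add: p_def)
  have pv: "p *\<^sub>v v = A *\<^sub>v (B *\<^sub>v v)" if "v \<in> carrier_vec ?n" for v
    unfolding p_def by (rule assoc_mult_mat_vec[OF A B that])
  have pW: "p *\<^sub>v v \<in> W" if "v \<in> carrier_vec ?n" for v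
    unfolding pv[OF that] using B that by (intro AW) simp
  have pw: "p *\<^sub>v w = w" if "w \<in> W" for w using pv[OF Wc[OF that]] ABw[OF that] by simp
  have fd2: "fd_rep G T (tensor_rep \<sigma> ?d)" and dm2: "rep_dim G (tensor_rep \<sigma> ?d) = ?n * ?n"
    using fd_rep_tensor[OF s fd] by (simp_all add: dm)
  obtain F M where M: "invariant_mean G F M" and ent: "entries_in F (?n * ?n) (?n * ?n) (tensor_rep \<sigma> ?d)"
    using mean_for_reps[of "{tensor_rep \<sigma> ?d}"] fd2 by (auto simp: dm2)
  define f where "f x = \<sigma> x * p * \<sigma> (inv x)" for x
  define P where "P = mat_mean M ?n ?n f"
  have P: "P \<in> carrier_mat ?n ?n" by (simp add: P_def)
  have dT: "transpose_mat (?d x) = \<sigma> (inv x)" for x by (simp add: dual_rep_def)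
  note mi = mean_intertwines[OF M s fd, unfolded dm dT, OF ent p, folded f_def, folded P_def]
  have fc: "f x \<in> carrier_mat ?n ?n" if "x \<in> carrier G" for x
    unfolding f_def using sD(3)[OF that] sD(3)[of "inv x"] that p by simp
  have comm: "P * \<sigma> h = \<sigma> h * P" if h: "h \<in> carrier G" for h
  proof -
    have hi: "inv h \<in> carrier G" using h by simp
    have "P * \<sigma> h = \<sigma> h * P * \<sigma> (inv h) * \<sigma> h" unfolding mi(2)[OF h] ..
    also have "\<dots> = \<sigma> h * P * (\<sigma> (inv h) * \<sigma> h)"
      by (rule assoc_mult_mat[OF mult_carrier_mat[OF sD(3)[OF h] P] sD(3)[OF hi] sD(3)[OF h]])
    also have "\<dots> = \<sigma> h * P"
      unfolding fd_rep_inv(2)[OF s h] using sD(3)[OF h] P by simp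
    finally show ?thesis .
  qed
  have fv: "f x *\<^sub>v v = \<sigma> x *\<^sub>v (p *\<^sub>v (\<sigma> (inv x) *\<^sub>v v))" if x: "x \<in> carrier G" and v: "v \<in> carrier_vec ?n" for x v
  proof -
    have xi: "inv x \<in> carrier G" using x by simp
    have u: "\<sigma> (inv x) *\<^sub>v v \<in> carrier_vec ?n" using sD(3)[OF xi] v by simp
    show ?thesis
      unfolding f_def assoc_mult_mat_vec[OF mult_carrier_mat[OF sD(3)[OF x] p] sD(3)[OF xi] v]
        assoc_mult_mat_vec[OF sD(3)[OF x] p u] ..
  qed
  have fW: "f x *\<^sub>v v \<in> W" if x: "x \<in> carrier G" and v: "v \<in> carrier_vec ?n" for x v
    unfolding fv[OF that] using sD(3)[of "inv x"] x v by (intro Winv[OF x] pW) simp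
  have fw: "f x *\<^sub>v w = w" if x: "x \<in> carrier G" and w: "w \<in> W" for x w
  proof -
    have xi: "inv x \<in> carrier G" using x by simp
    have "\<sigma> x *\<^sub>v (\<sigma> (inv x) *\<^sub>v w) = w"
      using assoc_mult_mat_vec[OF sD(3)[OF x] sD(3)[OF xi] Wc[OF w]] fd_rep_inv(1)[OF s x] Wc[OF w] by simp
    then show ?thesis unfolding fv[OF x Wc[OF w]] using pw[OF Winv[OF xi w]] by simp
  qed
  have PA: "P * A = A"
  proof -
    \<comment> \<open>The identity on the left puts the product into the two-sided form of
      \<open>mat_mean_mult\<close>.\<close>
    have fA: "1\<^sub>m ?n * f x * A = A" if x: "x \<in> carrier G" for x
    proof -
      have "f x * A = A"
      proof (rule eq_matI)
        fix i j assume "i < dim_row A" "j < dim_col A"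
        then have ij: "i < ?n" "j < k" using A by auto
        have "col (f x * A) j = f x *\<^sub>v col A j" by (rule col_mult2[OF fc[OF x] A ij(2)])
        also have "col A j = A *\<^sub>v unit_vec k j" using mult_mat_unit_vec[OF A ij(2)] by simp
        also have "f x *\<^sub>v (A *\<^sub>v unit_vec k j) = A *\<^sub>v unit_vec k j" by (rule fw[OF x AW]) simp
        also have "\<dots> = col A j" by (rule mult_mat_unit_vec[OF A ij(2)])
        finally have "col (f x * A) j $ i = col A j $ i" by simp
        then show "(f x * A) $$ (i, j) = A $$ (i, j)" using ij A fc[OF x] by simp
      qed (use A fc[OF x] in auto)
      then show ?thesis using fc[OF x] by simp
    qed
    note mm = mat_mean_mult[OF M mi(1) fc one_carrier_mat A]
    have "A = mat_mean M ?n k (\<lambda>_. A)" using mat_mean_const[OF M A] by simp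
    also have "\<dots> = mat_mean M ?n k (\<lambda>x. 1\<^sub>m ?n * f x * A)"
      by (rule mat_mean_cong[OF M mm(1), symmetric]) (use fA in simp_all)
    also have "\<dots> = 1\<^sub>m ?n * P * A" unfolding P_def by (rule mm(2))
    finally show ?thesis using P by simp
  qed
  have pP: "p * P = P"
  proof -
    have pf: "p * f x * 1\<^sub>m ?n = f x" if x: "x \<in> carrier G" for x
    proof -
      have "p * f x = f x"
      proof (rule eq_matI)
        fix i j assume "i < dim_row (f x)" "j < dim_col (f x)"
        then have ij: "i < ?n" "j < ?n" using fc[OF x] by auto
        have "col (p * f x) j = p *\<^sub>v col (f x) j" by (rule col_mult2[OF p fc[OF x] ij(2)])
        also have "col (f x) j = f x *\<^sub>v unit_vec ?n j" using mult_mat_unit_vec[OF fc[OF x] ij(2)] by simp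
        also have "p *\<^sub>v (f x *\<^sub>v unit_vec ?n j) = f x *\<^sub>v unit_vec ?n j" by (rule pw[OF fW[OF x]]) simp
        also have "\<dots> = col (f x) j" by (rule mult_mat_unit_vec[OF fc[OF x] ij(2)])
        finally have "col (p * f x) j $ i = col (f x) j $ i" by simp
        then show "(p * f x) $$ (i, j) = f x $$ (i, j)" using ij p fc[OF x] by simp
      qed (use p fc[OF x] in auto)
      then show ?thesis using fc[OF x] by simp
    qed
    note mm = mat_mean_mult[OF M mi(1) fc p one_carrier_mat]
    have "P = mat_mean M ?n ?n (\<lambda>x. p * f x * 1\<^sub>m ?n)"
      unfolding P_def by (rule mat_mean_cong[OF M mi(1)]) (use pf in simp)
    also have "\<dots> = p * P * 1\<^sub>m ?n" unfolding P_def by (rule mm(2))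
    finally show ?thesis using P p by simp
  qed
  have Pp: "P * p = p" unfolding p_def using assoc_mult_mat[OF P A B] PA by simp
  \<comment> \<open>Every \<open>f x\<close> fixes \<open>W\<close> and maps into \<open>W\<close>,
    and both properties survive averaging as \<open>P * p = p\<close> and \<open>p * P = P\<close>.
    Idempotence follows from \<open>P * P = P * p * P = p * P = P\<close>.\<close>
  have "P * P = P * (p * P)" by (simp only: pP)
  also have "\<dots> = P" using assoc_mult_mat[OF P p P] Pp pP by simp
  finally have PP: "P * P = P" .
  have PW: "P *\<^sub>v v \<in> W" if v: "v \<in> carrier_vec ?n" for v
  proof -
    have "P *\<^sub>v v = p *\<^sub>v (P *\<^sub>v v)" using assoc_mult_mat_vec[OF p P v] pP by simp
    moreover have "P *\<^sub>v v \<in> carrier_vec ?n" using P v by simp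
    ultimately show ?thesis using pW by metis
  qed
  have Pw: "P *\<^sub>v w = w" if w: "w \<in> W" for w
  proof -
    have "P *\<^sub>v w = P *\<^sub>v (p *\<^sub>v w)" by (simp only: pw[OF w])
    also have "\<dots> = p *\<^sub>v w" using assoc_mult_mat_vec[OF P p Wc[OF w]] Pp by simp
    finally show ?thesis by (simp only: pw[OF w])
  qed
  show ?thesis by (intro bexI[OF _ P] conjI ballI PP comm PW Pw)
qed

text \<open>Strong induction on the dimension: a proper nonzero invariant subspace has an
  equivariant projection, and the compressions to its range and to that of its complement are
  smaller representations.\<close>

theorem completely_reducible:
  assumes "fd_rep G T \<sigma>"
  shows "\<exists>rs. (\<forall>\<rho>\<in>set rs. irr_rep G T \<rho>) \<and> rep_equiv G \<sigma> (rep_dlist rs)"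
  using assms
proof (induction "rep_dim G \<sigma>" arbitrary: \<sigma> rule: less_induct)
  case less
  let ?n = "rep_dim G \<sigma>"
  note s = less.prems and sD = fd_repD[OF less.prems]
  show ?case
  proof (cases "irr_rep G T \<sigma>")
    case True
    then show ?thesis using rep_equiv_refl[OF fd_rep_square[OF s]]
      by (intro exI[of _ "[\<sigma>]"]) (simp add: rep_dlist_singleton)
  next
    case False
    have "\<exists>W. lin_closed ?n W \<and> (\<forall>g\<in>carrier G. \<forall>v\<in>W. \<sigma> g *\<^sub>v v \<in> W) \<and> W \<noteq> {0\<^sub>v ?n} \<and> W \<noteq> carrier_vec ?n"
    proof (rule ccontr)
      assume "\<not> ?thesis"
      then have "irr_rep G T \<sigma>" by (intro irr_repI[OF s]) blast
      with False show False ..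
    qed
    then obtain W where W: "lin_closed ?n W" and Winv: "\<And>g v. g \<in> carrier G \<Longrightarrow> v \<in> W \<Longrightarrow> \<sigma> g *\<^sub>v v \<in> W"
      and W0: "W \<noteq> {0\<^sub>v ?n}" and W1: "W \<noteq> carrier_vec ?n" by blast
    have Wc: "w \<in> carrier_vec ?n" if "w \<in> W" for w using W that by (auto simp: lin_closed_def)
    have W0': "0\<^sub>v ?n \<in> W" using W by (simp add: lin_closed_def)
    obtain P where P1: "P \<in> carrier_mat ?n ?n" and P2: "P * P = P \<and> (\<forall>g\<in>carrier G. P * \<sigma> g = \<sigma> g * P) \<and>
        (\<forall>v\<in>carrier_vec ?n. P *\<^sub>v v \<in> W) \<and> (\<forall>w\<in>W. P *\<^sub>v w = w)"
      using equivariant_projection[OF s W Winv] by (rule bexE)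
    note P = P1 P2[THEN conjunct1]
      and comm = P2[THEN conjunct2, THEN conjunct1, rule_format]
      and PW = P2[THEN conjunct2, THEN conjunct2, THEN conjunct1, rule_format]
      and Pw = P2[THEN conjunct2, THEN conjunct2, THEN conjunct2, rule_format]
    obtain k l A B C D where kl: "k + l = ?n" and A: "A \<in> carrier_mat ?n k" and B: "B \<in> carrier_mat k ?n"
      and BA: "B * A = 1\<^sub>m k" and AB: "A * B = P"
      and C: "C \<in> carrier_mat ?n l" and D: "D \<in> carrier_mat l ?n" and DC: "D * C = 1\<^sub>m l" and CD: "C * D = 1\<^sub>m ?n - P"
      and eq: "rep_equiv G \<sigma> (rep_dsum (\<lambda>g. B * \<sigma> g * A) (\<lambda>g. D * \<sigma> g * C))"
      by (rule invariant_idempotent_split[OF P sD(3) refl one_closed comm]) blast+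
    \<comment> \<open>For \<open>k = 0\<close> the projection would be zero although it fixes
      \<open>W\<close>; for \<open>l = 0\<close> it would be the identity and \<open>W\<close>
      everything. So both compressions have positive dimension below that of
      \<open>\<sigma>\<close>.\<close>
    have k0: "k \<noteq> 0"
    proof
      assume "k = 0"
      then have "P = 0\<^sub>m ?n ?n" using AB A B by (intro eq_matI) (auto simp: scalar_prod_def)
      moreover have "0\<^sub>m ?n ?n *\<^sub>v w = 0\<^sub>v ?n" if "w \<in> W" for w
        using Wc[OF that] by (intro eq_vecI) auto
      ultimately have "w = 0\<^sub>v ?n" if "w \<in> W" for w using Pw[OF that] that by simp
      then have "W \<subseteq> {0\<^sub>v ?n}" by (metis singleton_iff subsetI)
      with W0 W0' show False by (metis empty_iff subset_singletonD)
    qed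
    have l0: "l \<noteq> 0"
    proof
      assume "l = 0"
      then have 0: "1\<^sub>m ?n - P = 0\<^sub>m ?n ?n" unfolding CD[symmetric] using C D
        by (intro eq_matI) (auto simp: scalar_prod_def)
      have "v \<in> W" if v: "v \<in> carrier_vec ?n" for v
      proof -
        have "P = 1\<^sub>m ?n"
        proof (rule eq_matI)
          fix i j assume ij: "i < dim_row (1\<^sub>m ?n :: complex mat)" "j < dim_col (1\<^sub>m ?n :: complex mat)"
          have "(1\<^sub>m ?n - P) $$ (i, j) = 0" unfolding 0 using ij by simp
          then show "P $$ (i, j) = 1\<^sub>m ?n $$ (i, j)" using ij P(1) by simp
        qed (use P in auto)
        then show ?thesis using PW[OF v] v by simp
      qed
      then have "W = carrier_vec ?n" using Wc by (intro subset_antisym subsetI)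
      with W1 show False ..
    qed
    let ?\<alpha> = "\<lambda>g. B * \<sigma> g * A" and ?\<beta> = "\<lambda>g. D * \<sigma> g * C"
    have commq: "C * D * \<sigma> g = \<sigma> g * (C * D)" if g: "g \<in> carrier G" for g
      unfolding CD minus_mult_distrib_mat[OF one_carrier_mat P(1) sD(3)[OF g]]
        mult_minus_distrib_mat[OF sD(3)[OF g] one_carrier_mat P(1)] using sD(3)[OF g] comm[OF g] by simp
    have \<alpha>: "fd_rep G T ?\<alpha>" "rep_dim G ?\<alpha> = k"
      using fd_rep_compress[OF s A B BA] k0 comm AB by auto
    have \<beta>: "fd_rep G T ?\<beta>" "rep_dim G ?\<beta> = l"
      using fd_rep_compress[OF s C D DC] l0 commq by auto
    obtain rs where rs: "\<forall>\<rho>\<in>set rs. irr_rep G T \<rho>" "rep_equiv G ?\<alpha> (rep_dlist rs)"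
      using less.hyps[OF _ \<alpha>(1)] \<alpha>(2) kl l0 by auto
    obtain ss where ss: "\<forall>\<rho>\<in>set ss. irr_rep G T \<rho>" "rep_equiv G ?\<beta> (rep_dlist ss)"
      using less.hyps[OF _ \<beta>(1)] \<beta>(2) kl k0 by auto
    have sq: "square_rep G (rep_dlist rs)" "square_rep G (rep_dlist ss)"
      using rs(1) ss(1) by (simp_all add: square_rep_rep_dlist fd_rep_square irr_rep_fd)
    note sq' = fd_rep_square[OF \<alpha>(1)] fd_rep_square[OF \<beta>(1)]
    have "rep_equiv G (rep_dsum ?\<alpha> ?\<beta>) (rep_dlist (rs @ ss))"
      unfolding rep_dlist_append by (rule rep_dsum_cong[OF rs(2) ss(2) sq'(1) sq(1) sq'(2) sq(2)])
    then have "rep_equiv G \<sigma> (rep_dlist (rs @ ss))"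
      by (rule rep_equiv_trans[OF eq])
        (use sq sq' fd_rep_square[OF s] in \<open>auto simp: rep_dlist_append intro!: square_rep_rep_dsum\<close>)
    then show ?thesis using rs(1) ss(1) by (intro exI[of _ "rs @ ss"]) auto
  qed
qed

section \<open>From decompositions to measures on irreducible characters\<close>

lemma decomposition_exists:
  assumes s: "fd_rep G T \<sigma>"
  shows "\<exists>ks. decomposition G T \<sigma> ks"
proof -
  obtain rs where rs: "\<And>\<rho>. \<rho> \<in> set rs \<Longrightarrow> irr_rep G T \<rho>" "rep_equiv G \<sigma> (rep_dlist rs)"
    using completely_reducible[OF s] by blast
  have sq: "square_rep G \<rho>" if "irr_rep G T \<rho>" for \<rho> using that by (intro fd_rep_square irr_rep_fd)
  obtain ks where ks: "\<forall>(m, \<rho>)\<in>set ks. 0 < m \<and> irr_rep G T \<rho>"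
    "\<forall>i<length ks. \<forall>j<length ks. i \<noteq> j \<longrightarrow> \<not> rep_equiv G (snd (ks ! i)) (snd (ks ! j))"
    "rep_equiv G (rep_dlist rs) (rep_dlist (expand ks))"
    using group_equivalent_summands[of rs "irr_rep G T" G, OF rs(1) sq] by blast
  have "square_rep G \<rho>" if \<rho>: "\<rho> \<in> set (expand ks)" for \<rho>
  proof -
    from \<rho> set_expand[of ks] obtain m where "(m, \<rho>) \<in> set ks" by auto
    then show ?thesis using ks(1) sq by auto
  qed
  then have "rep_equiv G \<sigma> (rep_dlist (expand ks))"
    using rs sq by (intro rep_equiv_trans[OF rs(2) ks(3)] square_rep_rep_dlist fd_rep_square[OF s]) auto
  then show ?thesis using ks(1,2) unfolding decomposition_rep_dlist by blast
qed

text \<open>Traces add over the diagonal blocks; the quotient of dimensions in the weight converts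
  between the different normalisations of the characters.\<close>

lemma decomposition_ch:
  assumes s: "fd_rep G T \<sigma>" and d: "decomposition G T \<sigma> ks" and g: "g \<in> carrier G"
  shows "(\<Sum>(m, \<rho>)\<leftarrow>ks. of_real (real (m * rep_dim G \<rho>) / real (rep_dim G \<sigma>)) * ch G \<rho> g) = ch G \<sigma> g"
proof -
  have ks: "\<And>m \<rho>. (m, \<rho>) \<in> set ks \<Longrightarrow> irr_rep G T \<rho>" and eq: "rep_equiv G \<sigma> (rep_dlist (expand ks))"
    using d unfolding decomposition_rep_dlist by auto
  have sqe: "square_rep G \<rho>" if \<rho>: "\<rho> \<in> set (expand ks)" for \<rho>
  proof -
    from \<rho> set_expand[of ks] obtain m where "(m, \<rho>) \<in> set ks" by auto
    then show ?thesis using ks by (intro fd_rep_square irr_rep_fd) auto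
  qed
  have tr: "mat_trace (rep_dlist rs g) = (\<Sum>\<rho>\<leftarrow>rs. mat_trace (\<rho> g))"
    if "\<And>\<rho>. \<rho> \<in> set rs \<Longrightarrow> square_rep G \<rho>" for rs
    using that
  proof (induction rs)
    case Nil
    then show ?case by (simp add: rep_dlist_Nil mat_trace_def)
  next
    case (Cons \<rho> rs)
    have "square_rep G (rep_dlist rs)" using Cons.prems by (intro square_rep_rep_dlist) simp
    from square_repD[OF this g] have "mat_trace (rep_dlist (\<rho> # rs) g) = mat_trace (\<rho> g) + mat_trace (rep_dlist rs g)"
      unfolding rep_dlist_Cons rep_dsum_def using square_repD[OF Cons.prems g] by (intro mat_trace_diag2) auto
    then show ?case using Cons by simp
  qed
  have exp: "(\<Sum>\<rho>\<leftarrow>expand ks. f \<rho>) = (\<Sum>(m, \<rho>)\<leftarrow>ks. of_nat m * f \<rho>)" for f :: "'a rep \<Rightarrow> complex"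
    unfolding expand_def by (induction ks) (auto simp: sum_list_replicate)
  let ?n = "rep_dim G \<sigma>"
  have n: "rep_dim G (rep_dlist (expand ks)) = ?n" using eq by (simp add: rep_equiv_def)
  have "ch G \<sigma> g = ch G (rep_dlist (expand ks)) g"
    using ch_rep_equiv[OF eq fd_rep_square[OF s] square_rep_rep_dlist] sqe by metis
  also have "\<dots> = (\<Sum>(m, \<rho>)\<leftarrow>ks. of_nat m * mat_trace (\<rho> g)) / of_nat ?n"
    using g by (simp add: ch_eq n tr[OF sqe] exp)
  also have "\<dots> = (\<Sum>(m, \<rho>)\<leftarrow>ks. of_real (real (m * rep_dim G \<rho>) / real ?n) * ch G \<rho> g)"
  proof -
    have "of_nat m * mat_trace (\<rho> g) / of_nat ?n = of_real (real (m * rep_dim G \<rho>) / real ?n) * ch G \<rho> g"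
      if "(m, \<rho>) \<in> set ks" for m \<rho>
    proof -
      have "0 < rep_dim G \<rho>" using ks[OF that] by (intro fd_repD(1) irr_rep_fd)
      then show ?thesis using g by (simp add: ch_eq)
    qed
    then have "(\<Sum>(m, \<rho>)\<leftarrow>ks. of_nat m * mat_trace (\<rho> g) / of_nat ?n) =
        (\<Sum>(m, \<rho>)\<leftarrow>ks. of_real (real (m * rep_dim G \<rho>) / real ?n) * ch G \<rho> g)"
      by (intro arg_cong[where f = sum_list] map_cong) auto
    moreover have "(\<Sum>(m, \<rho>)\<leftarrow>ks. of_nat m * mat_trace (\<rho> g) / of_nat ?n) =
        (\<Sum>(m, \<rho>)\<leftarrow>ks. of_nat m * mat_trace (\<rho> g)) / (of_nat ?n :: complex)"
      by (induction ks) (auto simp: add_divide_distrib)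
    ultimately show ?thesis by simp
  qed
  finally show ?thesis by simp
qed

text \<open>The claims hold for every representation and decomposition that the choice operator may
  return, so its result need not be identified. The last claim, together with linear independence,
  is what later pins the measure down.\<close>

lemma char_measure:
  assumes s: "fd_rep G T \<sigma>" and \<phi>: "ch G \<sigma> = \<phi>"
  defines "\<mu> \<equiv> char_measure G T \<phi>"
  shows "0 \<le> \<mu> \<psi>" "{\<psi>. \<mu> \<psi> \<noteq> 0} \<subseteq> irr_chars G T" "finite {\<psi>. \<mu> \<psi> \<noteq> 0}"
    "(\<Sum>\<psi> | \<mu> \<psi> \<noteq> 0. \<mu> \<psi>) = 1"
    "g \<in> carrier G \<Longrightarrow> (\<Sum>\<psi> | \<mu> \<psi> \<noteq> 0. of_real (\<mu> \<psi>) * \<psi> g) = \<phi> g"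
proof -
  define Q where "Q = (\<lambda>(\<sigma>, ks). fd_rep G T \<sigma> \<and> ch G \<sigma> = \<phi> \<and> decomposition G T \<sigma> ks)"
  obtain \<tau> ks where some: "(SOME x. Q x) = (\<tau>, ks)" by force
  have "\<exists>x. Q x" using decomposition_exists[OF s] s \<phi> by (auto simp: Q_def)
  then have "Q (SOME x. Q x)" by (rule someI_ex)
  then have "Q (\<tau>, ks)" unfolding some .
  then have t: "fd_rep G T \<tau>" "ch G \<tau> = \<phi>" "decomposition G T \<tau> ks" by (simp_all add: Q_def)
  let ?n = "rep_dim G \<tau>"
  define w where "w = (\<lambda>(m, \<rho>). real (m * rep_dim G \<rho>) / real ?n)"
  have mu: "\<mu> \<psi> = (\<Sum>x\<leftarrow>ks. if ch G (snd x) = \<psi> then w x else 0)" for \<psi>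
    unfolding \<mu>_def char_measure_def Q_def[symmetric] some Let_def w_def prod.case case_prod_beta fst_conv snd_conv ..
  have ks: "irr_rep G T \<rho>" if "(m, \<rho>) \<in> set ks" for m \<rho>
    using t(3)[unfolded decomposition_def, THEN conjunct1] that by blast
  have w0: "0 \<le> w x" for x by (simp add: w_def case_prod_beta)
  show "0 \<le> \<mu> \<psi>" unfolding mu by (intro sum_list_nonneg) (auto simp: w0)
  define S where "S = (\<lambda>x. ch G (snd x)) ` set ks"
  have finS: "finite S" by (simp add: S_def)
  have supp: "{\<psi>. \<mu> \<psi> \<noteq> 0} \<subseteq> S"
  proof (rule subsetI, rule ccontr)
    fix \<psi> assume "\<psi> \<in> {\<psi>. \<mu> \<psi> \<noteq> 0}" "\<psi> \<notin> S"
    then have eq0: "map (\<lambda>x. if ch G (snd x) = \<psi> then w x else 0) ks = map (\<lambda>_. 0) ks"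
      by (intro map_cong) (auto simp: S_def)
    have "\<mu> \<psi> = 0" unfolding mu eq0 by simp
    with \<open>\<psi> \<in> {\<psi>. \<mu> \<psi> \<noteq> 0}\<close> show False by simp
  qed
  have Sirr: "S \<subseteq> irr_chars G T"
  proof
    fix \<psi> assume "\<psi> \<in> S"
    then obtain m \<rho> where "(m, \<rho>) \<in> set ks" "\<psi> = ch G \<rho>" by (auto simp: S_def)
    then show "\<psi> \<in> irr_chars G T" using ks unfolding irr_chars_def by blast
  qed
  show "{\<psi>. \<mu> \<psi> \<noteq> 0} \<subseteq> irr_chars G T" by (rule subset_trans[OF supp Sirr])
  show "finite {\<psi>. \<mu> \<psi> \<noteq> 0}" by (rule finite_subset[OF supp finS])
  \<comment> \<open>List entries with equal characters are merged in \<open>\<mu>\<close>; the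
    induction undoes the merging without appeal to distinctness of the characters in the
    list.\<close>
  have sum: "(\<Sum>\<psi>\<in>S. (\<Sum>x\<leftarrow>xs. if ch G (snd x) = \<psi> then w x else 0) *\<^sub>R h \<psi>) = (\<Sum>x\<leftarrow>xs. w x *\<^sub>R h (ch G (snd x)))"
    if "set xs \<subseteq> set ks" for xs and h :: "_ \<Rightarrow> complex"
    using that
  proof (induction xs)
    case (Cons x xs)
    have x: "ch G (snd x) \<in> S" using Cons.prems by (auto simp: S_def)
    have "(\<Sum>\<psi>\<in>S. (\<Sum>x\<leftarrow>x # xs. if ch G (snd x) = \<psi> then w x else 0) *\<^sub>R h \<psi>) =
        (\<Sum>\<psi>\<in>S. if \<psi> = ch G (snd x) then w x *\<^sub>R h \<psi> else 0) +
        (\<Sum>\<psi>\<in>S. (\<Sum>x\<leftarrow>xs. if ch G (snd x) = \<psi> then w x else 0) *\<^sub>R h \<psi>)"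
      unfolding sum.distrib[symmetric] by (intro sum.cong) (auto simp: scaleR_add_left)
    then show ?case using Cons x finS by simp
  qed simp
  have rep: "(\<Sum>\<psi> | \<mu> \<psi> \<noteq> 0. of_real (\<mu> \<psi>) * h \<psi>) = (\<Sum>x\<leftarrow>ks. of_real (w x) * h (ch G (snd x)))" for h :: "_ \<Rightarrow> complex"
  proof -
    have "(\<Sum>\<psi> | \<mu> \<psi> \<noteq> 0. of_real (\<mu> \<psi>) * h \<psi>) = (\<Sum>\<psi>\<in>S. \<mu> \<psi> *\<^sub>R h \<psi>)"
      by (rule sum.mono_neutral_cong_left[OF finS supp]) (auto simp: scaleR_conv_of_real)
    then show ?thesis unfolding mu using sum[of ks h] by (simp add: scaleR_conv_of_real)
  qed
  show *: "(\<Sum>\<psi> | \<mu> \<psi> \<noteq> 0. of_real (\<mu> \<psi>) * \<psi> g) = \<phi> g" if "g \<in> carrier G" for g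
    using rep[of "\<lambda>\<psi>. \<psi> g"] decomposition_ch[OF t(1,3) that] t(2)
    unfolding w_def case_prod_unfold by simp
  \<comment> \<open>The total mass is the value at \<open>\<one>\<close>, where every normalised
    character equals 1.\<close>
  have "of_real (\<Sum>\<psi> | \<mu> \<psi> \<noteq> 0. \<mu> \<psi>) = (\<Sum>\<psi> | \<mu> \<psi> \<noteq> 0. of_real (\<mu> \<psi>) * \<psi> \<one>)"
  proof -
    have "\<psi> \<one> = 1" if nz: "\<mu> \<psi> \<noteq> 0" for \<psi>
    proof -
      have "\<psi> \<in> irr_chars G T" using supp Sirr nz by auto
      then obtain \<pi> where "irr_rep G T \<pi>" "\<psi> = ch G \<pi>" unfolding irr_chars_def by blast
      then show ?thesis using ch_one[OF irr_rep_fd] by simp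
    qed
    then show ?thesis unfolding of_real_sum by (intro sum.cong) auto
  qed
  also have "\<dots> = 1" using *[OF one_closed] ch_one[OF s] \<phi> by simp
  finally show "(\<Sum>\<psi> | \<mu> \<psi> \<noteq> 0. \<mu> \<psi>) = 1" by (simp only: of_real_eq_1_iff)
qed

end

section \<open>Associativity of convolutions on discrete sets\<close>

lemma abs_summable_on_finite_support:
  assumes "finite {x \<in> A. f x \<noteq> 0}"
  shows "f abs_summable_on A"
proof -
  have "(\<lambda>x. norm (f x)) summable_on {x \<in> A. f x \<noteq> 0}" using assms by simp
  then show ?thesis by (rule summable_on_cong_neutral[THEN iffD1, rotated -1]) auto
qed

lemma infsum_finite_support:
  fixes f :: "'k \<Rightarrow> complex"
  assumes "finite S" "S \<subseteq> A" "\<And>x. x \<in> A \<Longrightarrow> x \<notin> S \<Longrightarrow> f x = 0"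
  shows "infsum f A = sum f S"
proof -
  have "infsum f A = infsum f S" using assms(2,3) by (intro infsum_cong_neutral) auto
  then show ?thesis using assms(1) by simp
qed

text \<open>Associativity on Dirac measures: for finitely supported convolutions it involves finite
  sums only, hence can be decided by identities between functions.\<close>

definition point_assoc :: "'k set \<Rightarrow> ('k \<Rightarrow> 'k \<Rightarrow> 'k \<Rightarrow> real) \<Rightarrow> bool" where
  "point_assoc K c \<longleftrightarrow> (\<forall>x\<in>K. \<forall>y\<in>K. \<forall>z\<in>K. \<forall>t.
     (\<Sum>w | c x y w \<noteq> 0. c x y w * c w z t) = (\<Sum>w | c y z w \<noteq> 0. c y z w * c x w t))"

definition cdirac :: "'k \<Rightarrow> 'k \<Rightarrow> complex" where
  "cdirac x = (\<lambda>z. of_real (dirac x z))"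

lemma cdirac_bounded: "x \<in> K \<Longrightarrow> cdirac x \<in> bounded_measures K"
proof -
  assume "x \<in> K"
  moreover have "cdirac x abs_summable_on K"
    by (rule abs_summable_on_finite_support, rule finite_subset[of _ "{x}"]) (auto simp: cdirac_def dirac_def)
  ultimately show ?thesis by (auto simp: bounded_measures_def cdirac_def dirac_def)
qed

lemma conv_ext_finite:
  assumes "finite S" "finite R" "S \<subseteq> K" "R \<subseteq> K" "\<And>x. x \<notin> S \<Longrightarrow> \<mu> x = 0" "\<And>x. x \<notin> R \<Longrightarrow> \<nu> x = 0"
  shows "conv_ext K c \<mu> \<nu> z = (\<Sum>x\<in>S. \<Sum>y\<in>R. \<mu> x * \<nu> y * of_real (c x y z))"
proof -
  have "conv_ext K c \<mu> \<nu> z = (\<Sum>(x, y)\<in>S \<times> R. \<mu> x * \<nu> y * of_real (c x y z))"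
    unfolding conv_ext_def
  proof (rule infsum_finite_support)
    fix p assume "p \<notin> S \<times> R"
    then have "fst p \<notin> S \<or> snd p \<notin> R" by (auto simp: mem_Times_iff)
    then show "(case p of (x, y) \<Rightarrow> \<mu> x * \<nu> y * of_real (c x y z)) = 0"
      by (auto simp: case_prod_unfold assms(5,6))
  qed (use assms(1-4) in auto)
  then show ?thesis by (simp add: sum.cartesian_product)
qed

lemma fin_prob_measureD:
  assumes "fin_prob_measure K \<mu>"
  shows "0 \<le> \<mu> z" "\<mu> z \<noteq> 0 \<Longrightarrow> z \<in> K" "finite {z. \<mu> z \<noteq> 0}" "(\<Sum>z | \<mu> z \<noteq> 0. \<mu> z) = 1" "\<mu> z \<le> 1"
proof -
  show *: "0 \<le> \<mu> z" "\<mu> z \<noteq> 0 \<Longrightarrow> z \<in> K" "finite {z. \<mu> z \<noteq> 0}" "(\<Sum>z | \<mu> z \<noteq> 0. \<mu> z) = 1" for z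
    using assms unfolding fin_prob_measure_def by blast+
  show "\<mu> z \<le> 1"
  proof (cases "\<mu> z = 0")
    case False
    then have "\<mu> z \<le> (\<Sum>z | \<mu> z \<noteq> 0. \<mu> z)" by (intro member_le_sum *(1,3)) auto
    then show ?thesis using *(4) by simp
  qed simp
qed

lemma point_assoc_if_conv_ext_assoc:
  assumes c: "\<And>x y. x \<in> K \<Longrightarrow> y \<in> K \<Longrightarrow> fin_prob_measure K (c x y)"
    and assoc: "\<And>\<mu> \<nu> \<xi>. \<lbrakk>\<mu> \<in> bounded_measures K; \<nu> \<in> bounded_measures K; \<xi> \<in> bounded_measures K\<rbrakk> \<Longrightarrow>
      conv_ext K c (conv_ext K c \<mu> \<nu>) \<xi> = conv_ext K c \<mu> (conv_ext K c \<nu> \<xi>)"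
  shows "point_assoc K c"
  unfolding point_assoc_def
proof (intro ballI allI)
  fix x y z t assume K: "x \<in> K" "y \<in> K" "z \<in> K"
  have cd: "conv_ext K c (cdirac u) (cdirac v) = (\<lambda>w. of_real (c u v w))" if "u \<in> K" "v \<in> K" for u v
  proof
    fix w show "conv_ext K c (cdirac u) (cdirac v) w = of_real (c u v w)"
      using conv_ext_finite[of "{u}" "{v}" K "cdirac u" "cdirac v" c w] that by (simp add: cdirac_def dirac_def)
  qed
  note f = fin_prob_measureD[OF c]
  let ?S = "{w. c x y w \<noteq> 0}" and ?R = "{w. c y z w \<noteq> 0}"
  have S: "finite ?S" "?S \<subseteq> K" "finite ?R" "?R \<subseteq> K" 
    using f(3)[OF K(1,2)] f(3)[OF K(2,3)] f(2)[OF K(1,2)] f(2)[OF K(2,3)] by blast+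
  have "conv_ext K c (\<lambda>w. of_real (c x y w)) (cdirac z) t = (\<Sum>w\<in>?S. of_real (c x y w * c w z t))"
    using conv_ext_finite[of ?S "{z}" K "\<lambda>w. of_real (c x y w)" "cdirac z" c t] S K
    by (simp add: cdirac_def dirac_def)
  moreover have "conv_ext K c (cdirac x) (\<lambda>w. of_real (c y z w)) t = (\<Sum>w\<in>?R. of_real (c y z w * c x w t))"
    using conv_ext_finite[of "{x}" ?R K "cdirac x" "\<lambda>w. of_real (c y z w)" c t] S K
    by (simp add: cdirac_def dirac_def)
  moreover have "conv_ext K c (\<lambda>w. of_real (c x y w)) (cdirac z) = conv_ext K c (cdirac x) (\<lambda>w. of_real (c y z w))"
    using assoc[OF cdirac_bounded cdirac_bounded cdirac_bounded, OF K] unfolding cd[OF K(1,2)] cd[OF K(2,3)] .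
  ultimately have "(\<Sum>w\<in>?S. complex_of_real (c x y w * c w z t)) = (\<Sum>w\<in>?R. of_real (c y z w * c x w t))" by simp
  then show "(\<Sum>w | c x y w \<noteq> 0. c x y w * c w z t) = (\<Sum>w | c y z w \<noteq> 0. c y z w * c x w t)"
    unfolding of_real_sum[symmetric] of_real_eq_iff .
qed

lemma abs_summable_on_product:
  fixes f :: "'k \<Rightarrow> complex" and g :: "'l \<Rightarrow> complex"
  assumes "f abs_summable_on A" "g abs_summable_on B"
  shows "(\<lambda>(x, y). f x * g y) abs_summable_on A \<times> B"
  unfolding abs_summable_on_Sigma_iff
proof (intro conjI ballI)
  fix x show "(\<lambda>y. case (x, y) of (x, y) \<Rightarrow> f x * g y) abs_summable_on B"
    using assms(2) by (simp add: norm_mult summable_on_cmult_right)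
  have "(\<Sum>\<^sub>\<infinity>y\<in>B. norm (case (x, y) of (x, y) \<Rightarrow> f x * g y)) = norm (f x) * (\<Sum>\<^sub>\<infinity>y\<in>B. norm (g y))" for x
    by (simp add: norm_mult infsum_cmult_right')
  moreover have "(\<lambda>x. norm (norm (f x) * (\<Sum>\<^sub>\<infinity>y\<in>B. norm (g y)))) summable_on A"
    using assms(1) by (simp add: abs_mult summable_on_cmult_left)
  ultimately show "(\<lambda>x. \<Sum>\<^sub>\<infinity>y\<in>B. norm (case (x, y) of (x, y) \<Rightarrow> f x * g y)) abs_summable_on A" by simp
qed

text \<open>Probability kernels preserve the total mass of the absolute value of \<open>g\<close>,
  and the factor \<open>e\<close> is at most 1. In a triple convolution \<open>d\<close> is the
  inner convolution and \<open>e\<close> the mass that the outer one gives to a fixed point.\<close>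

lemma abs_summable_on_kernel:
  fixes g :: "'p \<Rightarrow> complex" and d e :: "'p \<Rightarrow> 'k \<Rightarrow> real"
  assumes g: "g abs_summable_on P" and d: "\<And>p. p \<in> P \<Longrightarrow> fin_prob_measure K (d p)"
    and e: "\<And>p w. p \<in> P \<Longrightarrow> w \<in> K \<Longrightarrow> 0 \<le> e p w \<and> e p w \<le> 1"
  shows "(\<lambda>(p, w). g p * of_real (d p w * e p w)) abs_summable_on P \<times> K"
proof -
  have "(\<lambda>(p, w). g p * of_real (d p w)) abs_summable_on P \<times> K"
    unfolding abs_summable_on_Sigma_iff
  proof (intro conjI ballI)
    fix p assume p: "p \<in> P"
    note D = fin_prob_measureD[OF d[OF p]]
    show "(\<lambda>w. case (p, w) of (p, w) \<Rightarrow> g p * of_real (d p w)) abs_summable_on K"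
      by (rule abs_summable_on_finite_support) (rule finite_subset[OF _ D(3)], auto)
  next
    have "(\<Sum>\<^sub>\<infinity>w\<in>K. norm (case (p, w) of (p, w) \<Rightarrow> g p * of_real (d p w))) = norm (g p)" if p: "p \<in> P" for p
    proof -
      note D = fin_prob_measureD[OF d[OF p]]
      have "(\<Sum>\<^sub>\<infinity>w\<in>K. norm (case (p, w) of (p, w) \<Rightarrow> g p * of_real (d p w))) = (\<Sum>\<^sub>\<infinity>w\<in>K. norm (g p) * d p w)"
        using D(1) by (simp add: norm_mult)
      also have "\<dots> = norm (g p) * (\<Sum>\<^sub>\<infinity>w\<in>K. d p w)" by (rule infsum_cmult_right')
      also have "(\<Sum>\<^sub>\<infinity>w\<in>K. d p w) = (\<Sum>\<^sub>\<infinity>w\<in>{w. d p w \<noteq> 0}. d p w)"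
        using D(2) by (intro infsum_cong_neutral) auto
      also have "\<dots> = 1" using D(3,4) by simp
      finally show ?thesis by simp
    qed
    then show "(\<lambda>p. \<Sum>\<^sub>\<infinity>w\<in>K. norm (case (p, w) of (p, w) \<Rightarrow> g p * of_real (d p w))) abs_summable_on P"
      using g summable_on_cong[of P "\<lambda>p. norm (\<Sum>\<^sub>\<infinity>w\<in>K. norm (case (p, w) of (p, w) \<Rightarrow> g p * of_real (d p w)))" "\<lambda>p. norm (g p)"]
      by simp
  qed
  then show ?thesis
  proof (rule abs_summable_on_comparison_test)
    fix pw assume "pw \<in> P \<times> K"
    then obtain p w where pw: "pw = (p, w)" "p \<in> P" "w \<in> K" by blast
    have "0 \<le> d p w" using fin_prob_measureD(1)[OF d[OF pw(2)]] .
    then have "\<bar>d p w * e p w\<bar> \<le> \<bar>d p w\<bar>" using e[OF pw(2,3)] by (simp add: abs_mult mult_left_le)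
    then show "norm (case pw of (p, w) \<Rightarrow> g p * of_real (d p w * e p w)) \<le> norm (case pw of (p, w) \<Rightarrow> g p * of_real (d p w))"
      unfolding pw(1) prod.case norm_mult norm_of_real by (rule mult_left_mono) simp
  qed
qed

text \<open>Both sides are iterated sums over quadruples of three points and an intermediate point
  \<open>w\<close>. Absolute summability allows regrouping, and with \<open>w\<close> summed
  innermost the two sides agree term by term by \<open>point_assoc\<close>.\<close>

lemma conv_ext_assoc_if_point_assoc:
  assumes c: "\<And>x y. x \<in> K \<Longrightarrow> y \<in> K \<Longrightarrow> fin_prob_measure K (c x y)"
    and pa: "point_assoc K c"
    and m: "\<mu> \<in> bounded_measures K" "\<nu> \<in> bounded_measures K" "\<xi> \<in> bounded_measures K"
  shows "conv_ext K c (conv_ext K c \<mu> \<nu>) \<xi> = conv_ext K c \<mu> (conv_ext K c \<nu> \<xi>)"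
proof
  fix t
  note f = fin_prob_measureD[OF c]
  define P where "P = K \<times> K \<times> K"
  define g where "g = (\<lambda>(x, y, z). \<mu> x * (\<nu> y * \<xi> z))"
  have "(\<lambda>(x, yz). \<mu> x * (case yz of (y, z) \<Rightarrow> \<nu> y * \<xi> z)) abs_summable_on K \<times> K \<times> K"
    using m unfolding bounded_measures_def by (intro abs_summable_on_product) auto
  then have g: "g abs_summable_on P" unfolding g_def P_def by (simp add: case_prod_unfold)
  \<comment> \<open>The intermediate point \<open>w\<close> comes from \<open>x\<close> and
    \<open>y\<close> in \<open>H1\<close>, from \<open>y\<close> and \<open>z\<close> in
    \<open>H2\<close>.\<close>
  define H1 where "H1 = (\<lambda>((x, y, z), w). g (x, y, z) * of_real (c x y w * c w z t))"
  define H2 where "H2 = (\<lambda>((x, y, z), w). g (x, y, z) * of_real (c y z w * c x w t))"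
  have "(\<lambda>(p, w). g p * of_real ((case p of (x, y, z) \<Rightarrow> c x y) w * (case p of (x, y, z) \<Rightarrow> \<lambda>w. c w z t) w)) abs_summable_on P \<times> K"
    by (rule abs_summable_on_kernel[OF g]) (auto simp: P_def intro: f(1) f(5) c)
  then have "H1 abs_summable_on P \<times> K" unfolding H1_def by (simp add: case_prod_unfold)
  then have H1: "H1 summable_on P \<times> K" by (rule abs_summable_summable)
  have "(\<lambda>(p, w). g p * of_real ((case p of (x, y, z) \<Rightarrow> c y z) w * (case p of (x, y, z) \<Rightarrow> \<lambda>w. c x w t) w)) abs_summable_on P \<times> K"
    by (rule abs_summable_on_kernel[OF g]) (auto simp: P_def intro: f(1) f(5) c)
  then have "H2 abs_summable_on P \<times> K" unfolding H2_def by (simp add: case_prod_unfold)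
  then have H2: "H2 summable_on P \<times> K" by (rule abs_summable_summable)
  \<comment> \<open>The nested convolutions sum over \<open>(w, z)\<close> outside
    \<open>(x, y)\<close>, respectively over \<open>(x, w)\<close> outside \<open>(y, z)\<close>;
    these bijections bring both to a triple followed by \<open>w\<close>.\<close>
  have b1: "bij_betw (\<lambda>((w, z), (x, y)). ((x, y, z), w)) ((K \<times> K) \<times> K \<times> K) (P \<times> K)"
    by (rule bij_betwI[where g = "\<lambda>((x, y, z), w). ((w, z), (x, y))"]) (auto simp: P_def)
  have b2: "bij_betw (\<lambda>((x, w), (y, z)). ((x, y, z), w)) ((K \<times> K) \<times> K \<times> K) (P \<times> K)"
    by (rule bij_betwI[where g = "\<lambda>((x, y, z), w). ((x, w), (y, z))"]) (auto simp: P_def)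
  have "conv_ext K c (conv_ext K c \<mu> \<nu>) \<xi> t =
      (\<Sum>\<^sub>\<infinity>(w, z)\<in>K \<times> K. \<Sum>\<^sub>\<infinity>(x, y)\<in>K \<times> K. H1 ((x, y, z), w))"
    unfolding conv_ext_def
  proof (rule infsum_cong, clarify)
    fix w z
    have "(\<Sum>\<^sub>\<infinity>(x, y)\<in>K \<times> K. \<mu> x * \<nu> y * of_real (c x y w)) * \<xi> z * of_real (c w z t) =
        (\<Sum>\<^sub>\<infinity>(x, y)\<in>K \<times> K. \<mu> x * \<nu> y * of_real (c x y w)) * (\<xi> z * of_real (c w z t))" by simp
    also have "\<dots> = (\<Sum>\<^sub>\<infinity>p\<in>K \<times> K. (case p of (x, y) \<Rightarrow> \<mu> x * \<nu> y * of_real (c x y w)) * (\<xi> z * of_real (c w z t)))"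
      by (rule infsum_cmult_left'[symmetric])
    also have "\<dots> = (\<Sum>\<^sub>\<infinity>(x, y)\<in>K \<times> K. H1 ((x, y, z), w))"
      by (rule infsum_cong) (auto simp: H1_def g_def mult_ac)
    finally show "(\<Sum>\<^sub>\<infinity>(x, y)\<in>K \<times> K. \<mu> x * \<nu> y * of_real (c x y w)) * \<xi> z * of_real (c w z t) =
        (\<Sum>\<^sub>\<infinity>(x, y)\<in>K \<times> K. H1 ((x, y, z), w))" .
  qed
  also have "\<dots> = (\<Sum>\<^sub>\<infinity>p\<in>K \<times> K. \<Sum>\<^sub>\<infinity>q\<in>K \<times> K. H1 ((\<lambda>((w, z), (x, y)). ((x, y, z), w)) (p, q)))"
    by (simp add: case_prod_unfold)
  also have "\<dots> = infsum (\<lambda>r. H1 ((\<lambda>((w, z), (x, y)). ((x, y, z), w)) r)) ((K \<times> K) \<times> K \<times> K)"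
    by (rule infsum_Sigma_banach) (simp only: summable_on_reindex_bij_betw[OF b1] H1)
  also have "\<dots> = infsum H1 (P \<times> K)" by (rule infsum_reindex_bij_betw[OF b1])
  also have "\<dots> = (\<Sum>\<^sub>\<infinity>p\<in>P. \<Sum>\<^sub>\<infinity>w\<in>K. H1 (p, w))" by (rule infsum_Sigma_banach[OF H1, symmetric])
  also have "\<dots> = (\<Sum>\<^sub>\<infinity>p\<in>P. \<Sum>\<^sub>\<infinity>w\<in>K. H2 (p, w))"
  proof (rule infsum_cong)
    fix p assume "p \<in> P"
    then obtain x y z where p: "p = (x, y, z)" and K: "x \<in> K" "y \<in> K" "z \<in> K" by (auto simp: P_def)
    have "(\<Sum>\<^sub>\<infinity>w\<in>K. H1 (p, w)) = (\<Sum>w | c x y w \<noteq> 0. g p * of_real (c x y w * c w z t))"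
      using f(3)[OF K(1,2)] f(2)[OF K(1,2)] by (subst infsum_finite_support[of "{w. c x y w \<noteq> 0}"]) (auto simp: H1_def p)
    also have "\<dots> = g p * of_real (\<Sum>w | c x y w \<noteq> 0. c x y w * c w z t)"
      by (simp only: sum_distrib_left of_real_sum)
    also have "(\<Sum>w | c x y w \<noteq> 0. c x y w * c w z t) = (\<Sum>w | c y z w \<noteq> 0. c y z w * c x w t)"
      using pa K unfolding point_assoc_def by blast
    also have "g p * of_real \<dots> = (\<Sum>w | c y z w \<noteq> 0. g p * of_real (c y z w * c x w t))"
      by (simp only: sum_distrib_left of_real_sum)
    also have "\<dots> = (\<Sum>\<^sub>\<infinity>w\<in>K. H2 (p, w))"
      using f(3)[OF K(2,3)] f(2)[OF K(2,3)] by (subst infsum_finite_support[of "{w. c y z w \<noteq> 0}"]) (auto simp: H2_def p)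
    finally show "(\<Sum>\<^sub>\<infinity>w\<in>K. H1 (p, w)) = (\<Sum>\<^sub>\<infinity>w\<in>K. H2 (p, w))" .
  qed
  also have "\<dots> = infsum H2 (P \<times> K)" by (rule infsum_Sigma_banach[OF H2])
  also have "\<dots> = infsum (\<lambda>r. H2 ((\<lambda>((x, w), (y, z)). ((x, y, z), w)) r)) ((K \<times> K) \<times> K \<times> K)"
    by (rule infsum_reindex_bij_betw[OF b2, symmetric])
  also have "\<dots> = (\<Sum>\<^sub>\<infinity>p\<in>K \<times> K. \<Sum>\<^sub>\<infinity>q\<in>K \<times> K. H2 ((\<lambda>((x, w), (y, z)). ((x, y, z), w)) (p, q)))"
    by (rule infsum_Sigma_banach[symmetric]) (simp only: summable_on_reindex_bij_betw[OF b2] H2)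
  also have "\<dots> = (\<Sum>\<^sub>\<infinity>(x, w)\<in>K \<times> K. \<Sum>\<^sub>\<infinity>(y, z)\<in>K \<times> K. H2 ((x, y, z), w))"
    by (simp add: case_prod_unfold)
  also have "\<dots> = conv_ext K c \<mu> (conv_ext K c \<nu> \<xi>) t"
    unfolding conv_ext_def
  proof (rule infsum_cong, clarify)
    fix x w
    have "(\<Sum>\<^sub>\<infinity>(y, z)\<in>K \<times> K. H2 ((x, y, z), w)) =
        (\<Sum>\<^sub>\<infinity>p\<in>K \<times> K. (case p of (y, z) \<Rightarrow> \<nu> y * \<xi> z * of_real (c y z w)) * (\<mu> x * of_real (c x w t)))"
      by (rule infsum_cong) (auto simp: H2_def g_def mult_ac)
    also have "\<dots> = (\<Sum>\<^sub>\<infinity>(y, z)\<in>K \<times> K. \<nu> y * \<xi> z * of_real (c y z w)) * (\<mu> x * of_real (c x w t))"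
      by (rule infsum_cmult_left')
    finally show "(\<Sum>\<^sub>\<infinity>(y, z)\<in>K \<times> K. H2 ((x, y, z), w)) =
        \<mu> x * (\<Sum>\<^sub>\<infinity>(y, z)\<in>K \<times> K. \<nu> y * \<xi> z * of_real (c y z w)) * of_real (c x w t)"
      by (simp add: mult_ac)
  qed
  finally show "conv_ext K c (conv_ext K c \<mu> \<nu>) \<xi> t = conv_ext K c \<mu> (conv_ext K c \<nu> \<xi>) t" .
qed

section \<open>Restriction and induction\<close>

locale compact_pair = compact_grp G T
  for G :: "('a, 'b) monoid_scheme" (structure) and T +
  fixes H :: "'a set"
  assumes subgroup: "subgroup H G" and closed: "closedin T H" and finite_index: "finite (rcosets H)"
begin

lemma H_subset: "h \<in> H \<Longrightarrow> h \<in> carrier G"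
  using subgroup.subset[OF subgroup] by blast

lemma H_closed: "x \<in> H \<Longrightarrow> y \<in> H \<Longrightarrow> x \<otimes> y \<in> H" "x \<in> H \<Longrightarrow> inv x \<in> H" "\<one> \<in> H"
  using subgroup.m_closed[OF subgroup] subgroup.m_inv_closed[OF subgroup] subgroup.one_closed[OF subgroup] by auto

lemma inv_sub: "h \<in> H \<Longrightarrow> inv\<^bsub>G\<lparr>carrier := H\<rparr>\<^esub> h = inv h"
  by (rule m_inv_consistent[OF subgroup])

lemma inv_mult_cancel: "x \<in> carrier G \<Longrightarrow> y \<in> carrier G \<Longrightarrow> inv x \<otimes> (x \<otimes> y) = y"
  and mult_inv_cancel: "x \<in> carrier G \<Longrightarrow> y \<in> carrier G \<Longrightarrow> x \<otimes> (inv x \<otimes> y) = y"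
  by (simp_all add: m_assoc[symmetric])

lemma mult_in_H_iff: "x \<in> H \<Longrightarrow> y \<in> carrier G \<Longrightarrow> x \<otimes> y \<in> H \<longleftrightarrow> y \<in> H"
  using H_closed inv_mult_cancel[OF H_subset] by metis

lemma compact_grp_sub: "compact_grp (G\<lparr>carrier := H\<rparr>) (subtopology T H)"
proof
  have HT: "H \<subseteq> topspace T" using H_subset by (auto simp: topspace)
  have ts: "topspace (subtopology T H) = H" using HT by auto
  have "continuous_map (prod_topology (subtopology T H) (subtopology T H)) (subtopology T H) (\<lambda>(x, y). x \<otimes> y)"
    unfolding continuous_map_in_subtopology subtopology_Times[symmetric]
    using HT continuous_map_from_subtopology[OF continuous_mult] H_closed by auto
  moreover have "continuous_map (subtopology T H) (subtopology T H) (\<lambda>x. inv\<^bsub>G\<lparr>carrier := H\<rparr>\<^esub> x)"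
  proof (rule continuous_map_eq)
    show "continuous_map (subtopology T H) (subtopology T H) (\<lambda>x. inv x)"
      unfolding continuous_map_in_subtopology
      using continuous_map_from_subtopology[OF continuous_inv] H_closed by auto
  qed (simp add: inv_sub)
  ultimately have "topological_group (G\<lparr>carrier := H\<rparr>) (subtopology T H)"
    unfolding topological_group_def using subgroup.subgroup_is_group[OF subgroup is_group] ts by simp
  moreover have "compact_space (subtopology T H)"
    by (rule compact_space_subtopology[OF closedin_compact_space[OF compact closed]])
  moreover have "Hausdorff_space (subtopology T H)"
    using compact_group Hausdorff_space_subtopology by (auto simp: compact_group_def)
  ultimately show "compact_group (G\<lparr>carrier := H\<rparr>) (subtopology T H)" by (simp add: compact_group_def)
qed

sublocale sub: compact_grp "G\<lparr>carrier := H\<rparr>" "subtopology T H"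
  by (rule compact_grp_sub)

section \<open>Cosets and the transversal\<close>

lemma r_coset_eq_iff:
  assumes "t \<in> carrier G" "x \<in> carrier G"
  shows "H #> t = H #> x \<longleftrightarrow> x \<otimes> inv t \<in> H"
proof
  assume "H #> t = H #> x"
  then have "x \<in> H #> t" using rcos_self[OF assms(2) subgroup] by simp
  then obtain h where "h \<in> H" "x = h \<otimes> t" by (auto simp: r_coset_def)
  then show "x \<otimes> inv t \<in> H" using assms H_subset by (simp add: m_assoc)
next
  assume "x \<otimes> inv t \<in> H"
  moreover have "x = (x \<otimes> inv t) \<otimes> t" using assms by (simp add: m_assoc)
  ultimately have "x \<in> H #> t" unfolding r_coset_def by blast
  then show "H #> t = H #> x" using repr_independence[OF _ assms(1) subgroup] by simp
qed

text \<open>The very choice made inside \<open>ind_rep\<close>, named so that its blocks can be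
  addressed.\<close>

definition ts :: "'a list" where
  "ts = (SOME ts. right_transversal G H ts)"

abbreviation "ind \<equiv> length ts"

lemma right_transversal_ts: "right_transversal G H ts"
proof -
  have "\<exists>t\<in>carrier G. H #> t = C" if "C \<in> rcosets H" for C using that by (auto simp: RCOSETS_def)
  then obtain r where r: "\<And>C. C \<in> rcosets H \<Longrightarrow> r C \<in> carrier G" "\<And>C. C \<in> rcosets H \<Longrightarrow> H #> r C = C" by metis
  obtain cs where cs: "set cs = rcosets H" "distinct cs" using finite_distinct_list[OF finite_index] by blast
  have inj: "inj_on r (rcosets H)" using r(2) by (metis inj_onI)
  have "bij_betw (\<lambda>t. H #> t) (r ` (rcosets H)) (rcosets H)"
    by (rule bij_betwI[where g = r]) (auto simp: r)
  then have "right_transversal G H (map r cs)"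
    unfolding right_transversal_def using cs inj r(1) by (auto simp: distinct_map)
  then show ?thesis unfolding ts_def by (rule someI)
qed

lemma ts_carrier: "k < ind \<Longrightarrow> ts ! k \<in> carrier G"
  using right_transversal_ts nth_mem unfolding right_transversal_def by blast

lemma ts_ex:
  assumes x: "x \<in> carrier G"
  obtains k where "k < ind" "x \<otimes> inv (ts ! k) \<in> H"
proof -
  have "H #> x \<in> (\<lambda>t. H #> t) ` set ts"
    using right_transversal_ts rcosetsI[OF _ x] subgroup.subset[OF subgroup]
    unfolding right_transversal_def bij_betw_def by auto
  then obtain t where t: "t \<in> set ts" "H #> x = H #> t" by blast
  then obtain k where k: "k < ind" "t = ts ! k" by (auto simp: in_set_conv_nth)
  have "x \<otimes> inv (ts ! k) \<in> H" using r_coset_eq_iff[OF ts_carrier[OF k(1)] x] t k by simp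
  with k(1) that show thesis by blast
qed

lemma ts_unique:
  assumes x: "x \<in> carrier G" and k: "k < ind" "x \<otimes> inv (ts ! k) \<in> H" and l: "l < ind" "x \<otimes> inv (ts ! l) \<in> H"
  shows "l = k"
proof -
  have "H #> ts ! k = H #> ts ! l"
    using k l r_coset_eq_iff[OF ts_carrier[OF k(1)] x] r_coset_eq_iff[OF ts_carrier[OF l(1)] x] by simp
  then have "ts ! k = ts ! l"
    using right_transversal_ts k(1) l(1) unfolding right_transversal_def bij_betw_def by (meson inj_onD nth_mem)
  then show ?thesis using right_transversal_ts k(1) l(1) by (simp add: right_transversal_def nth_eq_iff_index_eq)
qed

lemma ind_pos: "0 < ind"
proof -
  obtain k where "k < ind" using ts_ex[OF one_closed] by blast
  then show ?thesis by linarith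
qed

text \<open>Exactly one coset of the transversal contains \<open>x\<close>, so one term survives.
  This collapses the block sums of induced representations and shows that translated indicators
  partition \<open>G\<close>.\<close>

lemma sum_ts:
  assumes "x \<in> carrier G" "k < ind" "x \<otimes> inv (ts ! k) \<in> H"
  shows "(\<Sum>l<ind. if x \<otimes> inv (ts ! l) \<in> H then f l else 0) = f k"
proof -
  have "(\<Sum>l<ind. if x \<otimes> inv (ts ! l) \<in> H then f l else 0) = (\<Sum>l<ind. if l = k then f l else 0)"
  proof (rule sum.cong[OF refl])
    fix l assume "l \<in> {..<ind}"
    then have "x \<otimes> inv (ts ! l) \<in> H \<longleftrightarrow> l = k" using ts_unique[OF assms] assms(3) by blast
    then show "(if x \<otimes> inv (ts ! l) \<in> H then f l else 0) = (if l = k then f l else 0)" by simp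
  qed
  then show ?thesis using assms(2) by simp
qed

definition zero_ext :: "('a \<Rightarrow> complex) \<Rightarrow> 'a \<Rightarrow> complex" where
  "zero_ext f x = (if x \<in> H then f x else 0)"

text \<open>The complement is the union of the other cosets, which are finitely many and each closed
  as the preimage of \<open>H\<close> under a right translation.\<close>

lemma openin_H: "openin T H"
proof -
  have cl: "closedin T (H #> a)" if a: "a \<in> carrier G" for a
  proof -
    have "H #> a = {x \<in> topspace T. x \<otimes> inv a \<in> H}"
    proof (intro subset_antisym subsetI)
      fix x assume "x \<in> H #> a"
      then obtain h where "h \<in> H" "x = h \<otimes> a" by (auto simp: r_coset_def)
      then show "x \<in> {x \<in> topspace T. x \<otimes> inv a \<in> H}" using a H_subset by (simp add: topspace m_assoc)
    next
      fix x assume "x \<in> {x \<in> topspace T. x \<otimes> inv a \<in> H}"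
      moreover then have "x = (x \<otimes> inv a) \<otimes> a" using a by (simp add: topspace m_assoc)
      ultimately show "x \<in> H #> a" unfolding r_coset_def by blast
    qed
    moreover have "continuous_map T T (\<lambda>x. x \<otimes> inv a)"
      using a by (intro continuous_mult_map continuous_map_id[unfolded id_def]) (simp add: topspace)
    ultimately show ?thesis using closedin_continuous_map_preimage[OF _ closed] by simp
  qed
  have "closedin T (\<Union>((rcosets H) - {H}))"
  proof (rule closedin_Union)
    fix C assume "C \<in> (rcosets H) - {H}"
    then obtain a where "a \<in> carrier G" "C = H #> a" by (auto simp: RCOSETS_def)
    then show "closedin T C" using cl by simp
  qed (use finite_index in simp)
  moreover have "topspace T - \<Union>((rcosets H) - {H}) = H"
  proof (intro subset_antisym subsetI)
    fix x assume x: "x \<in> topspace T - \<Union>((rcosets H) - {H})"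
    then have xc: "x \<in> carrier G" by (simp add: topspace)
    have "H #> x \<in> rcosets H" using rcosetsI[OF subgroup.subset[OF subgroup] xc] .
    then have "H #> x = H" using x rcos_self[OF xc subgroup] by blast
    then show "x \<in> H" using rcos_self[OF xc subgroup] by simp
  next
    fix x assume x: "x \<in> H"
    have "x \<notin> C" if C: "C \<in> rcosets H" "C \<noteq> H" for C
    proof
      assume "x \<in> C"
      obtain a where a: "a \<in> carrier G" "C = H #> a" using C(1) by (auto simp: RCOSETS_def)
      have "H #> a = H #> x" using repr_independence[OF _ a(1) subgroup] \<open>x \<in> C\<close> a(2) by simp
      then show False using coset_join2[OF H_subset[OF x] subgroup x] C a by simp
    qed
    then show "x \<in> topspace T - \<Union>((rcosets H) - {H})" using x H_subset by (auto simp: topspace)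
  qed
  ultimately show ?thesis by (metis openin_diff openin_topspace)
qed

text \<open>\<open>H\<close> and its complement are both open, so gluing with the constant 0
  preserves continuity.\<close>

lemma continuous_zero_ext:
  assumes f: "continuous_map (subtopology T H) euclidean f"
  shows "continuous_map T euclidean (zero_ext f)"
  unfolding continuous_map_def
proof (intro conjI allI impI)
  fix U :: "complex set" assume U: "openin euclidean U"
  have "openin (subtopology T H) {x \<in> topspace (subtopology T H). f x \<in> U}"
    using f U by (simp add: continuous_map_def)
  then have 1: "openin T {x \<in> topspace (subtopology T H). f x \<in> U}"
    using openin_open_subtopology[OF openin_H] by blast
  have 2: "openin T (topspace T - H)" using closed by (simp add: closedin_def)
  have "{x \<in> topspace T. zero_ext f x \<in> U} =
      (if 0 \<in> U then {x \<in> topspace (subtopology T H). f x \<in> U} \<union> (topspace T - H)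
       else {x \<in> topspace (subtopology T H). f x \<in> U})"
    by (auto simp: zero_ext_def)
  then show "openin T {x \<in> topspace T. zero_ext f x \<in> U}" using 1 2 by auto
qed auto

section \<open>Induced representations\<close>

lemma ind_rep_index:
  assumes "i < ind * rep_dim (G\<lparr>carrier := H\<rparr>) \<tau>" "j < ind * rep_dim (G\<lparr>carrier := H\<rparr>) \<tau>"
  defines "d \<equiv> rep_dim (G\<lparr>carrier := H\<rparr>) \<tau>"
  shows "ind_rep G H \<tau> g $$ (i, j) =
    zero_ext (\<lambda>x. \<tau> x $$ (i mod d, j mod d)) (ts ! (i div d) \<otimes> g \<otimes> inv (ts ! (j div d)))"
  using assms unfolding ind_rep_def ts_def[symmetric] zero_ext_def by (simp add: Let_def)

lemma ind_rep_carrier: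
  "ind_rep G H \<tau> g \<in> carrier_mat (ind * rep_dim (G\<lparr>carrier := H\<rparr>) \<tau>) (ind * rep_dim (G\<lparr>carrier := H\<rparr>) \<tau>)"
  unfolding ind_rep_def ts_def[symmetric] by (simp add: Let_def)

text \<open>Each row of blocks has a single position whose argument lies in \<open>H\<close>, given
  by the transversal element of the coset of \<open>ts ! k \<otimes> g\<close>. A product of block
  matrices thus composes arguments, and multiplicativity reduces to that of
  \<open>\<tau>\<close>.\<close>

lemma fd_rep_ind:
  assumes t: "fd_rep (G\<lparr>carrier := H\<rparr>) (subtopology T H) \<tau>"
  shows "fd_rep G T (ind_rep G H \<tau>)" "rep_dim G (ind_rep G H \<tau>) = ind * rep_dim (G\<lparr>carrier := H\<rparr>) \<tau>"
proof -
  let ?d = "rep_dim (G\<lparr>carrier := H\<rparr>) \<tau>"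
  note tD = sub.fd_repD[OF t]
  note c = ind_rep_carrier[of \<tau>]
  have pos: "0 < ind * ?d" using tD(1) ind_pos by simp
  have one: "ind_rep G H \<tau> \<one> = 1\<^sub>m (ind * ?d)"
  proof (rule eq_matI)
    fix i j assume "i < dim_row (1\<^sub>m (ind * ?d) :: complex mat)" "j < dim_col (1\<^sub>m (ind * ?d) :: complex mat)"
    then have ij: "i < ind * ?d" "j < ind * ?d" by auto
    note dm = nat_div_mod_less[OF ij(1)] nat_div_mod_less[OF ij(2)]
    let ?k = "i div ?d" and ?l = "j div ?d"
    have tk: "ts ! ?k \<in> carrier G" "ts ! ?l \<in> carrier G" using ts_carrier dm by auto
    show "ind_rep G H \<tau> \<one> $$ (i, j) = 1\<^sub>m (ind * ?d) $$ (i, j)"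
    proof (cases "?k = ?l")
      case True
      have "\<tau> \<one> = 1\<^sub>m ?d" using tD(2) by simp
      moreover have "i = j \<longleftrightarrow> i mod ?d = j mod ?d" using True by (metis div_mult_mod_eq)
      ultimately show ?thesis using tk dm ij True
        by (simp add: ind_rep_index zero_ext_def H_closed)
    next
      case False
      then have "ts ! ?k \<otimes> inv (ts ! ?l) \<notin> H"
        using ts_unique[OF tk(1) dm(1) _ dm(3)] tk H_closed(3) by auto
      moreover have "i \<noteq> j" using False by auto
      ultimately show ?thesis using tk ij by (simp add: ind_rep_index zero_ext_def)
    qed
  qed (use c in auto)
  have mult: "ind_rep G H \<tau> (g \<otimes> h) = ind_rep G H \<tau> g * ind_rep G H \<tau> h" if g: "g \<in> carrier G" and h: "h \<in> carrier G" for g h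
  proof (rule eq_matI)
    fix i j assume "i < dim_row (ind_rep G H \<tau> g * ind_rep G H \<tau> h)" "j < dim_col (ind_rep G H \<tau> g * ind_rep G H \<tau> h)"
    then have ij: "i < ind * ?d" "j < ind * ?d" using c[of g] c[of h] by auto
    note dm = nat_div_mod_less[OF ij(1)] nat_div_mod_less[OF ij(2)]
    let ?k = "i div ?d" and ?l = "j div ?d" and ?a = "i mod ?d" and ?b = "j mod ?d"
    have tk: "ts ! ?k \<in> carrier G" "ts ! ?l \<in> carrier G" using ts_carrier dm by auto
    define E where "E a b = zero_ext (\<lambda>x. \<tau> x $$ (a, b))" for a b
    have xg: "ts ! ?k \<otimes> g \<in> carrier G" using tk g by simp
    obtain m where m: "m < ind" "ts ! ?k \<otimes> g \<otimes> inv (ts ! m) \<in> H" using ts_ex[OF xg] by blast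
    have tm: "ts ! m \<in> carrier G" using ts_carrier m by simp
    define y where "y = ts ! ?k \<otimes> g \<otimes> inv (ts ! m)"
    define z where "z = ts ! m \<otimes> h \<otimes> inv (ts ! ?l)"
    have y: "y \<in> H" and z: "z \<in> carrier G" using m tm tk h by (auto simp: y_def z_def)
    have yz: "y \<otimes> z = ts ! ?k \<otimes> (g \<otimes> h) \<otimes> inv (ts ! ?l)"
      unfolding y_def z_def using tk tm g h by (simp add: m_assoc inv_mult_cancel)
    have "(ind_rep G H \<tau> g * ind_rep G H \<tau> h) $$ (i, j) = (\<Sum>q<ind * ?d. ind_rep G H \<tau> g $$ (i, q) * ind_rep G H \<tau> h $$ (q, j))"
      by (rule mat_mult_entry[OF c c ij])
    also have "\<dots> = (\<Sum>q<ind * ?d. E ?a (q mod ?d) (ts ! ?k \<otimes> g \<otimes> inv (ts ! (q div ?d))) * E (q mod ?d) ?b (ts ! (q div ?d) \<otimes> h \<otimes> inv (ts ! ?l)))"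
      using ij by (intro sum.cong) (auto simp: ind_rep_index E_def)
    also have "\<dots> = (\<Sum>m<ind. \<Sum>c<?d. E ?a c (ts ! ?k \<otimes> g \<otimes> inv (ts ! m)) * E c ?b (ts ! m \<otimes> h \<otimes> inv (ts ! ?l)))"
      by (rule sum_div_mod)
    also have "\<dots> = (\<Sum>m<ind. if ts ! ?k \<otimes> g \<otimes> inv (ts ! m) \<in> H then
        \<Sum>c<?d. E ?a c (ts ! ?k \<otimes> g \<otimes> inv (ts ! m)) * E c ?b (ts ! m \<otimes> h \<otimes> inv (ts ! ?l)) else 0)"
      by (intro sum.cong) (auto simp: E_def zero_ext_def)
    also have "\<dots> = (\<Sum>c<?d. E ?a c y * E c ?b z)"
      unfolding sum_ts[OF xg m] y_def z_def ..
    \<comment> \<open>If \<open>z\<close> lies outside \<open>H\<close>, then so does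
      \<open>y \<otimes> z\<close>, as \<open>y\<close> is in \<open>H\<close>, and both sides are
      0.\<close>
    also have "\<dots> = E ?a ?b (y \<otimes> z)"
    proof (cases "z \<in> H")
      case True
      have "\<tau> (y \<otimes> z) = \<tau> y * \<tau> z" using tD(4)[of y z] y True by simp
      moreover have "(\<tau> y * \<tau> z) $$ (?a, ?b) = (\<Sum>c<?d. \<tau> y $$ (?a, c) * \<tau> z $$ (c, ?b))"
        using tD(3)[of y] tD(3)[of z] y True dm by (intro mat_mult_entry) auto
      ultimately show ?thesis using y True H_closed by (simp add: E_def zero_ext_def)
    next
      case False
      then show ?thesis using mult_in_H_iff[OF y z] by (simp add: E_def zero_ext_def)
    qed
    also have "\<dots> = ind_rep G H \<tau> (g \<otimes> h) $$ (i, j)"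
      using ij by (simp add: yz ind_rep_index E_def)
    finally show "ind_rep G H \<tau> (g \<otimes> h) $$ (i, j) = (ind_rep G H \<tau> g * ind_rep G H \<tau> h) $$ (i, j)" ..
  qed (use c[of g] c[of h] c[of "g \<otimes> h"] in auto)
  have cont: "continuous_map T euclidean (\<lambda>g. ind_rep G H \<tau> g $$ (i, j))" if ij: "i < ind * ?d" "j < ind * ?d" for i j
  proof -
    note dm = nat_div_mod_less[OF ij(1)] nat_div_mod_less[OF ij(2)]
    have tk: "ts ! (i div ?d) \<in> carrier G" "ts ! (j div ?d) \<in> carrier G" using ts_carrier dm by auto
    have "continuous_map T T (\<lambda>g. ts ! (i div ?d) \<otimes> g \<otimes> inv (ts ! (j div ?d)))"
      using tk by (intro continuous_mult_map continuous_map_id[unfolded id_def]) (simp_all add: topspace)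
    from continuous_map_compose[OF this continuous_zero_ext[OF tD(5)[OF dm(2,4)]]]
    show ?thesis using ij by (simp add: ind_rep_index o_def)
  qed
  show "fd_rep G T (ind_rep G H \<tau>)" "rep_dim G (ind_rep G H \<tau>) = ind * ?d"
    using fd_repI[OF pos c one mult cont] by blast+
qed

section \<open>Normalised induction of functions\<close>

definition ind_fun :: "('a \<Rightarrow> complex) \<Rightarrow> 'a \<Rightarrow> complex" where
  "ind_fun \<phi> g = (\<Sum>k<ind. zero_ext \<phi> (ts ! k \<otimes> g \<otimes> inv (ts ! k))) / of_nat ind"

text \<open>The Frobenius formula: only diagonal blocks enter the trace. The division by the index
  in \<open>ind_fun\<close> stems from normalising by \<open>ind * d\<close> in place of
  \<open>d\<close>.\<close>

lemma ch_ind: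
  assumes t: "fd_rep (G\<lparr>carrier := H\<rparr>) (subtopology T H) \<tau>" and g: "g \<in> carrier G"
  shows "ch G (ind_rep G H \<tau>) g = ind_fun (ch (G\<lparr>carrier := H\<rparr>) \<tau>) g"
proof -
  let ?d = "rep_dim (G\<lparr>carrier := H\<rparr>) \<tau>"
  have d: "0 < ?d" by (rule sub.fd_repD(1)[OF t])
  have "mat_trace (ind_rep G H \<tau> g) =
      (\<Sum>i<ind * ?d. zero_ext (\<lambda>x. \<tau> x $$ (i mod ?d, i mod ?d)) (ts ! (i div ?d) \<otimes> g \<otimes> inv (ts ! (i div ?d))))"
    unfolding mat_trace_def using ind_rep_carrier[of \<tau> g] by (auto simp: ind_rep_index intro!: sum.cong)
  also have "\<dots> = (\<Sum>k<ind. \<Sum>a<?d. zero_ext (\<lambda>x. \<tau> x $$ (a, a)) (ts ! k \<otimes> g \<otimes> inv (ts ! k)))"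
    by (rule sum_div_mod)
  also have "\<dots> = (\<Sum>k<ind. of_nat ?d * zero_ext (ch (G\<lparr>carrier := H\<rparr>) \<tau>) (ts ! k \<otimes> g \<otimes> inv (ts ! k)))"
  proof (rule sum.cong[OF refl])
    fix k
    let ?x = "ts ! k \<otimes> g \<otimes> inv (ts ! k)"
    show "(\<Sum>a<?d. zero_ext (\<lambda>x. \<tau> x $$ (a, a)) ?x) = of_nat ?d * zero_ext (ch (G\<lparr>carrier := H\<rparr>) \<tau>) ?x"
      using sub.fd_repD(3)[OF t, of ?x] d by (auto simp: zero_ext_def ch_def mat_trace_def)
  qed
  finally show ?thesis
    using g d by (simp add: ch_eq fd_rep_ind(2)[OF t] ind_fun_def sum_distrib_left[symmetric])
qed

lemma ind_fun_cong:
  assumes "\<And>h. h \<in> H \<Longrightarrow> \<phi> h = \<theta> h"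
  shows "ind_fun \<phi> g = ind_fun \<theta> g"
  unfolding ind_fun_def using assms by (auto simp: zero_ext_def intro!: sum.cong arg_cong2[where f = "(/)"])

lemma ind_fun_add: "ind_fun (\<lambda>h. \<phi> h + \<theta> h) g = ind_fun \<phi> g + ind_fun \<theta> g"
proof -
  have "zero_ext (\<lambda>h. \<phi> h + \<theta> h) x = zero_ext \<phi> x + zero_ext \<theta> x" for x by (simp add: zero_ext_def)
  then show ?thesis by (simp add: ind_fun_def sum.distrib add_divide_distrib)
qed

lemma ind_fun_cmult: "ind_fun (\<lambda>h. c * \<phi> h) g = c * ind_fun \<phi> g"
proof -
  have "zero_ext (\<lambda>h. c * \<phi> h) x = c * zero_ext \<phi> x" for x by (simp add: zero_ext_def)
  then show ?thesis by (simp add: ind_fun_def sum_distrib_left)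
qed

lemma ind_fun_sum:
  "ind_fun (\<lambda>h. \<Sum>i\<in>A. f i h) g = (\<Sum>i\<in>A. ind_fun (f i) g)"
proof (induction A rule: infinite_finite_induct)
  case (insert a A)
  then show ?case by (simp add: ind_fun_add)
qed (simp_all add: ind_fun_def zero_ext_def)

text \<open>The projection formula: all conjugates of \<open>g\<close> carry the same value of
  \<open>f\<close>, which can therefore be taken out of the sum.\<close>

lemma ind_fun_mult_class_fun:
  assumes g: "g \<in> carrier G" and f: "\<And>s. s \<in> carrier G \<Longrightarrow> f (s \<otimes> g \<otimes> inv s) = f g"
  shows "ind_fun (\<lambda>h. \<phi> h * f h) g = ind_fun \<phi> g * f g"
proof -
  have "(\<Sum>k<ind. zero_ext (\<lambda>h. \<phi> h * f h) (ts ! k \<otimes> g \<otimes> inv (ts ! k))) =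
      (\<Sum>k<ind. zero_ext \<phi> (ts ! k \<otimes> g \<otimes> inv (ts ! k)) * f g)"
    using f ts_carrier by (intro sum.cong) (auto simp: zero_ext_def)
  then show ?thesis by (simp add: ind_fun_def sum_distrib_right)
qed

text \<open>Conjugates of \<open>g\<close> outside \<open>H\<close> contribute 0 to both sides, so
  constancy is asked only on those inside. For characters of \<open>H\<close> this is precisely
  admissibility.\<close>

lemma ind_fun_invariant:
  assumes "\<And>s. s \<in> carrier G \<Longrightarrow> s \<otimes> g \<otimes> inv s \<in> H \<Longrightarrow> \<phi> (s \<otimes> g \<otimes> inv s) = \<phi> g"
  shows "ind_fun \<phi> g = \<phi> g * ind_fun (\<lambda>_. 1) g"
proof -
  have "(\<Sum>k<ind. zero_ext \<phi> (ts ! k \<otimes> g \<otimes> inv (ts ! k))) =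
      (\<Sum>k<ind. \<phi> g * zero_ext (\<lambda>_. 1) (ts ! k \<otimes> g \<otimes> inv (ts ! k)))"
    using assms ts_carrier by (intro sum.cong) (auto simp: zero_ext_def)
  then show ?thesis by (simp add: ind_fun_def sum_distrib_left)
qed

text \<open>Inversion commutes with conjugation and preserves \<open>H\<close>; this makes induction
  compatible with the involution.\<close>

lemma ind_fun_inv:
  assumes g: "g \<in> carrier G" and \<phi>: "\<And>h. h \<in> H \<Longrightarrow> \<phi> h = \<theta> (inv h)"
  shows "ind_fun \<phi> g = ind_fun \<theta> (inv g)"
proof -
  have "zero_ext \<phi> (ts ! k \<otimes> g \<otimes> inv (ts ! k)) = zero_ext \<theta> (ts ! k \<otimes> inv g \<otimes> inv (ts ! k))" if "k < ind" for k
  proof -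
    let ?x = "ts ! k \<otimes> g \<otimes> inv (ts ! k)"
    have x: "?x \<in> carrier G" using ts_carrier[OF that] g by simp
    have e: "ts ! k \<otimes> inv g \<otimes> inv (ts ! k) = inv ?x"
      using ts_carrier[OF that] g by (simp add: inv_mult_group m_assoc)
    have "?x \<in> H \<longleftrightarrow> inv ?x \<in> H" using H_closed(2) inv_inv[OF x] by metis
    then show ?thesis unfolding e by (simp add: zero_ext_def \<phi>)
  qed
  then show ?thesis by (simp add: ind_fun_def)
qed

text \<open>The sum counts the representatives that conjugate \<open>g\<close> into
  \<open>H\<close>. The representative of the coset \<open>H\<close> itself lies in \<open>H\<close>
  and is always among them.\<close>

lemma ind_fun_one_nonzero:
  assumes g: "g \<in> H"
  shows "ind_fun (\<lambda>_. 1) g \<noteq> 0"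
proof -
  obtain k where k: "k < ind" "\<one> \<otimes> inv (ts ! k) \<in> H" using ts_ex[OF one_closed] by blast
  have tc: "ts ! k \<in> carrier G" by (rule ts_carrier[OF k(1)])
  then have tH: "ts ! k \<in> H" using H_closed(2)[OF k(2)] by simp
  define S where "S = {k \<in> {..<ind}. ts ! k \<otimes> g \<otimes> inv (ts ! k) \<in> H}"
  have S: "finite S" "k \<in> S" using k(1) tH g H_closed by (auto simp: S_def)
  have "(\<Sum>k<ind. zero_ext (\<lambda>_. 1) (ts ! k \<otimes> g \<otimes> inv (ts ! k))) = of_nat (card S)"
    unfolding zero_ext_def S_def by (subst sum.inter_filter[symmetric]) simp_all
  moreover have "card S \<noteq> 0" using S by (simp only: card_eq_0_iff) blast
  ultimately show ?thesis unfolding ind_fun_def using ind_pos by simp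
qed

section \<open>Restriction of representations and of means\<close>

lemma fd_rep_res:
  assumes "fd_rep G T \<pi>"
  shows "fd_rep (G\<lparr>carrier := H\<rparr>) (subtopology T H) (res_rep H \<pi>)"
    and "h \<in> H \<Longrightarrow> ch (G\<lparr>carrier := H\<rparr>) (res_rep H \<pi>) h = ch G \<pi> h"
proof -
  let ?n = "rep_dim G \<pi>"
  note p = fd_repD[OF assms]
  have cont: "continuous_map (subtopology T H) euclidean (\<lambda>g. res_rep H \<pi> g $$ (i, j))" if "i < ?n" "j < ?n" for i j
    using continuous_map_from_subtopology[OF p(5)[OF that], of H]
    by (rule continuous_map_eq) (simp add: res_rep_def)
  have "fd_rep (G\<lparr>carrier := H\<rparr>) (subtopology T H) (res_rep H \<pi>) \<and> rep_dim (G\<lparr>carrier := H\<rparr>) (res_rep H \<pi>) = ?n"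
    by (intro conjI sub.fd_repI[OF p(1) _ _ _ cont])
      (auto simp: res_rep_def H_closed p(2) H_subset p(3) p(4))
  then show "fd_rep (G\<lparr>carrier := H\<rparr>) (subtopology T H) (res_rep H \<pi>)"
    "h \<in> H \<Longrightarrow> ch (G\<lparr>carrier := H\<rparr>) (res_rep H \<pi>) h = ch G \<pi> h"
    using H_subset by (auto simp: ch_def res_rep_def)
qed

text \<open>
  The mean on \<open>G\<close> restricts to the open subgroup \<open>t\<^sub>k\<^sup>-\<^sup>1 H t\<^sub>k\<close>; transported to \<open>H\<close> and rescaled by the
  index it is an invariant mean there.
\<close>

lemma conjugate_mean:
  assumes M: "invariant_mean G F M" and k: "k < ind"
    and one: "(\<lambda>g. zero_ext (\<lambda>_. 1) (ts ! k \<otimes> g \<otimes> inv (ts ! k))) \<in> F"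
  defines "E \<equiv> \<lambda>f g. zero_ext f (ts ! k \<otimes> g \<otimes> inv (ts ! k))"
  shows "invariant_mean (G\<lparr>carrier := H\<rparr>) {f. E f \<in> F} (\<lambda>f. of_nat ind * M (E f))"
proof -
  let ?t = "ts ! k"
  have t: "?t \<in> carrier G" by (rule ts_carrier[OF k])
  have oneF: "E (\<lambda>_. 1) \<in> F" using one by (simp add: E_def)
  \<comment> \<open>The translates of the indicator of \<open>inv ?t H ?t\<close> by the elements
    \<open>inv ?t \<otimes> ts ! l\<close> add up to 1. By invariance the indicator has mean
    \<open>1 / ind\<close>, which explains the scaling factor.\<close>
  have M1: "of_nat ind * M (E (\<lambda>_. 1)) = 1"
  proof -
    have hc: "inv ?t \<otimes> ts ! l \<in> carrier G" if "l < ind" for l using t ts_carrier[OF that] by simp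
    have "of_nat ind * M (E (\<lambda>_. 1)) = (\<Sum>l<ind. M (\<lambda>x. E (\<lambda>_. 1) (inv ?t \<otimes> ts ! l \<otimes> x)))"
      using invariant_mean_translate(2)[OF M oneF hc] by simp
    also have "\<dots> = M (\<lambda>x. \<Sum>l<ind. E (\<lambda>_. 1) (inv ?t \<otimes> ts ! l \<otimes> x))"
      using invariant_mean_translate(1)[OF M oneF hc] by (intro invariant_mean_sum(2)[OF M, symmetric]) simp
    also have "\<dots> = M (\<lambda>_. 1)"
    proof (rule invariant_mean_cong(2)[OF M])
      show "(\<lambda>_. 1) \<in> F" by (rule invariant_mean_const(1)[OF M])
      fix x assume x: "x \<in> carrier G"
      define y where "y = x \<otimes> inv ?t"
      have y: "y \<in> carrier G" using x t by (simp add: y_def)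
      obtain m where m: "m < ind" "inv y \<otimes> inv (ts ! m) \<in> H" using ts_ex[of "inv y"] y by auto
      have "E (\<lambda>_. 1) (inv ?t \<otimes> ts ! l \<otimes> x) = (if inv y \<otimes> inv (ts ! l) \<in> H then 1 else 0)" if l: "l < ind" for l
      proof -
        have tl: "ts ! l \<in> carrier G" by (rule ts_carrier[OF l])
        have "?t \<otimes> (inv ?t \<otimes> ts ! l \<otimes> x) \<otimes> inv ?t = ts ! l \<otimes> y"
          unfolding y_def using t tl x by (simp add: m_assoc mult_inv_cancel)
        moreover have "inv (ts ! l \<otimes> y) = inv y \<otimes> inv (ts ! l)" using tl y by (simp add: inv_mult_group)
        moreover have "ts ! l \<otimes> y \<in> H \<longleftrightarrow> inv (ts ! l \<otimes> y) \<in> H"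
          using H_closed(2) inv_inv[of "ts ! l \<otimes> y"] tl y by (metis m_closed)
        ultimately show ?thesis by (simp add: E_def zero_ext_def)
      qed
      then have "(\<Sum>l<ind. E (\<lambda>_. 1) (inv ?t \<otimes> ts ! l \<otimes> x)) = (\<Sum>l<ind. if inv y \<otimes> inv (ts ! l) \<in> H then 1 else 0)"
        by (intro sum.cong) auto
      also have "\<dots> = 1" using sum_ts[OF _ m, of "\<lambda>_. 1"] y by simp
      finally show "1 = (\<Sum>l<ind. E (\<lambda>_. 1) (inv ?t \<otimes> ts ! l \<otimes> x))" by simp
    qed
    also have "\<dots> = 1" by (rule invariant_mean_const(2)[OF M])
    finally show ?thesis .
  qed
  have Eadd: "E (\<lambda>x. f x + f' x) = (\<lambda>g. E f g + E f' g)" for f f' by (auto simp: E_def zero_ext_def)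
  have Emult: "E (\<lambda>x. c * f x) = (\<lambda>g. c * E f g)" for c f by (auto simp: E_def zero_ext_def)
  show ?thesis
    unfolding invariant_mean_def
  proof (intro conjI allI ballI impI)
    fix c
    have Ec: "E (\<lambda>_. c) = (\<lambda>g. c * E (\<lambda>_. 1) g)" using Emult[of c "\<lambda>_. 1"] by simp
    show "(\<lambda>_. c) \<in> {f. E f \<in> F}" "of_nat ind * M (E (\<lambda>_. c)) = c"
      using invariant_mean_cmult[OF M oneF, of c] M1 unfolding mem_Collect_eq Ec by (simp_all add: mult.left_commute)
  next
    fix f f' assume "f \<in> {f. E f \<in> F}" "f' \<in> {f. E f \<in> F}"
    then have "E f \<in> F" "E f' \<in> F" by auto
    note * = invariant_mean_add[OF M this]
    show "(\<lambda>x. f x + f' x) \<in> {f. E f \<in> F}"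
      "of_nat ind * M (E (\<lambda>x. f x + f' x)) = of_nat ind * M (E f) + of_nat ind * M (E f')"
      using * unfolding mem_Collect_eq Eadd by (simp_all add: distrib_left)
  next
    fix f c assume "f \<in> {f. E f \<in> F}"
    then have "E f \<in> F" by simp
    note * = invariant_mean_cmult[OF M this, of c]
    show "(\<lambda>x. c * f x) \<in> {f. E f \<in> F}" "of_nat ind * M (E (\<lambda>x. c * f x)) = c * (of_nat ind * M (E f))"
      using * unfolding mem_Collect_eq Emult by simp_all
  next
    fix f h assume f: "f \<in> {f. E f \<in> F}" and "h \<in> carrier (G\<lparr>carrier := H\<rparr>)"
    then have h: "h \<in> H" and fF: "E f \<in> F" by auto
    \<comment> \<open>Left translation by \<open>h\<close> on \<open>H\<close> corresponds to left
      translation by this conjugate of \<open>h\<close> on \<open>G\<close>.\<close>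
    have hc: "inv ?t \<otimes> h \<otimes> ?t \<in> carrier G" using t h H_subset by simp
    have eq: "E f (inv ?t \<otimes> h \<otimes> ?t \<otimes> x) = E (\<lambda>x. f (h \<otimes>\<^bsub>G\<lparr>carrier := H\<rparr>\<^esub> x)) x" if x: "x \<in> carrier G" for x
    proof -
      have e: "?t \<otimes> (inv ?t \<otimes> h \<otimes> ?t \<otimes> x) \<otimes> inv ?t = h \<otimes> (?t \<otimes> x \<otimes> inv ?t)"
        using t x H_subset[OF h] by (simp add: m_assoc mult_inv_cancel)
      have "?t \<otimes> x \<otimes> inv ?t \<in> carrier G" using t x by simp
      then show ?thesis unfolding E_def e zero_ext_def using mult_in_H_iff[OF h] by simp
    qed
    note 1 = invariant_mean_translate[OF M fF hc]
    note 2 = invariant_mean_cong[OF M 1(1) eq]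
    show "(\<lambda>x. f (h \<otimes>\<^bsub>G\<lparr>carrier := H\<rparr>\<^esub> x)) \<in> {f. E f \<in> F}" using 2(1) by simp
    show "of_nat ind * M (E (\<lambda>x. f (h \<otimes>\<^bsub>G\<lparr>carrier := H\<rparr>\<^esub> x))) = of_nat ind * M (E f)" using 2(2) 1(2) by simp
  next
    fix f f' assume f: "f \<in> {f. E f \<in> F}" and "\<forall>x\<in>carrier (G\<lparr>carrier := H\<rparr>). f x = f' x"
    then have "E f = E f'" by (auto simp: E_def zero_ext_def)
    then show "f' \<in> {f. E f \<in> F}" "of_nat ind * M (E f') = of_nat ind * M (E f)" using f by auto
  qed
qed

end

section \<open>The hypergroup of an admissible pair\<close>

definition point_fun :: "'a point \<Rightarrow> mark \<Rightarrow> 'a \<Rightarrow> complex" where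
  "point_fun = (\<lambda>(\<psi>, s') s g. if s = s' then \<psi> g else 0)"

text \<open>
  The linear map sending \<open>\<delta>\<^sub>x\<close> to the character \<open>x\<close>. It is injective on finitely supported
  measures and turns the convolution into the product \<open>pair_mult\<close> of pairs of functions below.
\<close>

definition measure_fun :: "('a point \<Rightarrow> real) \<Rightarrow> mark \<Rightarrow> 'a \<Rightarrow> complex" where
  "measure_fun \<mu> s g = (\<Sum>z | \<mu> z \<noteq> 0. of_real (\<mu> z) * point_fun z s g)"

lemma measure_fun_superset:
  assumes "finite S" "{z. \<mu> z \<noteq> 0} \<subseteq> S"
  shows "measure_fun \<mu> s g = (\<Sum>z\<in>S. of_real (\<mu> z) * point_fun z s g)"
  unfolding measure_fun_def using assms by (intro sum.mono_neutral_left) auto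

lemma sum_point_fun:
  assumes "finite S"
  shows "(\<Sum>z\<in>S. f z * point_fun z s g) = (\<Sum>\<psi> | (\<psi>, s) \<in> S. f (\<psi>, s) * \<psi> g)"
proof -
  have "(\<Sum>z\<in>S. f z * point_fun z s g) = (\<Sum>z\<in>(\<lambda>\<psi>. (\<psi>, s)) ` {\<psi>. (\<psi>, s) \<in> S}. f z * point_fun z s g)"
  proof (intro sum.mono_neutral_right assms ballI)
    fix z assume z: "z \<in> S - (\<lambda>\<psi>. (\<psi>, s)) ` {\<psi>. (\<psi>, s) \<in> S}"
    obtain \<psi> s' where zz: "z = (\<psi>, s')" by force
    have "s \<noteq> s'" using z by (auto simp: zz)
    then show "f z * point_fun z s g = 0" by (simp add: zz point_fun_def)
  qed auto
  also have "\<dots> = (\<Sum>\<psi> | (\<psi>, s) \<in> S. f (\<psi>, s) * \<psi> g)"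
    by (subst sum.reindex) (auto simp: inj_on_def point_fun_def)
  finally show ?thesis .
qed

lemma finite_mark_section: "finite S \<Longrightarrow> finite {\<psi>. (\<psi>, s) \<in> S}"
  by (rule finite_subset[of _ "fst ` S"]) force+

text \<open>Stated for one group and an arbitrary ambient set, to serve \<open>G\<close> with
  \<open>Circ\<close> and \<open>H\<close> with \<open>Bullet\<close> alike.\<close>

lemma (in compact_grp) marked_char_measure:
  assumes s: "fd_rep G T \<sigma>" and \<phi>: "ch G \<sigma> = \<phi>" and K: "\<And>\<psi>. \<psi> \<in> irr_chars G T \<Longrightarrow> (\<psi>, s) \<in> K"
  defines "m \<equiv> marked_measure (char_measure G T \<phi>) s"
  shows "fin_prob_measure K m" "g \<in> carrier G \<Longrightarrow> measure_fun m s g = \<phi> g"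
    "s' \<noteq> s \<Longrightarrow> measure_fun m s' g = 0"
proof -
  let ?\<mu> = "char_measure G T \<phi>"
  note cm = char_measure[OF s \<phi>]
  have supp: "{z. m z \<noteq> 0} = (\<lambda>\<psi>. (\<psi>, s)) ` {\<psi>. ?\<mu> \<psi> \<noteq> 0}"
    by (auto simp: m_def marked_measure_def split: if_splits)
  have m: "m (\<psi>, s) = ?\<mu> \<psi>" for \<psi> by (simp add: m_def marked_measure_def)
  have inj: "inj_on (\<lambda>\<psi>. (\<psi>, s)) A" for A by (auto simp: inj_on_def)
  have sum: "(\<Sum>z | m z \<noteq> 0. f z) = (\<Sum>\<psi> | ?\<mu> \<psi> \<noteq> 0. f (\<psi>, s))" for f :: "_ \<Rightarrow> 'z :: comm_monoid_add"
    unfolding supp by (simp add: sum.reindex[OF inj])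
  show "fin_prob_measure K m"
    unfolding fin_prob_measure_def
  proof (intro conjI allI)
    show "0 \<le> m z" for z using cm(1) by (auto simp: m_def marked_measure_def split: prod.split)
    show "{z. m z \<noteq> 0} \<subseteq> K" unfolding supp using cm(2) K by blast
    show "finite {z. m z \<noteq> 0}" unfolding supp using cm(3) by (rule finite_imageI)
    show "(\<Sum>z | m z \<noteq> 0. m z) = 1" unfolding sum m by (rule cm(4))
  qed
  show "measure_fun m s g = \<phi> g" if "g \<in> carrier G"
    unfolding measure_fun_def sum m using cm(5)[OF that] by (simp add: point_fun_def)
  show "measure_fun m s' g = 0" if "s' \<noteq> s"
    unfolding measure_fun_def sum m using that by (simp add: point_fun_def)
qed

section \<open>The convolution as a product of pairs of functions\<close>

context compact_pair
begin

abbreviation "HG \<equiv> G\<lparr>carrier := H\<rparr>"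
abbreviation "HT \<equiv> subtopology T H"
abbreviation "K \<equiv> dual_union G T H"
abbreviation "conv \<equiv> dual_conv G T H"

definition mark_dom :: "mark \<Rightarrow> 'a set" where
  "mark_dom s = (case s of Circ \<Rightarrow> carrier G | Bullet \<Rightarrow> H)"

lemma mark_dom_simps [simp]: "mark_dom Circ = carrier G" "mark_dom Bullet = H"
  by (simp_all add: mark_dom_def)

lemma dual_union_Circ: "(\<psi>, Circ) \<in> K \<longleftrightarrow> \<psi> \<in> irr_chars G T"
  and dual_union_Bullet: "(\<psi>, Bullet) \<in> K \<longleftrightarrow> \<psi> \<in> irr_chars HG HT"
  by (auto simp: dual_union_def irr_chars_def)

lemma dual_union_cases:
  assumes "x \<in> K"
  obtains (Circ) \<pi> where "x = (ch G \<pi>, Circ)" "irr_rep G T \<pi>"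
    | (Bullet) \<tau> where "x = (ch HG \<tau>, Bullet)" "irr_rep HG HT \<tau>"
  using assms unfolding dual_union_def by blast

text \<open>The two marks separate; in each component the difference of the measures is a vanishing
  combination of finitely many irreducible characters of the respective group.\<close>

lemma measure_fun_inject:
  assumes \<mu>: "finite {z. \<mu> z \<noteq> 0}" "{z. \<mu> z \<noteq> 0} \<subseteq> K"
    and \<nu>: "finite {z. \<nu> z \<noteq> 0}" "{z. \<nu> z \<noteq> 0} \<subseteq> K"
    and eq: "\<And>s g. g \<in> mark_dom s \<Longrightarrow> measure_fun \<mu> s g = measure_fun \<nu> s g"
  shows "\<mu> = \<nu>"
proof
  fix z :: "'a point"
  let ?S = "{z. \<mu> z \<noteq> 0} \<union> {z. \<nu> z \<noteq> 0}"
  obtain \<psi>\<^sub>0 s where z: "z = (\<psi>\<^sub>0, s)" by force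
  let ?A = "{\<psi>. (\<psi>, s) \<in> ?S}"
  have fin: "finite ?S" using \<mu> \<nu> by simp
  have finA: "finite ?A" by (rule finite_mark_section[OF fin])
  have 0: "(\<Sum>\<psi>\<in>?A. of_real (\<mu> (\<psi>, s) - \<nu> (\<psi>, s)) * \<psi> g) = (0 :: complex)" if g: "g \<in> mark_dom s" for g
  proof -
    have "measure_fun \<mu> s g = (\<Sum>\<psi>\<in>?A. of_real (\<mu> (\<psi>, s)) * \<psi> g)"
      by (rule trans[OF measure_fun_superset[OF fin Un_upper1] sum_point_fun[OF fin]])
    moreover have "measure_fun \<nu> s g = (\<Sum>\<psi>\<in>?A. of_real (\<nu> (\<psi>, s)) * \<psi> g)"
      by (rule trans[OF measure_fun_superset[OF fin Un_upper2] sum_point_fun[OF fin]])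
    ultimately show ?thesis using eq[OF g] by (simp add: left_diff_distrib sum_subtractf)
  qed
  show "\<mu> z = \<nu> z"
  proof (cases "z \<in> ?S")
    case True
    then have A: "\<psi>\<^sub>0 \<in> ?A" by (simp add: z)
    have "complex_of_real (\<mu> (\<psi>\<^sub>0, s) - \<nu> (\<psi>\<^sub>0, s)) = 0"
    proof (cases s)
      case Circ
      have "?A \<subseteq> irr_chars G T" using \<mu>(2) \<nu>(2) dual_union_Circ Circ by blast
      note indep = irr_chars_independent[OF finA this _ A, where a = "\<lambda>\<psi>. complex_of_real (\<mu> (\<psi>, s) - \<nu> (\<psi>, s))"]
      show ?thesis by (rule indep, rule 0) (simp add: Circ)
    next
      case Bullet
      have "?A \<subseteq> irr_chars HG HT" using \<mu>(2) \<nu>(2) dual_union_Bullet Bullet by blast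
      note indep = sub.irr_chars_independent[OF finA this _ A, where a = "\<lambda>\<psi>. complex_of_real (\<mu> (\<psi>, s) - \<nu> (\<psi>, s))"]
      show ?thesis by (rule indep, rule 0) (simp add: Bullet)
    qed
    then show ?thesis by (simp only: z of_real_eq_0_iff right_minus_eq)
  qed simp
qed

definition pair_mult :: "(mark \<Rightarrow> 'a \<Rightarrow> complex) \<Rightarrow> (mark \<Rightarrow> 'a \<Rightarrow> complex) \<Rightarrow> mark \<Rightarrow> 'a \<Rightarrow> complex" where
  "pair_mult u v s g = (case s of
     Circ \<Rightarrow> u Circ g * v Circ g + ind_fun (\<lambda>h. u Bullet h * v Bullet h) g
   | Bullet \<Rightarrow> u Circ g * v Bullet g + u Bullet g * v Circ g)"

lemma pair_mult_simps:
  "pair_mult u v Circ g = u Circ g * v Circ g + ind_fun (\<lambda>h. u Bullet h * v Bullet h) g"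
  "pair_mult u v Bullet g = u Circ g * v Bullet g + u Bullet g * v Circ g"
  by (simp_all add: pair_mult_def)

lemma pair_mult_commute: "pair_mult u v = pair_mult v u"
proof (intro ext)
  fix s g show "pair_mult u v s g = pair_mult v u s g"
    by (cases s) (simp_all add: pair_mult_simps mult.commute)
qed

text \<open>Induction evaluates its argument on \<open>H\<close> only, and \<open>H\<close> lies in
  the carrier, so agreement on \<open>mark_dom\<close> suffices.\<close>

lemma pair_mult_cong:
  assumes "\<And>s g. g \<in> mark_dom s \<Longrightarrow> u s g = u' s g" "g \<in> mark_dom s"
  shows "pair_mult u v s g = pair_mult u' v s g"
proof (cases s)
  case Circ
  have "ind_fun (\<lambda>h. u Bullet h * v Bullet h) g = ind_fun (\<lambda>h. u' Bullet h * v Bullet h) g"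
    using assms(1)[of _ Bullet] by (intro ind_fun_cong) simp
  then show ?thesis using assms(1)[of g Circ] assms(2) Circ by (simp add: pair_mult_simps)
next
  case Bullet
  then show ?thesis using assms(1)[of g Circ] assms(1)[of g Bullet] assms(2) H_subset by (simp add: pair_mult_simps)
qed

lemma pair_mult_sum:
  "pair_mult (\<lambda>s g. \<Sum>i\<in>A. a i * u i s g) v s g = (\<Sum>i\<in>A. a i * pair_mult (u i) v s g)"
proof (cases s)
  case Circ
  have "ind_fun (\<lambda>h. (\<Sum>i\<in>A. a i * u i Bullet h) * v Bullet h) g =
      ind_fun (\<lambda>h. \<Sum>i\<in>A. a i * (u i Bullet h * v Bullet h)) g"
    by (intro ind_fun_cong) (simp add: sum_distrib_right mult.assoc)
  also have "\<dots> = (\<Sum>i\<in>A. a i * ind_fun (\<lambda>h. u i Bullet h * v Bullet h) g)"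
    unfolding ind_fun_sum ind_fun_cmult ..
  finally show ?thesis
    using Circ by (simp add: pair_mult_simps sum_distrib_right sum.distrib distrib_left mult.assoc)
next
  case Bullet
  then show ?thesis by (simp add: pair_mult_simps sum_distrib_right sum.distrib distrib_left mult.assoc)
qed

lemma ind_fun_zero: "ind_fun (\<lambda>_. 0) g = 0"
  by (simp add: ind_fun_def zero_ext_def)

lemma rep_of_irr:
  assumes "irr_rep G T \<pi>"
  shows "irr_rep G T (rep_of G T (ch G \<pi>))" "ch G (rep_of G T (ch G \<pi>)) = ch G \<pi>"
  using someI[of "\<lambda>\<rho>. irr_rep G T \<rho> \<and> ch G \<rho> = ch G \<pi>" \<pi>] assms unfolding rep_of_def by auto

lemma rep_of_irr_sub:
  assumes "irr_rep HG HT \<pi>"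
  shows "irr_rep HG HT (rep_of HG HT (ch HG \<pi>))" "ch HG (rep_of HG HT (ch HG \<pi>)) = ch HG \<pi>"
  using someI[of "\<lambda>\<rho>. irr_rep HG HT \<rho> \<and> ch HG \<rho> = ch HG \<pi>" \<pi>] assms unfolding rep_of_def by auto

text \<open>In each of the four cases the convolution is the measure of an actual representation,
  whose character is computed. Associativity then becomes a question about \<open>pair_mult\<close>
  only.\<close>

lemma conv_measure:
  assumes x: "x \<in> K" and y: "y \<in> K"
  shows "fin_prob_measure K (conv x y)"
    and "g \<in> mark_dom s \<Longrightarrow> measure_fun (conv x y) s g = pair_mult (point_fun x) (point_fun y) s g"
proof -
  have KC: "(\<psi>, Circ) \<in> K" if "\<psi> \<in> irr_chars G T" for \<psi> using that dual_union_Circ by blast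
  have KB: "(\<psi>, Bullet) \<in> K" if "\<psi> \<in> irr_chars HG HT" for \<psi> using that dual_union_Bullet by blast
  have "fin_prob_measure K (conv x y) \<and>
    (\<forall>s g. g \<in> mark_dom s \<longrightarrow> measure_fun (conv x y) s g = pair_mult (point_fun x) (point_fun y) s g)"
    using x
  proof (cases rule: dual_union_cases)
    case x: (Circ \<pi>)
    show ?thesis using y
    proof (cases rule: dual_union_cases)
      case y: (Circ \<pi>')
      note fd = irr_rep_fd[OF x(2)] irr_rep_fd[OF y(2)]
      note mc = marked_char_measure[OF fd_rep_tensor(1)[OF fd] ch_tensor[OF fd], where s = Circ and K = K, OF KC]
      have "measure_fun (conv x y) s g = pair_mult (point_fun x) (point_fun y) s g" if "g \<in> mark_dom s" for s g
        using mc(2)[of g] mc(3)[of Bullet g] that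
        by (cases s) (simp_all add: x y pair_mult_simps point_fun_def ind_fun_zero)
      then show ?thesis using mc(1) by (simp add: x y)
    next
      case y: (Bullet \<tau>)
      \<comment> \<open>\<open>rep_of\<close> may select another representation with the character
        of \<open>\<pi>\<close>; its restriction still has the restricted character.\<close>
      let ?\<rho> = "res_rep H (rep_of G T (ch G \<pi>))"
      note r = rep_of_irr[OF x(2)]
      note fd = fd_rep_res(1)[OF irr_rep_fd[OF r(1)]] sub.irr_rep_fd[OF y(2)]
      have res: "ch HG ?\<rho> h = ch G \<pi> h" if "h \<in> H" for h using fd_rep_res(2)[OF irr_rep_fd[OF r(1)] that] r(2) by simp
      note mc = sub.marked_char_measure[OF sub.fd_rep_tensor(1)[OF fd] sub.ch_tensor[OF fd], where s = Bullet and K = K, OF KB]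
      have "measure_fun (conv x y) s g = pair_mult (point_fun x) (point_fun y) s g" if "g \<in> mark_dom s" for s g
        using mc(2)[of g] mc(3)[of Circ g] that res
        by (cases s) (simp_all add: x y pair_mult_simps point_fun_def ind_fun_zero)
      then show ?thesis using mc(1) by (simp add: x y)
    qed
  next
    case x: (Bullet \<tau>)
    show ?thesis using y
    proof (cases rule: dual_union_cases)
      case y: (Circ \<pi>)
      let ?\<rho> = "res_rep H (rep_of G T (ch G \<pi>))"
      note r = rep_of_irr[OF y(2)]
      note fd = sub.irr_rep_fd[OF x(2)] fd_rep_res(1)[OF irr_rep_fd[OF r(1)]]
      have res: "ch HG ?\<rho> h = ch G \<pi> h" if "h \<in> H" for h using fd_rep_res(2)[OF irr_rep_fd[OF r(1)] that] r(2) by simp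
      note mc = sub.marked_char_measure[OF sub.fd_rep_tensor(1)[OF fd] sub.ch_tensor[OF fd], where s = Bullet and K = K, OF KB]
      have "measure_fun (conv x y) s g = pair_mult (point_fun x) (point_fun y) s g" if "g \<in> mark_dom s" for s g
        using mc(2)[of g] mc(3)[of Circ g] that res
        by (cases s) (simp_all add: x y pair_mult_simps point_fun_def ind_fun_zero)
      then show ?thesis using mc(1) by (simp add: x y)
    next
      case y: (Bullet \<tau>')
      note r = rep_of_irr_sub[OF x(2)] rep_of_irr_sub[OF y(2)]
      note fd = sub.irr_rep_fd[OF r(1)] sub.irr_rep_fd[OF r(3)]
      note ft = sub.fd_rep_tensor(1)[OF fd]
      have ch: "ch G (ind_rep G H (tensor_rep (rep_of HG HT (ch HG \<tau>)) (rep_of HG HT (ch HG \<tau>')))) g =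
          ind_fun (\<lambda>h. ch HG \<tau> h * ch HG \<tau>' h) g" if "g \<in> carrier G" for g
        unfolding ch_ind[OF ft that] by (rule ind_fun_cong) (simp add: sub.ch_tensor[OF fd] r)
      note mc = marked_char_measure[OF fd_rep_ind(1)[OF ft] refl, where s = Circ and K = K, OF KC]
      have "measure_fun (conv x y) s g = pair_mult (point_fun x) (point_fun y) s g" if "g \<in> mark_dom s" for s g
        using mc(2)[of g] mc(3)[of Bullet g] that ch
        by (cases s) (simp_all add: x y pair_mult_simps point_fun_def)
      then show ?thesis using mc(1) by (simp add: x y)
    qed
  qed
  then show "fin_prob_measure K (conv x y)"
    "g \<in> mark_dom s \<Longrightarrow> measure_fun (conv x y) s g = pair_mult (point_fun x) (point_fun y) s g" by auto
qed

lemma conv_support: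
  assumes "x \<in> K" "y \<in> K"
  shows "finite {z. conv x y z \<noteq> 0}" "{z. conv x y z \<noteq> 0} \<subseteq> K"
  using conv_measure(1)[OF assms] unfolding fin_prob_measure_def by auto

lemma conv_commute:
  assumes "x \<in> K" "y \<in> K" shows "conv x y = conv y x"
  by (rule measure_fun_inject[OF conv_support[OF assms] conv_support[OF assms(2,1)]])
    (simp add: conv_measure(2) assms pair_mult_commute)

text \<open>\<open>L\<close> is the measure of the triple product bracketed to the left. Since
  \<open>measure_fun\<close> is linear and multiplicative on points, it carries \<open>L\<close> to
  the product of the three pairs.\<close>

lemma triple_conv:
  assumes K: "x \<in> K" "y \<in> K" "z \<in> K"
  defines "L \<equiv> \<lambda>t. \<Sum>w | conv x y w \<noteq> 0. conv x y w * conv w z t"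
  shows "finite {t. L t \<noteq> 0}" "{t. L t \<noteq> 0} \<subseteq> K"
    "g \<in> mark_dom s \<Longrightarrow> measure_fun L s g = pair_mult (pair_mult (point_fun x) (point_fun y)) (point_fun z) s g"
proof -
  let ?W = "{w. conv x y w \<noteq> 0}"
  \<comment> \<open>One finite set supporting all the measures \<open>conv w z\<close> that occur,
    so that the double sum can be exchanged.\<close>
  define U where "U = (\<Union>w\<in>?W. {t. conv w z t \<noteq> 0})"
  note W = conv_support[OF K(1,2)]
  have w: "w \<in> K" if "w \<in> ?W" for w using that W by blast
  have U: "finite U" "U \<subseteq> K"
    using W(1) conv_support[OF w K(3)] unfolding U_def by blast+
  have sub: "{t. L t \<noteq> 0} \<subseteq> U"
  proof
    fix t assume "t \<in> {t. L t \<noteq> 0}"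
    then have "(\<Sum>w\<in>?W. conv x y w * conv w z t) \<noteq> 0" by (simp add: L_def)
    then obtain w where "w \<in> ?W" "conv x y w * conv w z t \<noteq> 0" by (meson sum.not_neutral_contains_not_neutral)
    then show "t \<in> U" unfolding U_def by (intro UN_I[of w]) auto
  qed
  show "finite {t. L t \<noteq> 0}" "{t. L t \<noteq> 0} \<subseteq> K" using finite_subset[OF sub U(1)] sub U(2) by blast+
  assume g: "g \<in> mark_dom s"
  have "measure_fun L s g = (\<Sum>t\<in>U. of_real (L t) * point_fun t s g)"
    by (rule measure_fun_superset[OF U(1) sub])
  also have "\<dots> = (\<Sum>t\<in>U. \<Sum>w\<in>?W. of_real (conv x y w) * (of_real (conv w z t) * point_fun t s g))"
    by (simp add: L_def sum_distrib_right mult.assoc)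
  also have "\<dots> = (\<Sum>w\<in>?W. of_real (conv x y w) * (\<Sum>t\<in>U. of_real (conv w z t) * point_fun t s g))"
    by (subst sum.swap) (simp add: sum_distrib_left)
  also have "\<dots> = (\<Sum>w\<in>?W. of_real (conv x y w) * pair_mult (point_fun w) (point_fun z) s g)"
  proof (rule sum.cong[OF refl])
    fix v assume v: "v \<in> ?W"
    have "{t. conv v z t \<noteq> 0} \<subseteq> U" using v unfolding U_def by blast
    from measure_fun_superset[OF U(1) this] conv_measure(2)[OF w[OF v] K(3) g]
    show "of_real (conv x y v) * (\<Sum>t\<in>U. of_real (conv v z t) * point_fun t s g) =
        of_real (conv x y v) * pair_mult (point_fun v) (point_fun z) s g" by simp
  qed
  also have "\<dots> = pair_mult (measure_fun (conv x y)) (point_fun z) s g"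
    unfolding measure_fun_def[abs_def] by (rule pair_mult_sum[symmetric])
  also have "\<dots> = pair_mult (pair_mult (point_fun x) (point_fun y)) (point_fun z) s g"
    by (rule pair_mult_cong[OF conv_measure(2)[OF K(1,2)] g])
  finally show "measure_fun L s g = pair_mult (pair_mult (point_fun x) (point_fun y)) (point_fun z) s g" .
qed

text \<open>Commutativity turns \<open>x * (y * z)\<close> into \<open>(y * z) * x\<close>, so that
  both bracketings are left-bracketed triple products and differ by a cyclic shift.\<close>

lemma point_assoc_iff:
  "point_assoc K conv \<longleftrightarrow> (\<forall>x\<in>K. \<forall>y\<in>K. \<forall>z\<in>K. \<forall>s. \<forall>g\<in>mark_dom s.
     pair_mult (pair_mult (point_fun x) (point_fun y)) (point_fun z) s g =
     pair_mult (pair_mult (point_fun y) (point_fun z)) (point_fun x) s g)"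
proof -
  define L where "L x y z t = (\<Sum>w | conv x y w \<noteq> 0. conv x y w * conv w z t)" for x y z t
  have R: "(\<Sum>w | conv y z w \<noteq> 0. conv y z w * conv x w t) = L y z x t"
    if "x \<in> K" "y \<in> K" "z \<in> K" for x y z t
    unfolding L_def using conv_commute[OF that(1)] conv_support(2)[OF that(2,3)] by (intro sum.cong) auto
  have "(\<forall>t. L x y z t = L y z x t) \<longleftrightarrow> (\<forall>s. \<forall>g\<in>mark_dom s.
     pair_mult (pair_mult (point_fun x) (point_fun y)) (point_fun z) s g =
     pair_mult (pair_mult (point_fun y) (point_fun z)) (point_fun x) s g)" (is "?l \<longleftrightarrow> ?r")
    if K: "x \<in> K" "y \<in> K" "z \<in> K" for x y z
  proof
    note 1 = triple_conv[OF K, folded L_def] and 2 = triple_conv[OF K(2,3,1), folded L_def]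
    show ?r if ?l
    proof (intro allI ballI)
      fix s g assume g: "g \<in> mark_dom s"
      have "L x y z = L y z x" using that by blast
      then show "pair_mult (pair_mult (point_fun x) (point_fun y)) (point_fun z) s g =
          pair_mult (pair_mult (point_fun y) (point_fun z)) (point_fun x) s g"
        using 1(3)[OF g] 2(3)[OF g] by simp
    qed
    show ?l if ?r
    proof -
      have "L x y z = L y z x"
        by (rule measure_fun_inject[OF 1(1,2) 2(1,2)]) (use 1(3) 2(3) that in simp)
      then show ?thesis by simp
    qed
  qed
  then show ?thesis unfolding point_assoc_def L_def[symmetric] using R by simp
qed

section \<open>Associativity and admissibility\<close>

lemma trivial_points: "(ch G trivial_rep, Circ) \<in> K" "(ch HG trivial_rep, Bullet) \<in> K"
  using irr_rep_trivial sub.irr_rep_trivial by (auto simp: dual_union_def)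

lemma admissible_if_point_assoc:
  assumes "point_assoc K conv"
  shows "admissible_pair G T H"
  unfolding admissible_pair_def
proof (intro allI impI ballI)
  fix \<tau> g s assume t: "irr_rep HG HT \<tau>" and g: "g \<in> H" and s: "s \<in> {s \<in> carrier G. s \<otimes> g \<otimes> inv s \<in> H}"
  \<comment> \<open>With a trivial \<open>Bullet\<close> point in the last two places, one
    bracketing induces \<open>\<tau>\<close> and the other induces the trivial character and
    multiplies by \<open>\<tau>\<close>.\<close>
  let ?x = "(ch HG \<tau>, Bullet)" and ?y = "(ch HG trivial_rep, Bullet)"
  have x: "?x \<in> K" using t by (auto simp: dual_union_def)
  have one: "ch HG trivial_rep h = 1" if "h \<in> H" for h using that by (simp add: sub.ch_trivial)
  have eq: "ind_fun (ch HG \<tau>) h = ind_fun (ch HG trivial_rep) h * ch HG \<tau> h" if h: "h \<in> H" for h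
  proof -
    have "pair_mult (pair_mult (point_fun ?x) (point_fun ?y)) (point_fun ?y) Bullet h =
        pair_mult (pair_mult (point_fun ?y) (point_fun ?y)) (point_fun ?x) Bullet h"
      using assms x trivial_points(2) h unfolding point_assoc_iff by (metis mark_dom_simps(2))
    moreover have "ind_fun (\<lambda>h. ch HG \<tau> h * ch HG trivial_rep h) h = ind_fun (ch HG \<tau>) h"
      by (rule ind_fun_cong) (simp add: one)
    moreover have "ind_fun (\<lambda>h. ch HG trivial_rep h * ch HG trivial_rep h) h = ind_fun (ch HG trivial_rep) h"
      by (rule ind_fun_cong) (simp add: one)
    ultimately show ?thesis using one[OF h] by (simp add: pair_mult_simps point_fun_def)
  qed
  have sc: "s \<in> carrier G" and sH: "s \<otimes> g \<otimes> inv s \<in> H" using s by auto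
  \<comment> \<open>Induced characters are invariant under conjugation by all of \<open>G\<close>,
    in particular by an \<open>s\<close> outside \<open>H\<close>. Cancelling the nonzero factor
    below passes this on to the character of \<open>\<tau>\<close>.\<close>
  have cl: "ind_fun (ch HG \<rho>) (s \<otimes> g \<otimes> inv s) = ind_fun (ch HG \<rho>) g" if "irr_rep HG HT \<rho>" for \<rho>
  proof -
    note fd = sub.irr_rep_fd[OF that]
    show ?thesis
      using ch_conj[OF fd_rep_ind(1)[OF fd] H_subset[OF g] sc] ch_ind[OF fd H_subset[OF g]] ch_ind[OF fd H_subset[OF sH]] by simp
  qed
  have "ind_fun (ch HG trivial_rep) g = ind_fun (\<lambda>_. 1) g" by (rule ind_fun_cong) (rule one)
  then have nz: "ind_fun (ch HG trivial_rep) g \<noteq> 0" using ind_fun_one_nonzero[OF g] by simp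
  have "ind_fun (ch HG trivial_rep) g * ch HG \<tau> (s \<otimes> g \<otimes> inv s) =
      ind_fun (ch HG trivial_rep) (s \<otimes> g \<otimes> inv s) * ch HG \<tau> (s \<otimes> g \<otimes> inv s)"
    by (simp only: cl[OF sub.irr_rep_trivial])
  also have "\<dots> = ind_fun (ch HG \<tau>) (s \<otimes> g \<otimes> inv s)" by (rule eq[OF sH, symmetric])
  also have "\<dots> = ind_fun (ch HG \<tau>) g" by (rule cl[OF t])
  also have "\<dots> = ind_fun (ch HG trivial_rep) g * ch HG \<tau> g" by (rule eq[OF g])
  finally show "ch HG \<tau> (s \<otimes> g \<otimes> inv s) = ch HG \<tau> g" by (simp only: mult_left_cancel[OF nz])
qed

lemma point_assoc_if_admissible:
  assumes adm: "admissible_pair G T H"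
  shows "point_assoc K conv"
proof -
  have C: "point_fun x Circ (s \<otimes> g \<otimes> inv s) = point_fun x Circ g"
    if "x \<in> K" "g \<in> carrier G" "s \<in> carrier G" for x g s
    using that(1) by (cases rule: dual_union_cases) (simp_all add: point_fun_def ch_conj[OF irr_rep_fd that(2,3)])
  have B: "point_fun x Bullet (s \<otimes> g \<otimes> inv s) = point_fun x Bullet g"
    if "x \<in> K" "g \<in> H" "s \<in> carrier G" "s \<otimes> g \<otimes> inv s \<in> H" for x g s
    using that(1)
  proof (cases rule: dual_union_cases)
    case (Bullet \<tau>)
    then show ?thesis using adm that(2-) unfolding admissible_pair_def by (simp add: point_fun_def)
  qed (simp add: point_fun_def)
  show ?thesis
    unfolding point_assoc_iff
  proof (intro ballI allI)
    fix x y z s g assume K: "x \<in> K" "y \<in> K" "z \<in> K" and g: "g \<in> mark_dom s"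
    let ?x = "point_fun x" and ?y = "point_fun y" and ?z = "point_fun z"
    show "pair_mult (pair_mult ?x ?y) ?z s g = pair_mult (pair_mult ?y ?z) ?x s g"
    proof (cases s)
      case Circ
      then have gc: "g \<in> carrier G" using g by simp
      \<comment> \<open>The \<open>Circ\<close> component is symmetric without admissibility. With
        primes for \<open>Bullet\<close> parts, the projection formula brings it to
        \<open>x y z + Ind (x' y') z + Ind (y' z') x + Ind (x' z') y\<close>.\<close>
      have P: "ind_fun (\<lambda>h. u Bullet h * v Bullet h * point_fun w Circ h) g =
          ind_fun (\<lambda>h. u Bullet h * v Bullet h) g * point_fun w Circ g" if "w \<in> K" for u v w
        by (rule ind_fun_mult_class_fun[OF gc]) (rule C[OF that gc])
      have D: "ind_fun (\<lambda>h. (u Circ h * v Bullet h + u Bullet h * v Circ h) * w Bullet h) g =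
          ind_fun (\<lambda>h. v Bullet h * w Bullet h * u Circ h) g + ind_fun (\<lambda>h. u Bullet h * w Bullet h * v Circ h) g"
        for u v w :: "mark \<Rightarrow> 'a \<Rightarrow> complex"
        unfolding ind_fun_add[symmetric] by (rule ind_fun_cong) (simp add: algebra_simps)
      have cm: "ind_fun (\<lambda>h. u Bullet h * v Bullet h) g = ind_fun (\<lambda>h. v Bullet h * u Bullet h) g"
        for u v :: "mark \<Rightarrow> 'a \<Rightarrow> complex" by (rule ind_fun_cong) (rule mult.commute)
      show ?thesis
        unfolding Circ pair_mult_simps D P[OF K(1)] P[OF K(2)] P[OF K(3)]
        using cm[of ?x ?z] cm[of ?x ?y] by (simp add: algebra_simps)
    next
      case Bullet
      then have gH: "g \<in> H" using g by simp
      \<comment> \<open>Admissibility enters here: \<open>Ind (x' y') z'\<close> and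
        \<open>Ind (y' z') x'\<close> both become \<open>x' y' z'\<close> times the induced constant
        1, while the other terms match directly.\<close>
      have I: "ind_fun (\<lambda>h. point_fun u Bullet h * point_fun v Bullet h) g =
          point_fun u Bullet g * point_fun v Bullet g * ind_fun (\<lambda>_. 1) g" if "u \<in> K" "v \<in> K" for u v
        by (rule ind_fun_invariant) (simp add: B[OF that(1) gH] B[OF that(2) gH])
      show ?thesis
        unfolding Bullet pair_mult_simps I[OF K(1,2)] I[OF K(2,3)] by (simp add: algebra_simps)
    qed
  qed
qed


subsection \<open>Unit and involution\<close>

definition unit_point :: "'a point" where
  "unit_point = (ch G trivial_rep, Circ)"

lemma measure_fun_dirac: "measure_fun (dirac x) s g = point_fun x s g"
  using measure_fun_superset[of "{x}" "dirac x" s g] by (auto simp: dirac_def)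

text \<open>As a pair the trivial character is \<open>(1, 0)\<close>, the unit for
  \<open>pair_mult\<close>.\<close>

lemma conv_unit:
  assumes x: "x \<in> K" shows "conv unit_point x = dirac x"
proof (rule measure_fun_inject)
  note e = trivial_points(1)[folded unit_point_def]
  show "finite {z. conv unit_point x z \<noteq> 0}" "{z. conv unit_point x z \<noteq> 0} \<subseteq> K"
    by (rule conv_support[OF e x])+
  show "finite {z. dirac x z \<noteq> 0}" "{z. dirac x z \<noteq> 0} \<subseteq> K" using x by (auto simp: dirac_def)
  fix s g assume g: "g \<in> mark_dom s"
  have gc: "g \<in> carrier G" using g H_subset by (cases s) auto
  have "pair_mult (point_fun unit_point) (point_fun x) s g = point_fun x s g"
    using gc by (cases s) (simp_all add: pair_mult_simps point_fun_def unit_point_def ch_trivial ind_fun_zero)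
  then show "measure_fun (conv unit_point x) s g = measure_fun (dirac x) s g"
    by (simp add: conv_measure(2)[OF e x g] measure_fun_dirac)
qed

text \<open>Given by values at inverses instead of a chosen representation, so that it is well
  defined on characters; dual representations show that it preserves \<open>K\<close>.\<close>

definition invol :: "'a point \<Rightarrow> 'a point" where
  "invol = (\<lambda>(\<psi>, s). (\<lambda>g\<in>mark_dom s. \<psi> (inv g), s))"

lemma invol_Circ: "irr_rep G T \<pi> \<Longrightarrow> invol (ch G \<pi>, Circ) = (ch G (dual_rep G \<pi>), Circ)"
  by (simp add: invol_def ch_dual[OF irr_rep_fd])

lemma invol_Bullet:
  assumes "irr_rep HG HT \<tau>" shows "invol (ch HG \<tau>, Bullet) = (ch HG (dual_rep HG \<tau>), Bullet)"
  unfolding sub.ch_dual[OF sub.irr_rep_fd[OF assms]]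
  by (auto simp: invol_def inv_sub intro!: restrict_ext)

lemma invol_closed: "x \<in> K \<Longrightarrow> invol x \<in> K"
  by (cases rule: dual_union_cases, assumption)
    (auto simp: invol_Circ invol_Bullet dual_union_def intro: irr_rep_dual sub.irr_rep_dual)

lemma invol_invol:
  assumes "x \<in> K" shows "invol (invol x) = x"
  using assms
proof (cases rule: dual_union_cases)
  case (Circ \<pi>)
  then show ?thesis by (simp add: invol_Circ irr_rep_dual dual_dual_ch[OF irr_rep_fd])
next
  case (Bullet \<tau>)
  then show ?thesis by (simp add: invol_Bullet sub.irr_rep_dual sub.dual_dual_ch[OF sub.irr_rep_fd])
qed

lemma mark_dom_inv: "g \<in> mark_dom s \<Longrightarrow> inv g \<in> mark_dom s"
  using H_closed(2) by (cases s) auto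

lemma point_fun_invol: "g \<in> mark_dom s \<Longrightarrow> point_fun (invol x) s g = point_fun x s (inv g)"
  by (cases x) (auto simp: point_fun_def invol_def)

text \<open>The fibre over a point \<open>z\<close> of \<open>K\<close> is the singleton of
  \<open>invol z\<close>; over other points it is empty, since \<open>invol\<close> preserves
  \<open>K\<close>.\<close>

lemma push_forward_invol:
  assumes "\<And>w. \<mu> w \<noteq> 0 \<Longrightarrow> w \<in> K"
  shows "push_forward K invol \<mu> z = (if z \<in> K then \<mu> (invol z) else 0)"
proof (cases "z \<in> K")
  case True
  have "{w \<in> K. invol w = z} = {invol z}"
  proof (intro subset_antisym subsetI)
    fix w assume "w \<in> {w \<in> K. invol w = z}"
    then show "w \<in> {invol z}" using invol_invol[of w] by auto
  next
    fix w assume "w \<in> {invol z}"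
    then show "w \<in> {w \<in> K. invol w = z}" using invol_closed[OF True] invol_invol[OF True] by simp
  qed
  then show ?thesis using True by (simp add: push_forward_def)
next
  case False
  have empty: "{w \<in> K. invol w = z} = {}" using False invol_closed by auto
  show ?thesis unfolding push_forward_def empty using False by simp
qed

text \<open>On pairs the involution substitutes \<open>inv g\<close> for \<open>g\<close>, which
  respects products and, by \<open>ind_fun_inv\<close>, induction. The reversal of factors is
  absorbed by commutativity.\<close>

lemma conv_invol:
  assumes x: "x \<in> K" and y: "y \<in> K"
  shows "conv (invol x) (invol y) = push_forward K invol (conv y x)"
proof (rule measure_fun_inject)
  note ix = invol_closed[OF x] and iy = invol_closed[OF y]
  note cs = conv_support[OF y x]
  define p where "p = push_forward K invol (conv y x)"
  have p: "p z = (if z \<in> K then conv y x (invol z) else 0)" for z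
    unfolding p_def by (rule push_forward_invol) (use cs in blast)
  have supp: "{z. p z \<noteq> 0} = invol ` {w. conv y x w \<noteq> 0}"
  proof (intro subset_antisym subsetI)
    fix z assume "z \<in> {z. p z \<noteq> 0}"
    then have "z \<in> K" "conv y x (invol z) \<noteq> 0" by (auto simp: p split: if_splits)
    then show "z \<in> invol ` {w. conv y x w \<noteq> 0}" using invol_invol[of z] by (intro image_eqI[of _ _ "invol z"]) auto
  next
    fix z assume "z \<in> invol ` {w. conv y x w \<noteq> 0}"
    then obtain w where "conv y x w \<noteq> 0" "z = invol w" by auto
    moreover then have "w \<in> K" using cs by blast
    ultimately show "z \<in> {z. p z \<noteq> 0}" using invol_closed invol_invol by (simp add: p)
  qed
  show "finite {z. conv (invol x) (invol y) z \<noteq> 0}" "{z. conv (invol x) (invol y) z \<noteq> 0} \<subseteq> K"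
    by (rule conv_support[OF ix iy])+
  show "finite {z. push_forward K invol (conv y x) z \<noteq> 0}" "{z. push_forward K invol (conv y x) z \<noteq> 0} \<subseteq> K"
    unfolding p_def[symmetric] supp using cs invol_closed by auto
  fix s g assume g: "g \<in> mark_dom s"
  have "inj_on invol {w. conv y x w \<noteq> 0}" using cs(2) invol_invol by (metis (no_types, lifting) inj_onI subsetD)
  then have "measure_fun p s g = (\<Sum>w | conv y x w \<noteq> 0. of_real (p (invol w)) * point_fun (invol w) s g)"
    unfolding measure_fun_def supp by (simp add: sum.reindex)
  also have "\<dots> = (\<Sum>w | conv y x w \<noteq> 0. of_real (conv y x w) * point_fun w s (inv g))"
    using cs(2) invol_closed invol_invol by (intro sum.cong) (auto simp: p point_fun_invol[OF g])
  also have "\<dots> = pair_mult (point_fun y) (point_fun x) s (inv g)"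
    using conv_measure(2)[OF y x mark_dom_inv[OF g]] by (simp add: measure_fun_def)
  also have "\<dots> = pair_mult (point_fun x) (point_fun y) s (inv g)" by (simp only: pair_mult_commute)
  also have "\<dots> = pair_mult (point_fun (invol x)) (point_fun (invol y)) s g"
  proof (cases s)
    case Circ
    then have gc: "g \<in> carrier G" using g by simp
    have "ind_fun (\<lambda>h. point_fun (invol x) Bullet h * point_fun (invol y) Bullet h) g =
        ind_fun (\<lambda>h. point_fun x Bullet h * point_fun y Bullet h) (inv g)"
      by (rule ind_fun_inv[OF gc]) (simp add: point_fun_invol)
    then show ?thesis using gc by (simp add: Circ pair_mult_simps point_fun_invol)
  next
    case Bullet
    then have "g \<in> H" "g \<in> carrier G" using g H_subset by auto
    then show ?thesis by (simp add: Bullet pair_mult_simps point_fun_invol)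
  qed
  finally show "measure_fun (conv (invol x) (invol y)) s g = measure_fun (push_forward K invol (conv y x)) s g"
    using conv_measure(2)[OF ix iy g] by (simp add: p_def)
qed

text \<open>The mean picks out the mass at the unit, as it kills all nontrivial irreducible characters.\<close>

lemma conv_unit_mass:
  assumes x: "x \<in> K" and y: "y \<in> K" and S: "finite S" "\<And>\<pi>. \<pi> \<in> S \<Longrightarrow> fd_rep G T \<pi>"
  obtains F M where "invariant_mean G F M"
    "\<And>\<pi>. \<pi> \<in> S \<Longrightarrow> entries_in F (rep_dim G \<pi>) (rep_dim G \<pi>) \<pi>"
    "M (\<lambda>g. pair_mult (point_fun x) (point_fun y) Circ g) = of_real (conv x y unit_point)"
proof -
  let ?S = "{z. conv x y z \<noteq> 0}"
  let ?A = "{\<psi>. (\<psi>, Circ) \<in> ?S}"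
  note cs = conv_support[OF x y]
  have finA: "finite ?A" by (rule finite_mark_section[OF cs(1)])
  have "\<exists>\<pi>. irr_rep G T \<pi> \<and> ch G \<pi> = \<psi>" if "\<psi> \<in> ?A" for \<psi>
  proof -
    have "(\<psi>, Circ) \<in> K" using that cs(2) by auto
    then have "\<psi> \<in> irr_chars G T" by (rule dual_union_Circ[THEN iffD1])
    then show ?thesis unfolding irr_chars_def by blast
  qed
  then obtain r where r: "\<And>\<psi>. \<psi> \<in> ?A \<Longrightarrow> irr_rep G T (r \<psi>)" "\<And>\<psi>. \<psi> \<in> ?A \<Longrightarrow> ch G (r \<psi>) = \<psi>" by metis
  \<comment> \<open>Tensoring with the trivial representation presents each \<open>\<psi>\<close> as
    a product of two characters, the form in which orthogonality is available.\<close>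
  let ?R = "(\<lambda>\<psi>. tensor_rep (r \<psi>) trivial_rep) ` ?A"
  have fdR: "fd_rep G T \<pi>" if "\<pi> \<in> ?R \<union> S" for \<pi>
    using that
  proof
    assume "\<pi> \<in> ?R"
    then obtain \<psi> where "\<psi> \<in> ?A" "\<pi> = tensor_rep (r \<psi>) trivial_rep" by blast
    then show ?thesis using fd_rep_tensor(1)[OF irr_rep_fd[OF r(1)] fd_rep_trivial(1)] by simp
  qed (rule S(2))
  \<comment> \<open>The mean covers \<open>S\<close> as well, so that the same mean of the product
    can be evaluated a second time, through the representations behind \<open>x\<close> and
    \<open>y\<close>.\<close>
  obtain F M where M: "invariant_mean G F M"
    and ent: "\<And>\<pi>. \<pi> \<in> ?R \<union> S \<Longrightarrow> entries_in F (rep_dim G \<pi>) (rep_dim G \<pi>) \<pi>"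
    using mean_for_reps[of "?R \<union> S"] finA S(1) fdR by blast
  have entr: "entries_in F (rep_dim G (r \<psi>) * rep_dim G trivial_rep) (rep_dim G (r \<psi>) * rep_dim G trivial_rep) (tensor_rep (r \<psi>) trivial_rep)"
    if "\<psi> \<in> ?A" for \<psi>
    using ent[of "tensor_rep (r \<psi>) trivial_rep"] that
    unfolding fd_rep_tensor(2)[OF irr_rep_fd[OF r(1)[OF that]] fd_rep_trivial(1)] by blast
  have eqA: "ch G (r \<psi>) g * ch G trivial_rep g = \<psi> g" if "\<psi> \<in> ?A" "g \<in> carrier G" for \<psi> g
    using that r(2) by (simp add: ch_trivial)
  note cp = ch_product_mean(1)[OF M irr_rep_fd[OF r(1)] fd_rep_trivial(1) entr]
  have inF: "(\<lambda>g. \<psi> g) \<in> F" if "\<psi> \<in> ?A" for \<psi>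
    by (rule invariant_mean_cong(1)[OF M cp[OF that that] eqA[OF that]])
  have dt: "ch G (dual_rep G trivial_rep) = ch G trivial_rep"
    unfolding ch_dual[OF fd_rep_trivial(1)] ch_trivial by (auto intro!: restrict_ext)
  have Mval: "M (\<lambda>g. \<psi> g) = (if \<psi> = ch G trivial_rep then 1 else 0)" if \<psi>: "\<psi> \<in> ?A" for \<psi>
  proof (cases "\<psi> = ch G trivial_rep")
    case True
    have "M (\<lambda>_. 1) = M (\<lambda>g. \<psi> g)"
      by (rule invariant_mean_cong(2)[OF M inF[OF \<psi>]]) (simp add: True ch_trivial)
    then show ?thesis using True invariant_mean_const(2)[OF M, of 1] by simp
  next
    case False
    have "M (\<lambda>g. \<psi> g) = M (\<lambda>g. ch G (r \<psi>) g * ch G trivial_rep g)"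
      by (rule invariant_mean_cong(2)[OF M cp[OF \<psi> \<psi>] eqA[OF \<psi>]])
    also have "\<dots> = 0"
      using ch_orthogonal[OF M r(1)[OF \<psi>] irr_rep_trivial entr[OF \<psi>]] False r(2)[OF \<psi>] dt by simp
    finally show ?thesis using False by simp
  qed
  define f where "f g = (\<Sum>\<psi>\<in>?A. of_real (conv x y (\<psi>, Circ)) * \<psi> g)" for g
  have fF: "f \<in> F" unfolding f_def
    by (rule invariant_mean_sum(1)[OF M]) (rule invariant_mean_cmult(1)[OF M inF])
  have "M f = (\<Sum>\<psi>\<in>?A. M (\<lambda>g. of_real (conv x y (\<psi>, Circ)) * \<psi> g))"
    unfolding f_def by (rule invariant_mean_sum(2)[OF M]) (rule invariant_mean_cmult(1)[OF M inF])
  also have "\<dots> = (\<Sum>\<psi>\<in>?A. if \<psi> = ch G trivial_rep then of_real (conv x y (\<psi>, Circ)) else 0)"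
    using invariant_mean_cmult(2)[OF M inF] Mval by (intro sum.cong) auto
  also have "\<dots> = of_real (conv x y unit_point)"
    using finA by (auto simp: unit_point_def)
  finally have Mf: "M f = of_real (conv x y unit_point)" .
  have "f g = pair_mult (point_fun x) (point_fun y) Circ g" if "g \<in> carrier G" for g
    using conv_measure(2)[OF x y, of g Circ] that
    unfolding measure_fun_def sum_point_fun[OF cs(1)] f_def by simp
  from invariant_mean_cong(2)[OF M fF this] Mf
  have mass: "M (\<lambda>g. pair_mult (point_fun x) (point_fun y) Circ g) = of_real (conv x y unit_point)" by simp
  show thesis by (rule that[OF M _ mass], rule ent) simp
qed

lemma ch_eq_dual_swap:
  assumes "irr_rep G T \<rho>" "irr_rep G T \<sigma>" "ch G \<rho> = ch G (dual_rep G \<sigma>)"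
  shows "ch G \<sigma> = ch G (dual_rep G \<rho>)"
proof -
  have "(ch G \<sigma>, Circ) \<in> K" using assms(2) by (auto simp: dual_union_def)
  from invol_invol[OF this] show ?thesis
    unfolding invol_Circ[OF assms(2)] assms(3)[symmetric] invol_Circ[OF assms(1)] by simp
qed

lemma ch_eq_dual_swap_sub:
  assumes "irr_rep HG HT \<rho>" "irr_rep HG HT \<sigma>" "ch HG \<rho> = ch HG (dual_rep HG \<sigma>)"
  shows "ch HG \<sigma> = ch HG (dual_rep HG \<rho>)"
proof -
  have "(ch HG \<sigma>, Bullet) \<in> K" using assms(2) by (auto simp: dual_union_def)
  from invol_invol[OF this] show ?thesis
    unfolding invol_Bullet[OF assms(2)] assms(3)[symmetric] invol_Bullet[OF assms(1)] by simp
qed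

text \<open>The mass at the unit is the mean of the \<open>Circ\<close> component of the product.
  For two \<open>Circ\<close> points this is orthogonality on \<open>G\<close>; for mixed marks the
  component is zero; for two \<open>Bullet\<close> points it is an induced product, whose mean is
  traced back to orthogonality on \<open>H\<close>.\<close>

lemma unit_in_support_iff:
  assumes x: "x \<in> K" and y: "y \<in> K"
  shows "conv x y unit_point \<noteq> 0 \<longleftrightarrow> x = invol y"
  using x
proof (cases rule: dual_union_cases)
  case X: (Circ \<rho>)
  show ?thesis using y
  proof (cases rule: dual_union_cases)
    case Y: (Circ \<sigma>)
    note r = X(2) and s = Y(2)
    note fr = irr_rep_fd[OF r] and fs = irr_rep_fd[OF s]
    note fd = fd_rep_dual(1)[OF fr]
    let ?S = "{tensor_rep \<rho> \<sigma>, tensor_rep \<rho> (dual_rep G \<rho>)}"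
    obtain F M where M: "invariant_mean G F M"
      and ent: "\<And>\<pi>. \<pi> \<in> ?S \<Longrightarrow> entries_in F (rep_dim G \<pi>) (rep_dim G \<pi>) \<pi>"
      and mass: "M (\<lambda>g. pair_mult (point_fun x) (point_fun y) Circ g) = of_real (conv x y unit_point)"
      using conv_unit_mass[OF x y, of ?S] fd_rep_tensor(1)[OF fr fs] fd_rep_tensor(1)[OF fr fd] by blast
    have e1: "entries_in F (rep_dim G \<rho> * rep_dim G \<sigma>) (rep_dim G \<rho> * rep_dim G \<sigma>) (tensor_rep \<rho> \<sigma>)"
      using ent[of "tensor_rep \<rho> \<sigma>"] by (simp add: fd_rep_tensor(2)[OF fr fs])
    have e2: "entries_in F (rep_dim G \<rho> * rep_dim G \<rho>) (rep_dim G \<rho> * rep_dim G \<rho>) (tensor_rep \<rho> (dual_rep G \<rho>))"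
      using ent[of "tensor_rep \<rho> (dual_rep G \<rho>)"] by (simp add: fd_rep_tensor(2)[OF fr fd] fd_rep_dual(2)[OF fr])
    have "(\<lambda>g. pair_mult (point_fun x) (point_fun y) Circ g) = (\<lambda>g. ch G \<rho> g * ch G \<sigma> g)"
      by (simp add: X(1) Y(1) pair_mult_simps point_fun_def ind_fun_zero)
    then have mass': "M (\<lambda>g. ch G \<rho> g * ch G \<sigma> g) = of_real (conv x y unit_point)" using mass by simp
    have iff: "x = invol y \<longleftrightarrow> ch G \<rho> = ch G (dual_rep G \<sigma>)"
      using invol_Circ[OF s] by (simp add: X(1) Y(1))
    show ?thesis
    proof (cases "ch G \<rho> = ch G (dual_rep G \<sigma>)")
      case True
      have "ch G \<sigma> = ch G (dual_rep G \<rho>)" by (rule ch_eq_dual_swap[OF r s True])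
      then have "complex_of_real (conv x y unit_point) \<noteq> 0"
        using ch_norm[OF M r e2] mass' fd_repD(1)[OF fr] by auto
      then show ?thesis using iff True by simp
    next
      case False
      then show ?thesis using ch_orthogonal[OF M r s e1] mass' iff by simp
    qed
  next
    case Y: (Bullet \<tau>)
    obtain F M where M: "invariant_mean G F M"
      and mass: "M (\<lambda>g. pair_mult (point_fun x) (point_fun y) Circ g) = of_real (conv x y unit_point)"
      using conv_unit_mass[OF x y, of "{}"] by blast
    have "M (\<lambda>_. 0) = of_real (conv x y unit_point)"
      using mass by (simp add: X(1) Y(1) pair_mult_simps point_fun_def ind_fun_zero)
    then show ?thesis using invariant_mean_const(2)[OF M, of 0] by (simp add: X(1) Y(1) invol_def)
  qed
next
  case X: (Bullet \<rho>)
  show ?thesis using y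
  proof (cases rule: dual_union_cases)
    case Y: (Circ \<sigma>)
    obtain F M where M: "invariant_mean G F M"
      and mass: "M (\<lambda>g. pair_mult (point_fun x) (point_fun y) Circ g) = of_real (conv x y unit_point)"
      using conv_unit_mass[OF x y, of "{}"] by blast
    have "M (\<lambda>_. 0) = of_real (conv x y unit_point)"
      using mass by (simp add: X(1) Y(1) pair_mult_simps point_fun_def ind_fun_zero)
    then show ?thesis using invariant_mean_const(2)[OF M, of 0] by (simp add: X(1) Y(1) invol_def)
  next
    case Y: (Bullet \<sigma>)
    note r = X(2) and s = Y(2)
    note fr = sub.irr_rep_fd[OF r] and fs = sub.irr_rep_fd[OF s]
    note fd = sub.fd_rep_dual(1)[OF fr]
    let ?\<alpha> = "tensor_rep \<rho> \<sigma>" and ?\<beta> = "tensor_rep \<rho> (dual_rep HG \<rho>)"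
    note fa = sub.fd_rep_tensor[OF fr fs] and fb = sub.fd_rep_tensor[OF fr fd]
    \<comment> \<open>The induced trivial representation is included because its diagonal
      coefficients are the indicators of the conjugates of \<open>H\<close>, which
      \<open>conjugate_mean\<close> requires in \<open>F\<close>.\<close>
    let ?S = "{ind_rep G H ?\<alpha>, ind_rep G H ?\<beta>, ind_rep G H trivial_rep}"
    obtain F M where M: "invariant_mean G F M"
      and ent: "\<And>\<pi>. \<pi> \<in> ?S \<Longrightarrow> entries_in F (rep_dim G \<pi>) (rep_dim G \<pi>) \<pi>"
      and mass: "M (\<lambda>g. pair_mult (point_fun x) (point_fun y) Circ g) = of_real (conv x y unit_point)"
      using conv_unit_mass[OF x y, of ?S] fd_rep_ind(1)[OF fa(1)] fd_rep_ind(1)[OF fb(1)]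
        fd_rep_ind(1)[OF sub.fd_rep_trivial(1)] by blast
    define E where "E k f g = zero_ext f (ts ! k \<otimes> g \<otimes> inv (ts ! k))" for k f g
    \<comment> \<open>The \<open>k\<close>-th diagonal block of an induced representation is
      \<open>\<tau>\<close> transported to the conjugate of \<open>H\<close> by
      \<open>ts ! k\<close> and extended by zero, so its entries lie in \<open>F\<close>.\<close>
    have block: "E k (\<lambda>x. \<tau> x $$ (i, j)) \<in> F"
      if fd: "fd_rep HG HT \<tau>" and S: "ind_rep G H \<tau> \<in> ?S" and k: "k < ind" and ij: "i < rep_dim HG \<tau>" "j < rep_dim HG \<tau>"
      for \<tau> k i j
    proof -
      let ?d = "rep_dim HG \<tau>"
      have b: "k * ?d + i < ind * ?d" "k * ?d + j < ind * ?d" using k ij by (auto intro!: nat_mult_add_less)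
      have "(\<lambda>g. ind_rep G H \<tau> g $$ (k * ?d + i, k * ?d + j)) \<in> F"
        using ent[OF S] b unfolding fd_rep_ind(2)[OF fd] entries_in_def by blast
      moreover have "(\<lambda>g. ind_rep G H \<tau> g $$ (k * ?d + i, k * ?d + j)) = E k (\<lambda>x. \<tau> x $$ (i, j))"
        using ij by (simp add: ind_rep_index[OF b] E_def fun_eq_iff)
      ultimately show ?thesis by simp
    qed
    have oneE: "E k (\<lambda>_. 1) \<in> F" if k: "k < ind" for k
    proof -
      have "E k (\<lambda>x. trivial_rep x $$ (0, 0)) \<in> F"
        by (rule block[OF sub.fd_rep_trivial(1) _ k]) (simp_all add: sub.fd_rep_trivial(2))
      then show ?thesis by (simp add: trivial_rep_def)
    qed
    let ?\<phi> = "\<lambda>h. ch HG \<rho> h * ch HG \<sigma> h"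
    \<comment> \<open>The value that orthogonality on \<open>H\<close> gives to the product of the
      two characters; it does not depend on \<open>k\<close>.\<close>
    define v :: complex where "v = (if ch HG \<rho> = ch HG (dual_rep HG \<sigma>) then 1 / of_nat (rep_dim HG \<rho> * rep_dim HG \<rho>) else 0)"
    have val: "E k ?\<phi> \<in> F \<and> of_nat ind * M (E k ?\<phi>) = v" if k: "k < ind" for k
    proof -
      note M' = conjugate_mean[OF M k oneE[OF k, unfolded E_def], folded E_def]
      let ?F' = "{f. E k f \<in> F}"
      have ent': "entries_in ?F' (rep_dim HG \<tau>) (rep_dim HG \<tau>) \<tau>"
        if "fd_rep HG HT \<tau>" "ind_rep G H \<tau> \<in> ?S" for \<tau>
        using block[OF that k] unfolding entries_in_def by simp
      have e1: "entries_in ?F' (rep_dim HG \<rho> * rep_dim HG \<sigma>) (rep_dim HG \<rho> * rep_dim HG \<sigma>) ?\<alpha>"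
        using ent'[OF fa(1)] by (simp add: fa(2))
      have e2: "entries_in ?F' (rep_dim HG \<rho> * rep_dim HG \<rho>) (rep_dim HG \<rho> * rep_dim HG \<rho>) ?\<beta>"
        using ent'[OF fb(1)] by (simp add: fb(2) sub.fd_rep_dual(2)[OF fr])
      have "E k ?\<phi> \<in> F" using sub.ch_product_mean(1)[OF M' fr fs e1] by simp
      moreover have "of_nat ind * M (E k ?\<phi>) = v"
      proof (cases "ch HG \<rho> = ch HG (dual_rep HG \<sigma>)")
        case True
        have "ch HG \<sigma> = ch HG (dual_rep HG \<rho>)" by (rule ch_eq_dual_swap_sub[OF r s True])
        then show ?thesis using sub.ch_norm[OF M' r e2] True by (simp add: v_def)
      next
        case False
        then show ?thesis using sub.ch_orthogonal[OF M' r s e1] by (simp add: v_def)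
      qed
      ultimately show ?thesis ..
    qed
    have "pair_mult (point_fun x) (point_fun y) Circ g = (1 / of_nat ind) * (\<Sum>k<ind. E k ?\<phi> g)" for g
      by (simp add: X(1) Y(1) pair_mult_simps point_fun_def ind_fun_def E_def)
    then have "of_real (conv x y unit_point) = M (\<lambda>g. (1 / of_nat ind) * (\<Sum>k<ind. E k ?\<phi> g))"
      using mass by simp
    also have "\<dots> = (1 / of_nat ind) * M (\<lambda>g. \<Sum>k<ind. E k ?\<phi> g)"
      using val by (intro invariant_mean_cmult(2)[OF M] invariant_mean_sum(1)[OF M]) simp
    also have "M (\<lambda>g. \<Sum>k<ind. E k ?\<phi> g) = (\<Sum>k<ind. M (E k ?\<phi>))"
      using val by (intro invariant_mean_sum(2)[OF M]) simp
    \<comment> \<open>Undoing the rescaling by \<open>ind\<close>, each conjugate contributes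
      \<open>v / ind\<close>. The average over all \<open>ind\<close> of them is again
      \<open>v / ind\<close>, which vanishes only with \<open>v\<close>.\<close>
    also have "\<dots> = (\<Sum>k<ind. v / of_nat ind)"
      using val ind_pos by (intro sum.cong refl) (simp add: eq_divide_eq mult.commute)
    finally have "complex_of_real (conv x y unit_point) = v / of_nat ind" using ind_pos by simp
    moreover have "v \<noteq> 0 \<longleftrightarrow> ch HG \<rho> = ch HG (dual_rep HG \<sigma>)"
      using sub.fd_repD(1)[OF fr] by (auto simp: v_def)
    moreover have "x = invol y \<longleftrightarrow> ch HG \<rho> = ch HG (dual_rep HG \<sigma>)"
      using invol_Bullet[OF s] by (simp add: X(1) Y(1))
    ultimately show ?thesis using ind_pos by (metis divide_eq_0_iff of_nat_0_eq_iff of_real_eq_0_iff less_numeral_extra(3))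
  qed
qed

theorem hypergroup_iff_admissible:
  "discrete_hypergroup K conv \<longleftrightarrow> admissible_pair G T H"
proof
  assume h: "discrete_hypergroup K conv"
  have "point_assoc K conv"
    by (rule point_assoc_if_conv_ext_assoc) (use h in \<open>simp_all add: discrete_hypergroup_def\<close>)
  then show "admissible_pair G T H" by (rule admissible_if_point_assoc)
next
  assume adm: "admissible_pair G T H"
  note pa = point_assoc_if_admissible[OF adm]
  note e = trivial_points(1)[folded unit_point_def]
  show "discrete_hypergroup K conv"
    unfolding discrete_hypergroup_def
  proof (intro conjI)
    show "\<forall>x\<in>K. \<forall>y\<in>K. fin_prob_measure K (conv x y)" using conv_measure(1) by blast
    show "\<forall>\<mu>\<in>bounded_measures K. \<forall>\<nu>\<in>bounded_measures K. \<forall>\<xi>\<in>bounded_measures K.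
        conv_ext K conv (conv_ext K conv \<mu> \<nu>) \<xi> = conv_ext K conv \<mu> (conv_ext K conv \<nu> \<xi>)"
      using conv_ext_assoc_if_point_assoc[OF conv_measure(1) pa] by blast
    show "\<exists>e\<in>K. (\<forall>x\<in>K. conv e x = dirac x \<and> conv x e = dirac x) \<and>
        (\<exists>invol\<in>K \<rightarrow> K. (\<forall>x\<in>K. invol (invol x) = x) \<and>
           (\<forall>x\<in>K. \<forall>y\<in>K. conv (invol x) (invol y) = push_forward K invol (conv y x)) \<and>
           (\<forall>x\<in>K. \<forall>y\<in>K. e \<in> {z. conv x y z \<noteq> 0} \<longleftrightarrow> x = invol y))"
    proof (intro bexI[OF _ e] bexI[of _ invol] conjI ballI)
      fix x assume x: "x \<in> K"
      show "conv unit_point x = dirac x" by (rule conv_unit[OF x])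
      then show "conv x unit_point = dirac x" using conv_commute[OF x e] by simp
      show "invol (invol x) = x" by (rule invol_invol[OF x])
      fix y assume y: "y \<in> K"
      show "conv (invol x) (invol y) = push_forward K invol (conv y x)" by (rule conv_invol[OF x y])
      show "unit_point \<in> {z. conv x y z \<noteq> 0} \<longleftrightarrow> x = invol y" using unit_in_support_iff[OF x y] by simp
    qed (use invol_closed in blast)
  qed
qed

end

theorem mainTheorem1:
  fixes G :: "('a, 'b) monoid_scheme" and T :: "'a topology" and G\<^sub>0 :: "'a set"
  assumes "compact_group G T"
    and "second_countable T"
    and "subgroup G\<^sub>0 G"
    and "closedin T G\<^sub>0"
    and "finite (rcosets\<^bsub>G\<^esub> G\<^sub>0)"
  shows "discrete_hypergroup (dual_union G T G\<^sub>0) (dual_conv G T G\<^sub>0) \<longleftrightarrow> admissible_pair G T G\<^sub>0"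
proof -
  interpret compact_pair G T G\<^sub>0
    by (intro compact_pair.intro compact_grp.intro compact_pair_axioms.intro assms)
  show ?thesis by (rule hypergroup_iff_admissible)
qed

end
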